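(* Let $K$ be a closed subgroup of $O(n)$, let $G=\mathbb{R}^n\cdot K$ be the semidirect product, and let $P(G,K)$ be the set of all positive definite $(G,K)$-spherical functions on $\mathbb{E}^n=G/K$, with the subspace topology from the space $S(G,K)$ of all $(G,K)$-spherical functions. Then the map $\varphi_\xi^K\mapsto\pi(\xi)$ $(\xi\in\mathbb{R}^n)$ is a (well-defined) homeomorphism of $P(G,K)$ onto $\mathbb{R}^n/\!/K$. Thus $P(G,K)$ is parametrized topologically by the real form $\mathbb{R}^n/\!/K$ of the complex affine variety $\mathbb{C}^n/\!/K_{\mathbb{C}}$.
   Context: $b$ is the $\mathbb{C}$-bilinear form on $\mathbb{C}^n$ extending the standard inner product of $\mathbb{R}^n$; $K$ acts on $\mathbb{C}^n$ by complexification of its action on $\mathbb{R}^n$. $\mathbb{E}^n=G/K$ is identified with $\mathbb{R}^n$. For $\xi\in\mathbb{C}^n$, $\varphi_\xi^K(x)=\int_K e^{i\,b(x,k(\xi))}\,d\mu_K(k)$, with $\mu_K$ the Haar measure on $K$ of total mass $1$. A function $\varphi:G\to\mathbb{C}$ is $(G,K)$-spherical if it is continuous, bi-$K$-invariant, $\varphi(1)=1$, and for every $f\in C_c(K\backslash G/K)$ (continuous compactly supported bi-$K$-invariant functions on $G$) there is $\lambda_f\in\mathbb{C}$ with $f*\varphi=\lambda_f\varphi$. Right-$K$-invariant functions on $G$ are identified with functions on $\mathbb{E}^n$. It is positive definite if $\sum_{i,j}\varphi(g_j^{-1}g_i)\overline{c_j}c_i\ge 0$ whenever $m>0$, $c_1,\dots,c_m\in\mathbb{C}$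 and $g_1,\dots,g_m\in G$. $S(G,K)$ carries the weak topology from the maps $\widehat f(\varphi)=\int_G f(g)\varphi(g^{-1})\,d\mu_G(g)$, $f\in C_c(K\backslash G/K)$, with $\mu_G$ Haar measure on $G$. Complexification: with $\mathfrak{k}$ the Lie algebra of $K$, $K_{\mathbb{C}}^0$ is the analytic subgroup of $GL(n;\mathbb{C})$ with Lie algebra $\mathfrak{k}\otimes_{\mathbb{R}}\mathbb{C}$, and $K_{\mathbb{C}}:=K K_{\mathbb{C}}^0\subset O(n;\mathbb{C})$. The categorical quotient $\mathbb{C}^n/\!/K_{\mathbb{C}}$ is the set of equivalence classes for $\xi\sim\xi'$ iff $p(\xi)=p(\xi')$ for all $K_{\mathbb{C}}$-invariant polynomials $p$ on $\mathbb{C}^n$, an affine variety whose algebra of regular functions is the algebra of $K_{\mathbb{C}}$-invariant polynomials, with its classical (Euclidean) topology; $\pi:\mathbb{C}^n\to\mathbb{C}^n/\!/K_{\mathbb{C}}$ is the projection. $\mathbb{R}^n/\!/K$ denotes the set of equivalence classes in $\mathbb{R}^n$ for the same relation ($p(\xi)=p(\xi')$ for all $K$-invariant polynomials $p$), identified with the image $\pi(\mathbb{R}^n)\subset\mathbb{C}^n/\!/K_{\mathbb{C}}$ with the subspace topology. "Real form" is a name for this subset and carries no further assertion. *)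

theory Defs
  imports "HOL-Analysis.Analysis" "HOL-Algebra.Coset" "HOL-Algebra.Generated_Groups"
begin

section \<open>Spherical functions on topological groups\<close>

text \<open>
  A topological group is a HOL-Algebra group \<open>G\<close> whose carrier is a subset of a topological type
  and carries the subspace topology; \<open>K\<close> is a subset (in use: a compact subgroup) of the carrier.
  Functions on \<open>G\<close> that are members of a function space are taken \<open>extensional\<close>, so
  that equality of such functions is equality on the carrier.
\<close>

text \<open>
  Left Haar measures. No regularity is required: it is automatic for the second countable locally
  compact groups considered here. Those groups are unimodular, so left Haar measures are also right
  Haar measures.
\<close>

definition haar_measure :: "('a::topological_space, 'b) monoid_scheme \<Rightarrow> 'a measure \<Rightarrow> bool" where
  "haar_measure G M \<longleftrightarrow>
     sets M = sets (restrict_space borel (carrier G)) \<and>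
     (\<forall>g\<in>carrier G. \<forall>A\<in>sets M. emeasure M ((\<lambda>x. g \<otimes>\<^bsub>G\<^esub> x) ` A) = emeasure M A) \<and>
     (\<forall>C. compact C \<and> C \<subseteq> carrier G \<longrightarrow> emeasure M C < \<infinity>) \<and>
     emeasure M (space M) \<noteq> 0"

definition bi_invariant :: "('a, 'b) monoid_scheme \<Rightarrow> 'a set \<Rightarrow> ('a \<Rightarrow> 'c) \<Rightarrow> bool" where
  "bi_invariant G K f \<longleftrightarrow>
     (\<forall>g\<in>carrier G. \<forall>k\<in>K. \<forall>l\<in>K. f (k \<otimes>\<^bsub>G\<^esub> g \<otimes>\<^bsub>G\<^esub> l) = f g)"

text \<open>The space \<open>C\<^sub>c(K\G/K)\<close>.\<close>

definition Cc_biinv ::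
  "('a::topological_space, 'b) monoid_scheme \<Rightarrow> 'a set \<Rightarrow> ('a \<Rightarrow> complex) set" where
  "Cc_biinv G K =
     {f. continuous_on (carrier G) f \<and> bi_invariant G K f \<and>
         (\<exists>C. compact C \<and> C \<subseteq> carrier G \<and> (\<forall>g\<in>carrier G - C. f g = 0))}"

definition group_convolution ::
  "('a, 'b) monoid_scheme \<Rightarrow> 'a measure \<Rightarrow> ('a \<Rightarrow> complex) \<Rightarrow> ('a \<Rightarrow> complex) \<Rightarrow> 'a \<Rightarrow> complex" where
  "group_convolution G M f h g = (LINT x|M. f x * h (inv\<^bsub>G\<^esub> x \<otimes>\<^bsub>G\<^esub> g))"

text \<open>The space \<open>S(G,K)\<close>; \<open>M\<close> is a Haar measure on \<open>G\<close>.\<close>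

definition spherical_functions ::
  "('a::topological_space, 'b) monoid_scheme \<Rightarrow> 'a set \<Rightarrow> 'a measure \<Rightarrow> ('a \<Rightarrow> complex) set" where
  "spherical_functions G K M =
     {\<phi> \<in> extensional (carrier G).
        continuous_on (carrier G) \<phi> \<and> bi_invariant G K \<phi> \<and> \<phi> \<one>\<^bsub>G\<^esub> = 1 \<and>
        (\<forall>f\<in>Cc_biinv G K. \<exists>c. \<forall>g\<in>carrier G. group_convolution G M f \<phi> g = c * \<phi> g)}"

definition positive_definite_on :: "('a, 'b) monoid_scheme \<Rightarrow> ('a \<Rightarrow> complex) \<Rightarrow> bool" where
  "positive_definite_on G \<phi> \<longleftrightarrow>
     (\<forall>m>0. \<forall>(c :: nat \<Rightarrow> complex) g. (\<forall>i<m. g i \<in> carrier G) \<longrightarrow>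
        (\<Sum>i<m. \<Sum>j<m. \<phi> (inv\<^bsub>G\<^esub> (g j) \<otimes>\<^bsub>G\<^esub> g i) * cnj (c j) * c i) \<in> \<real>\<^sub>\<ge>\<^sub>0)"

text \<open>The space \<open>P(G,K)\<close>.\<close>

definition posdef_spherical_functions ::
  "('a::topological_space, 'b) monoid_scheme \<Rightarrow> 'a set \<Rightarrow> 'a measure \<Rightarrow> ('a \<Rightarrow> complex) set" where
  "posdef_spherical_functions G K M =
     {\<phi> \<in> spherical_functions G K M. positive_definite_on G \<phi>}"

definition spherical_transform ::
  "('a, 'b) monoid_scheme \<Rightarrow> 'a measure \<Rightarrow> ('a \<Rightarrow> complex) \<Rightarrow> ('a \<Rightarrow> complex) \<Rightarrow> complex" where
  "spherical_transform G M f \<phi> = (LINT g|M. f g * \<phi> (inv\<^bsub>G\<^esub> g))"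

text \<open>The weak topology on \<open>S(G,K)\<close>.\<close>

definition spherical_topology ::
  "('a::topological_space, 'b) monoid_scheme \<Rightarrow> 'a set \<Rightarrow> 'a measure \<Rightarrow> ('a \<Rightarrow> complex) topology" where
  "spherical_topology G K M =
     topology_generated_by
       {{\<phi> \<in> spherical_functions G K M. spherical_transform G M f \<phi> \<in> U} | f U.
          f \<in> Cc_biinv G K \<and> open U}"

lemma topspace_spherical_topology:
  "topspace (spherical_topology G K M) = spherical_functions G K M"
proof -
  have "(\<lambda>_. 0) \<in> Cc_biinv G K"
    by (auto simp: Cc_biinv_def bi_invariant_def intro: exI[of _ "{}"])
  then have "spherical_functions G K M \<in>
      {{\<phi> \<in> spherical_functions G K M. spherical_transform G M f \<phi> \<in> U} | f U.
         f \<in> Cc_biinv G K \<and> open U}"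
    by (auto intro!: exI[of _ "\<lambda>_. 0"] exI[of _ UNIV])
  then show ?thesis
    unfolding spherical_topology_def topology_generated_by_topspace by blast
qed


section \<open>Matrix groups and the semidirect product with the translations\<close>

definition orthogonal_group :: "(real^'n^'n) monoid" where
  "orthogonal_group = \<lparr>carrier = {A. orthogonal_matrix A}, mult = (**), one = mat 1\<rparr>"

definition complex_GL :: "(complex^'n^'n) monoid" where
  "complex_GL = \<lparr>carrier = {A. invertible A}, mult = (**), one = mat 1\<rparr>"

definition motion_group :: "(real^'n^'n) set \<Rightarrow> ((real^'n) \<times> (real^'n^'n)) monoid" where
  "motion_group K =
     \<lparr>carrier = UNIV \<times> K, mult = (\<lambda>(x, k) (y, l). (x + k *v y, k ** l)), one = (0, mat 1)\<rparr>"

lemma group_orthogonal_group: "group orthogonal_group"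
proof (rule groupI)
  fix A :: "real^'n^'n" assume "A \<in> carrier orthogonal_group"
  then show "\<exists>B\<in>carrier orthogonal_group. B \<otimes>\<^bsub>orthogonal_group\<^esub> A = \<one>\<^bsub>orthogonal_group\<^esub>"
    by (intro bexI[of _ "transpose A"]) (auto simp: orthogonal_group_def orthogonal_matrix_def)
qed (auto simp: orthogonal_group_def orthogonal_matrix_mul orthogonal_matrix_id matrix_mul_assoc)

lemma group_complex_GL: "group complex_GL"
proof (rule groupI)
  fix A :: "complex^'n^'n" assume "A \<in> carrier complex_GL"
  then show "\<exists>B\<in>carrier complex_GL. B \<otimes>\<^bsub>complex_GL\<^esub> A = \<one>\<^bsub>complex_GL\<^esub>"
    by (auto simp: complex_GL_def invertible_def)
qed (auto simp: complex_GL_def invertible_mult matrix_mul_assoc invertible_def[of "mat 1"])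

lemma group_motion_group:
  assumes "subgroup K orthogonal_group"
  shows "group (motion_group K)"
proof -
  interpret O: group "orthogonal_group :: (real^'n^'n) monoid" by (rule group_orthogonal_group)
  interpret K: subgroup K orthogonal_group by fact
  have closed: "k ** l \<in> K" if "k \<in> K" "l \<in> K" for k l
    using K.m_closed[OF that] by (simp add: orthogonal_group_def)
  have one: "mat 1 \<in> K"
    using K.one_closed by (simp add: orthogonal_group_def)
  have inv: "\<exists>l\<in>K. l ** k = mat 1" if "k \<in> K" for k
    using K.m_inv_closed[OF that] O.l_inv[OF K.mem_carrier[OF that]]
    by (auto simp: orthogonal_group_def)
  show ?thesis
  proof (rule groupI)
    fix g assume "g \<in> carrier (motion_group K)"
    then obtain x k where g: "g = (x, k)" "k \<in> K" by (auto simp: motion_group_def)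
    obtain l where l: "l \<in> K" "l ** k = mat 1" using inv[OF g(2)] by blast
    then show "\<exists>h\<in>carrier (motion_group K). h \<otimes>\<^bsub>motion_group K\<^esub> g = \<one>\<^bsub>motion_group K\<^esub>"
      by (intro bexI[of _ "(- (l *v x), l)"]) (auto simp: motion_group_def g)
  qed (auto simp: motion_group_def closed one matrix_mul_assoc matrix_vector_right_distrib
        matrix_vector_mul_assoc add.assoc)
qed


section \<open>Complexification\<close>

definition complexify :: "real^'n \<Rightarrow> complex^'n" where
  "complexify x = (\<chi> i. complex_of_real (x $ i))"

abbreviation complexify_matrix :: "real^'n^'n \<Rightarrow> complex^'n^'n" where
  "complexify_matrix \<equiv> map_matrix complex_of_real"

text \<open>
  The exponential of matrices is defined here by its power series, since the multiplication of the
  type class structure on \<open>real^'n^'n\<close> is componentwise.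
\<close>

definition matrix_exp :: "'a::real_normed_field^'n^'n \<Rightarrow> 'a^'n^'n" where
  "matrix_exp A = (\<Sum>k. (1 / fact k) *\<^sub>R (((**) A ^^ k) (mat 1)))"

definition lie_algebra :: "(real^'n^'n) set \<Rightarrow> (real^'n^'n) set" where
  "lie_algebra K = {X. \<forall>t::real. matrix_exp (t *\<^sub>R X) \<in> K}"

text \<open>The image of \<open>\<kk> \<otimes> \<complex>\<close> in the complex matrices: all \<open>X + iY\<close> with \<open>X\<close>, \<open>Y\<close> in \<open>\<kk>\<close>.\<close>

definition complexified_lie_algebra :: "(real^'n^'n) set \<Rightarrow> (complex^'n^'n) set" where
  "complexified_lie_algebra K =
     {(\<chi> i j. Complex (X $ i $ j) (Y $ i $ j)) | X Y. X \<in> lie_algebra K \<and> Y \<in> lie_algebra K}"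

text \<open>The analytic subgroup with a given Lie algebra is the group generated by the exponentials.\<close>

definition complexified_identity_component :: "(real^'n^'n) set \<Rightarrow> (complex^'n^'n) set" where
  "complexified_identity_component K =
     generate complex_GL (matrix_exp ` complexified_lie_algebra K)"

definition complexification :: "(real^'n^'n) set \<Rightarrow> (complex^'n^'n) set" where
  "complexification K =
     (complexify_matrix ` K) <#>\<^bsub>complex_GL\<^esub> complexified_identity_component K"


section \<open>Categorical quotients\<close>

text \<open>Polynomials on \<open>\<complex>\<^sup>n\<close>, as functions.\<close>

inductive complex_polynomial :: "(complex^'n \<Rightarrow> complex) \<Rightarrow> bool" where
  coord: "complex_polynomial (\<lambda>\<xi>. \<xi> $ i)"
| const: "complex_polynomial (\<lambda>\<xi>. c)"
| add: "complex_polynomial p \<Longrightarrow> complex_polynomial q \<Longrightarrow> complex_polynomial (\<lambda>\<xi>. p \<xi> + q \<xi>)"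
| mult: "complex_polynomial p \<Longrightarrow> complex_polynomial q \<Longrightarrow> complex_polynomial (\<lambda>\<xi>. p \<xi> * q \<xi>)"

definition invariant_polynomials :: "(complex^'n^'n) set \<Rightarrow> (complex^'n \<Rightarrow> complex) set" where
  "invariant_polynomials H =
     {p. complex_polynomial p \<and> (\<forall>h\<in>H. \<forall>\<xi>. p (h *v \<xi>) = p \<xi>)}"

definition quotient_rel :: "(complex^'n^'n) set \<Rightarrow> ((complex^'n) \<times> (complex^'n)) set" where
  "quotient_rel H = {(\<xi>, \<eta>). \<forall>p\<in>invariant_polynomials H. p \<xi> = p \<eta>}"

definition categorical_quotient :: "(complex^'n^'n) set \<Rightarrow> (complex^'n) set set" where
  "categorical_quotient H = UNIV // quotient_rel H"

definition quotient_projection :: "(complex^'n^'n) set \<Rightarrow> complex^'n \<Rightarrow> (complex^'n) set" where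
  "quotient_projection H \<xi> = quotient_rel H `` {\<xi>}"

definition regular_functions :: "(complex^'n^'n) set \<Rightarrow> ((complex^'n) set \<Rightarrow> complex) set" where
  "regular_functions H = {r. r \<circ> quotient_projection H \<in> invariant_polynomials H}"

text \<open>
  The classical topology of an affine variety is the coarsest one for which all regular functions
  are continuous; it is the topology induced from \<open>\<complex>\<^sup>N\<close> by any choice of \<open>N\<close> generators of
  the algebra of regular functions.
\<close>

definition categorical_quotient_topology :: "(complex^'n^'n) set \<Rightarrow> (complex^'n) set topology" where
  "categorical_quotient_topology H =
     topology_generated_by
       {{c \<in> categorical_quotient H. r c \<in> U} | r U. r \<in> regular_functions H \<and> open U}"

lemma topspace_categorical_quotient_topology:
  "topspace (categorical_quotient_topology H) = categorical_quotient H"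
proof -
  have "(\<lambda>_. 0) \<in> regular_functions H"
    by (auto simp: regular_functions_def invariant_polynomials_def o_def
        intro: complex_polynomial.const)
  then have "categorical_quotient H \<in>
      {{c \<in> categorical_quotient H. r c \<in> U} | r U. r \<in> regular_functions H \<and> open U}"
    by (auto intro!: exI[of _ "\<lambda>_. 0"] exI[of _ UNIV])
  then show ?thesis
    unfolding categorical_quotient_topology_def topology_generated_by_topspace by blast
qed

text \<open>
  \<open>\<real>\<^sup>n//K\<close>, identified with the image of \<open>\<real>\<^sup>n\<close> in \<open>\<complex>\<^sup>n//K\<^sub>\<complex>\<close>.
\<close>

definition real_form :: "(real^'n^'n) set \<Rightarrow> (complex^'n) set set" where
  "real_form K = range (\<lambda>\<xi>. quotient_projection (complexification K) (complexify \<xi>))"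


section \<open>The functions \<open>\<phi>\<^sub>\<xi>\<close>\<close>

definition cbilinear :: "complex^'n \<Rightarrow> complex^'n \<Rightarrow> complex" where
  "cbilinear \<xi> \<eta> = (\<Sum>i\<in>UNIV. \<xi> $ i * \<eta> $ i)"

definition spherical_phi ::
  "(real^'n^'n) measure \<Rightarrow> complex^'n \<Rightarrow> real^'n \<Rightarrow> complex" where
  "spherical_phi \<mu> \<xi> x =
     (LINT k|\<mu>. exp (\<i> * cbilinear (complexify x) (complexify_matrix k *v \<xi>)))"

text \<open>The right-\<open>K\<close>-invariant function on the motion group given by a function on \<open>\<real>\<^sup>n = G/K\<close>.\<close>

definition lift_to_motion_group ::
  "(real^'n^'n) set \<Rightarrow> (real^'n \<Rightarrow> complex) \<Rightarrow> (real^'n) \<times> (real^'n^'n) \<Rightarrow> complex" where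
  "lift_to_motion_group K f = restrict (\<lambda>(x, k). f x) (carrier (motion_group K))"

end

theory Submission
  imports Defs "HOL-Probability.Probability"
begin

text \<open>
  A positive definite spherical function \<open>\<phi>\<close> is, as a function on \<open>\<real>\<^sup>n\<close>, a limit of Fourier
  transforms of finite measures, by a Gaussian smoothing of Bochner's theorem. If \<open>F\<close> is a test
  function with \<open>F * \<phi> = c \<phi>\<close>, the mean of \<open>|F^ - c|\<^sup>2\<close> against these measures tends to \<open>0\<close>, where
  \<open>F^\<close> is the Fourier transform of \<open>F\<close>. Hence the eigenvalues of finitely many test functions are
  approximated by the values of their transforms at a common real point; the Riemann--Lebesgue lemma
  and compactness give one real \<open>\<xi>\<close> that serves all test functions exactly, and then
  \<open>\<phi> = \<phi>\<^sub>\<xi>\<close>.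

  Polynomials invariant under \<open>K\<close> are invariant under \<open>K\<^sub>\<complex>\<close> because the infinitesimal invariance
  is complex linear. Expanding \<open>\<phi>\<^sub>\<xi>\<close> into a power series writes it in terms of invariant
  polynomials in \<open>\<xi>\<close>; conversely, differentiating \<open>\<phi>\<^sub>\<xi>\<close> recovers the mean over the orbit of
  every polynomial. So \<open>\<phi>\<^sub>\<xi>\<close> and \<open>\<pi>(\<xi>)\<close> determine each other. Both topologies are the initial
  ones of families of continuous functions on \<open>\<real>\<^sup>n\<close> that separate the same points and contain,
  near each point, a function that is small (or large) outside a compact set; by compactness such
  families define the same topology.
\<close>

section \<open>Polynomial invariants of the complexification\<close>

text \<open>The eigenvalue equations alone give only a character of the algebra of test functions,
  and nothing in them forces its parameter to be real; positive definiteness has to supply this. The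
  approximating measures show no more than that finitely many eigenvalues are nearly attained at a
  common point, and such points might run off to infinity as the approximation improves. A test
  function with nonzero eigenvalue prevents this, because its transform is small far out. The same
  kind of properness drives the comparison of the topologies: on the function side it comes from a
  transform that is nonzero at the given point, on the quotient side from the invariant
  \<open>cbilinear \<zeta> \<zeta>\<close>, which is the squared norm at real points. To reach R^n,
  Haar measure on \<open>G\<close> is replaced by its image \<nu>, which enters through its
  invariance, its finiteness on balls and its being nonzero; Haar measure on \<open>K\<close> is
  extended to a measure \<kappa> on all matrices that is concentrated on \<open>K\<close>.\<close>

definition matrix_power :: "'a::comm_semiring_1^'n^'n \<Rightarrow> nat \<Rightarrow> 'a^'n^'n" where
  "matrix_power A k = ((**) A ^^ k) (mat 1)"

lemma matrix_power_0 [simp]: "matrix_power A 0 = mat 1"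
  by (simp add: matrix_power_def)

lemma matrix_power_Suc: "matrix_power A (Suc k) = A ** matrix_power A k"
  by (simp add: matrix_power_def)

lemma matrix_power_Suc2: "matrix_power A (Suc k) = matrix_power A k ** A"
  by (induction k) (simp_all add: matrix_power_Suc matrix_mul_assoc)

lemma matrix_power_scaleR:
  fixes A :: "'a::real_normed_field^'n^'n"
  shows "matrix_power (t *\<^sub>R A) k = t ^ k *\<^sub>R matrix_power A k"
  by (induction k)
     (auto simp: matrix_power_Suc vec_eq_iff matrix_matrix_mult_def scaleR_sum_right algebra_simps)

text \<open>The sum of the norms of all entries dominates every row sum, which closes the induction;
  the bound compares each entry of the exponential series with a scalar exponential series.\<close>

lemma norm_matrix_power_entry_le:
  fixes A :: "'a::real_normed_field^'n^'n"
  shows "norm (matrix_power A k $ i $ j) \<le> (\<Sum>i\<in>UNIV. \<Sum>j\<in>UNIV. norm (A $ i $ j)) ^ k"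
proof (induction k arbitrary: i j)
  case 0
  then show ?case by (simp add: mat_def)
next
  case (Suc k)
  let ?c = "\<Sum>i\<in>UNIV. \<Sum>j\<in>UNIV. norm (A $ i $ j)"
  have c: "?c \<ge> 0" by (intro sum_nonneg) auto
  have "norm (matrix_power A (Suc k) $ i $ j) \<le> (\<Sum>l\<in>UNIV. norm (A $ i $ l) * norm (matrix_power A k $ l $ j))"
    by (simp add: matrix_power_Suc matrix_matrix_mult_def sum_norm_le norm_mult)
  also have "\<dots> \<le> (\<Sum>l\<in>UNIV. norm (A $ i $ l) * ?c ^ k)"
    by (intro sum_mono mult_left_mono Suc) auto
  also have "\<dots> = (\<Sum>l\<in>UNIV. norm (A $ i $ l)) * ?c ^ k"
    by (simp add: sum_distrib_right)
  also have "\<dots> \<le> ?c * ?c ^ k"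
    using c by (intro mult_right_mono member_le_sum[of i UNIV "\<lambda>i. \<Sum>j\<in>UNIV. norm (A $ i $ j)"])
      (auto intro: sum_nonneg)
  finally show ?case by simp
qed

text \<open>The parameter \<open>t\<close> ranges over the whole field because termwise
  differentiation of a power series asks for convergence at every field element.\<close>

lemma summable_matrix_exp_entry:
  fixes A :: "'a::{real_normed_field,banach}^'n^'n"
  shows "summable (\<lambda>k. matrix_power A k $ i $ j / fact k * t ^ k)"
proof (rule summable_comparison_test)
  let ?c = "\<Sum>i\<in>UNIV. \<Sum>j\<in>UNIV. norm (A $ i $ j)"
  show "summable (\<lambda>k. inverse (fact k) * (?c * norm t) ^ k)"
    by (rule summable_exp)
  show "\<exists>N. \<forall>n\<ge>N. norm (matrix_power A n $ i $ j / fact n * t ^ n) \<le> inverse (fact n) * (?c * norm t) ^ n"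
  proof (intro exI[of _ 0] allI impI)
    fix n
    have "norm (matrix_power A n $ i $ j) * norm t ^ n / fact n \<le> ?c ^ n * norm t ^ n / fact n"
      by (intro divide_right_mono mult_right_mono norm_matrix_power_entry_le) auto
    then show "norm (matrix_power A n $ i $ j / fact n * t ^ n) \<le> inverse (fact n) * (?c * norm t) ^ n"
      by (simp add: norm_mult norm_divide norm_power power_mult_distrib divide_simps mult_ac)
  qed
qed

text \<open>Turns each entry of the exponential into a scalar power series in the real parameter,
  the form in which it is differentiated.\<close>

lemma matrix_exp_entry:
  fixes A :: "'a::{real_normed_field,banach}^'n^'n"
  shows "(\<lambda>k. matrix_power A k $ i $ j / fact k * of_real t ^ k) sums (matrix_exp (t *\<^sub>R A) $ i $ j)"
proof -
  define S where "S = (\<chi> i j. \<Sum>k. matrix_power A k $ i $ j / fact k * of_real t ^ k)"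
  have entry: "((1 / fact k) *\<^sub>R matrix_power (t *\<^sub>R A) k) $ i $ j
      = matrix_power A k $ i $ j / fact k * of_real t ^ k" for k i j
    unfolding matrix_power_scaleR vector_scaleR_component
    by (simp only: scaleR_conv_of_real[where 'a='a] of_real_power of_real_divide of_real_fact of_real_1)
      (simp add: field_simps)
  have "(\<lambda>k. (1 / fact k) *\<^sub>R matrix_power (t *\<^sub>R A) k) sums S"
    unfolding sums_def
  proof (intro vec_tendstoI)
    fix i j
    show "(\<lambda>n. (\<Sum>k<n. (1 / fact k) *\<^sub>R matrix_power (t *\<^sub>R A) k) $ i $ j) \<longlonglongrightarrow> S $ i $ j"
      using summable_sums[OF summable_matrix_exp_entry[of A i j "of_real t"]]
      by (simp add: sum_component entry S_def sums_def del: vector_scaleR_component)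
  qed
  then have "matrix_exp (t *\<^sub>R A) = S"
    unfolding matrix_exp_def matrix_power_def[symmetric] by (rule sums_unique[symmetric])
  then show ?thesis
    using summable_sums[OF summable_matrix_exp_entry[of A i j "of_real t"]] by (simp add: S_def)
qed

lemma matrix_exp_0 [simp]: "matrix_exp 0 = (mat 1 :: 'a::{real_normed_field,banach}^'n^'n)"
proof (simp add: vec_eq_iff, intro allI)
  fix i j :: 'n
  have "(\<lambda>k. matrix_power (0 :: 'a^'n^'n) k $ i $ j / fact k * of_real 0 ^ k) sums (matrix_exp (0 *\<^sub>R 0) $ i $ j)"
    by (rule matrix_exp_entry)
  moreover have "(\<lambda>k. matrix_power (0 :: 'a^'n^'n) k $ i $ j / fact k * of_real 0 ^ k) sums (mat 1 $ i $ j)"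
    using powser_sums_zero[of "\<lambda>k. matrix_power (0 :: 'a^'n^'n) k $ i $ j / fact k"] by simp
  ultimately show "matrix_exp 0 $ i $ j = (mat 1 :: 'a^'n^'n) $ i $ j"
    by (simp add: sums_iff)
qed

text \<open>Two forms, because a factor \<open>A\<close> can be split off a power on the left
  (\<open>matrix_power_Suc\<close>) or on the right (\<open>matrix_power_Suc2\<close>).\<close>

lemma has_vector_derivative_matrix_exp:
  fixes A :: "'a::{real_normed_field,banach}^'n^'n"
  shows "((\<lambda>t. matrix_exp (t *\<^sub>R A) $ i $ j) has_vector_derivative (A ** matrix_exp (t *\<^sub>R A)) $ i $ j) (at t)"
    and "((\<lambda>t. matrix_exp (t *\<^sub>R A) $ i $ j) has_vector_derivative (matrix_exp (t *\<^sub>R A) ** A) $ i $ j) (at t)"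
proof -
  let ?c = "\<lambda>i j k. matrix_power A k $ i $ j / fact k"
  have "((\<lambda>x. \<Sum>k. ?c i j k * x ^ k) has_field_derivative (\<Sum>k. diffs (?c i j) k * of_real t ^ k)) (at (of_real t))"
    by (rule termdiffs_strong_converges_everywhere[OF summable_matrix_exp_entry])
  from has_vector_derivative_real_field[OF this, of UNIV]
  have *: "((\<lambda>t. matrix_exp (t *\<^sub>R A) $ i $ j) has_vector_derivative (\<Sum>k. diffs (?c i j) k * of_real t ^ k)) (at t)"
    using sums_unique[OF matrix_exp_entry[of A i j]] by simp
  have d: "diffs (?c i j) k = matrix_power A (Suc k) $ i $ j / fact k" for k
    by (simp add: diffs_def field_simps del: of_nat_Suc)
  have "(\<lambda>k. \<Sum>l\<in>UNIV. A $ i $ l * (?c l j k * of_real t ^ k)) sums (\<Sum>l\<in>UNIV. A $ i $ l * matrix_exp (t *\<^sub>R A) $ l $ j)"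
    by (intro sums_sum sums_mult matrix_exp_entry)
  moreover have "(\<Sum>l\<in>UNIV. A $ i $ l * (?c l j k * of_real t ^ k)) = diffs (?c i j) k * of_real t ^ k" for k
    unfolding d by (simp add: matrix_power_Suc matrix_matrix_mult_def sum_distrib_right sum_distrib_left sum_divide_distrib mult_ac)
  ultimately have "(\<Sum>k. diffs (?c i j) k * of_real t ^ k) = (A ** matrix_exp (t *\<^sub>R A)) $ i $ j"
    by (simp add: sums_iff matrix_matrix_mult_def)
  with * show "((\<lambda>t. matrix_exp (t *\<^sub>R A) $ i $ j) has_vector_derivative (A ** matrix_exp (t *\<^sub>R A)) $ i $ j) (at t)"
    by simp
  have "(\<lambda>k. \<Sum>l\<in>UNIV. (?c i l k * of_real t ^ k) * A $ l $ j) sums (\<Sum>l\<in>UNIV. matrix_exp (t *\<^sub>R A) $ i $ l * A $ l $ j)"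
    by (intro sums_sum sums_mult2 matrix_exp_entry)
  moreover have "(\<Sum>l\<in>UNIV. (?c i l k * of_real t ^ k) * A $ l $ j) = diffs (?c i j) k * of_real t ^ k" for k
    unfolding d by (simp add: matrix_power_Suc2 matrix_matrix_mult_def sum_distrib_right sum_distrib_left sum_divide_distrib mult_ac)
  ultimately have "(\<Sum>k. diffs (?c i j) k * of_real t ^ k) = (matrix_exp (t *\<^sub>R A) ** A) $ i $ j"
    by (simp add: sums_iff matrix_matrix_mult_def)
  with * show "((\<lambda>t. matrix_exp (t *\<^sub>R A) $ i $ j) has_vector_derivative (matrix_exp (t *\<^sub>R A) ** A) $ i $ j) (at t)"
    by simp
qed

text \<open>With the factor \<open>A\<close> placed between the two exponentials, the two terms of
  the product rule cancel; so the product is constant in \<open>t\<close> and equals its value at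
  \<open>t = 0\<close>.\<close>

lemma matrix_exp_minus_mult:
  fixes A :: "'a::{real_normed_field,banach}^'n^'n"
  shows "matrix_exp (- A) ** matrix_exp A = mat 1"
proof -
  define f where "f t = matrix_exp (t *\<^sub>R (- A)) ** matrix_exp (t *\<^sub>R A)" for t
  have f: "f t $ i $ j = (\<Sum>l\<in>UNIV. matrix_exp (t *\<^sub>R (- A)) $ i $ l * matrix_exp (t *\<^sub>R A) $ l $ j)" for t i j
    by (simp add: f_def matrix_matrix_mult_def)
  have "((\<lambda>t. f t $ i $ j) has_vector_derivative 0) (at t)" for t i j
  proof -
    let ?E = "matrix_exp (t *\<^sub>R A)" and ?F = "matrix_exp (t *\<^sub>R (- A))"
    have "((\<lambda>t. f t $ i $ j) has_vector_derivative
        (\<Sum>l\<in>UNIV. ?F $ i $ l * (A ** ?E) $ l $ j + (?F ** (- A)) $ i $ l * ?E $ l $ j)) (at t)"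
      unfolding f by (intro has_vector_derivative_sum has_vector_derivative_mult has_vector_derivative_matrix_exp)
    also have "(\<Sum>l\<in>UNIV. ?F $ i $ l * (A ** ?E) $ l $ j + (?F ** (- A)) $ i $ l * ?E $ l $ j)
        = (?F ** (A ** ?E)) $ i $ j + ((?F ** (- A)) ** ?E) $ i $ j"
      by (simp add: matrix_matrix_mult_def sum.distrib)
    also have "(?F ** (- A)) ** ?E = - (?F ** (A ** ?E))"
    proof -
      have "?F ** (- A) = - (?F ** A)"
        by (simp add: vec_eq_iff matrix_matrix_mult_def sum_negf)
      moreover have "(- B) ** ?E = - (B ** ?E)" for B
        by (simp add: vec_eq_iff matrix_matrix_mult_def sum_negf)
      ultimately show ?thesis by (simp add: matrix_mul_assoc)
    qed
    finally show ?thesis by simp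
  qed
  then have "f 1 $ i $ j = f 0 $ i $ j" for i j
    using has_vector_derivative_zero_constant[OF convex_UNIV, of "\<lambda>t. f t $ i $ j"] by (metis UNIV_I)
  then show ?thesis
    by (simp add: f_def vec_eq_iff)
qed

lemma invertible_matrix_exp:
  fixes A :: "'a::{real_normed_field,banach}^'n^'n"
  shows "invertible (matrix_exp A)"
  unfolding invertible_def
  using matrix_exp_minus_mult[of A] matrix_exp_minus_mult[of "- A"] by auto

section \<open>Invariance of polynomials under the complexified group\<close>

lemma map_matrix_of_real_mult:
  "complexify_matrix (A ** B) = complexify_matrix A ** complexify_matrix B"
  by (simp add: vec_eq_iff matrix_matrix_mult_def map_matrix_def)

lemma complexify_matrix_1: "complexify_matrix (mat 1) = mat 1"
  by (simp add: vec_eq_iff map_matrix_def mat_def)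

lemma complexify_matrix_mult_complexify:
  "complexify_matrix A *v complexify x = complexify (A *v x)"
  by (simp add: vec_eq_iff matrix_vector_mult_def map_matrix_def complexify_def)

lemma complexify_matrix_exp:
  "complexify_matrix (matrix_exp A) = matrix_exp (complexify_matrix A)"
proof (simp add: vec_eq_iff, intro allI)
  fix i j
  have pow: "matrix_power (complexify_matrix A) k = complexify_matrix (matrix_power A k)" for k
    by (induction k) (simp_all add: matrix_power_Suc map_matrix_of_real_mult complexify_matrix_1)
  have "(\<lambda>k. of_real (matrix_power A k $ i $ j / fact k * of_real 1 ^ k) :: complex) sums of_real (matrix_exp (1 *\<^sub>R A) $ i $ j)"
    using matrix_exp_entry by (rule sums_of_real)
  moreover have "(\<lambda>k. matrix_power (complexify_matrix A) k $ i $ j / fact k * of_real 1 ^ k) sums (matrix_exp (1 *\<^sub>R complexify_matrix A) $ i $ j)"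
    by (rule matrix_exp_entry)
  moreover have "matrix_power (complexify_matrix A) k $ i $ j = of_real (matrix_power A k $ i $ j)" for k
    unfolding pow by (simp add: map_matrix_def)
  ultimately show "complex_of_real (matrix_exp A $ i $ j) = matrix_exp (complexify_matrix A) $ i $ j"
    by (simp add: sums_iff)
qed

text \<open>A chain rule along real curves in which the derivative depends complex linearly on the
  velocity; \<open>D\<close> is the holomorphic gradient, built by structural induction on the
  polynomial.\<close>

lemma complex_polynomial_gradient:
  fixes p :: "complex^'n \<Rightarrow> complex"
  assumes "complex_polynomial p"
  obtains D :: "complex^'n \<Rightarrow> complex^'n" where
    "\<And>(\<gamma> :: real \<Rightarrow> complex^'n) \<gamma>' t. (\<And>i. ((\<lambda>t. \<gamma> t $ i) has_vector_derivative \<gamma>' $ i) (at t)) \<Longrightarrow>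
      ((\<lambda>t::real. p (\<gamma> t)) has_vector_derivative (\<Sum>i\<in>UNIV. D (\<gamma> t) $ i * \<gamma>' $ i)) (at t)"
proof -
  have "\<exists>D :: complex^'n \<Rightarrow> complex^'n. \<forall>(\<gamma> :: real \<Rightarrow> complex^'n) \<gamma>' t. (\<forall>i. ((\<lambda>t. \<gamma> t $ i) has_vector_derivative \<gamma>' $ i) (at t)) \<longrightarrow>
      ((\<lambda>t::real. p (\<gamma> t)) has_vector_derivative (\<Sum>i\<in>UNIV. D (\<gamma> t) $ i * \<gamma>' $ i)) (at t)"
    using assms
  proof induction
    case (coord i)
    have "(\<Sum>j\<in>UNIV. axis i 1 $ j * v $ j) = v $ i" for v :: "complex^'n"
      by (simp add: axis_def if_distrib[of "\<lambda>x. x * _"] sum.delta' cong: if_cong)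
    then show ?case
      by (intro exI[of _ "\<lambda>_. axis i 1"]) simp
  next
    case (const c)
    show ?case by (intro exI[of _ "\<lambda>_. 0"]) simp
  next
    case (add p q)
    then obtain D E where "\<forall>(\<gamma> :: real \<Rightarrow> complex^'n) \<gamma>' t. (\<forall>i. ((\<lambda>t. \<gamma> t $ i) has_vector_derivative \<gamma>' $ i) (at t)) \<longrightarrow>
      ((\<lambda>t::real. p (\<gamma> t)) has_vector_derivative (\<Sum>i\<in>UNIV. D (\<gamma> t) $ i * \<gamma>' $ i)) (at t)"
      "\<forall>(\<gamma> :: real \<Rightarrow> complex^'n) \<gamma>' t. (\<forall>i. ((\<lambda>t. \<gamma> t $ i) has_vector_derivative \<gamma>' $ i) (at t)) \<longrightarrow>
      ((\<lambda>t::real. q (\<gamma> t)) has_vector_derivative (\<Sum>i\<in>UNIV. E (\<gamma> t) $ i * \<gamma>' $ i)) (at t)"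
      by blast
    then show ?case
      by (intro exI[of _ "\<lambda>x. D x + E x"])
        (simp add: distrib_right sum.distrib has_vector_derivative_add)
  next
    case (mult p q)
    then obtain D E where DE: "\<forall>(\<gamma> :: real \<Rightarrow> complex^'n) \<gamma>' t. (\<forall>i. ((\<lambda>t. \<gamma> t $ i) has_vector_derivative \<gamma>' $ i) (at t)) \<longrightarrow>
      ((\<lambda>t::real. p (\<gamma> t)) has_vector_derivative (\<Sum>i\<in>UNIV. D (\<gamma> t) $ i * \<gamma>' $ i)) (at t)"
      "\<forall>(\<gamma> :: real \<Rightarrow> complex^'n) \<gamma>' t. (\<forall>i. ((\<lambda>t. \<gamma> t $ i) has_vector_derivative \<gamma>' $ i) (at t)) \<longrightarrow>
      ((\<lambda>t::real. q (\<gamma> t)) has_vector_derivative (\<Sum>i\<in>UNIV. E (\<gamma> t) $ i * \<gamma>' $ i)) (at t)"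
      by blast
    show ?case
    proof (intro exI[of _ "\<lambda>x. p x *s E x + q x *s D x"] allI impI)
      fix \<gamma> :: "real \<Rightarrow> complex^'n" and \<gamma>' t
      assume "\<forall>i. ((\<lambda>t. \<gamma> t $ i) has_vector_derivative \<gamma>' $ i) (at t)"
      then have "((\<lambda>t. p (\<gamma> t) * q (\<gamma> t)) has_vector_derivative
         p (\<gamma> t) * (\<Sum>i\<in>UNIV. E (\<gamma> t) $ i * \<gamma>' $ i) + (\<Sum>i\<in>UNIV. D (\<gamma> t) $ i * \<gamma>' $ i) * q (\<gamma> t)) (at t)"
        using DE by (intro has_vector_derivative_mult) auto
      then show "((\<lambda>t. p (\<gamma> t) * q (\<gamma> t)) has_vector_derivative
          (\<Sum>i\<in>UNIV. (p (\<gamma> t) *s E (\<gamma> t) + q (\<gamma> t) *s D (\<gamma> t)) $ i * \<gamma>' $ i)) (at t)"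
        by (simp add: sum_distrib_left sum_distrib_right sum.distrib algebra_simps)
    qed
  qed
  then show thesis using that by blast
qed

lemma has_vector_derivative_matrix_exp_orbit:
  fixes A :: "'a::{real_normed_field,banach}^'n^'n"
  shows "((\<lambda>t. (matrix_exp (t *\<^sub>R A) *v \<xi>) $ i) has_vector_derivative
     (A *v (matrix_exp (t *\<^sub>R A) *v \<xi>)) $ i) (at t)"
proof -
  have "((\<lambda>t. \<Sum>j\<in>UNIV. matrix_exp (t *\<^sub>R A) $ i $ j * \<xi> $ j) has_vector_derivative
     (\<Sum>j\<in>UNIV. (A ** matrix_exp (t *\<^sub>R A)) $ i $ j * \<xi> $ j)) (at t)"
    by (intro has_vector_derivative_sum bounded_linear.has_vector_derivative[OF bounded_linear_mult_left]
        has_vector_derivative_matrix_exp)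
  then show ?thesis
    unfolding matrix_vector_mul_assoc by (simp add: matrix_vector_mult_def)
qed

text \<open>Differentiating along real one-parameter groups at time \<open>0\<close> shows that the
  gradient at \<eta> annihilates \<open>X\<close> applied to \<eta>, for every complex vector
  \<eta>. By linearity the same holds for \<open>Z\<close>, whose real and imaginary parts lie in
  the Lie algebra. The derivative of \<open>p\<close> along the orbit of exp(tZ) is this pairing at
  the moved point, hence zero for all \<open>t\<close>.\<close>

lemma invariant_matrix_exp_complexified_lie_algebra:
  fixes p :: "complex^'n \<Rightarrow> complex"
  assumes p: "complex_polynomial p"
    and inv: "\<And>k \<xi>. k \<in> K \<Longrightarrow> p (complexify_matrix k *v \<xi>) = p \<xi>"
    and Z: "Z \<in> complexified_lie_algebra K"
  shows "p (matrix_exp Z *v \<xi>) = p \<xi>"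
proof -
  obtain D :: "complex^'n \<Rightarrow> complex^'n" where
    D: "\<And>(\<gamma> :: real \<Rightarrow> complex^'n) \<gamma>' t. (\<And>i. ((\<lambda>t. \<gamma> t $ i) has_vector_derivative \<gamma>' $ i) (at t)) \<Longrightarrow>
      ((\<lambda>t::real. p (\<gamma> t)) has_vector_derivative (\<Sum>i\<in>UNIV. D (\<gamma> t) $ i * \<gamma>' $ i)) (at t)"
    using complex_polynomial_gradient[OF p] by blast
  have real_case: "(\<Sum>i\<in>UNIV. D \<eta> $ i * (complexify_matrix X *v \<eta>) $ i) = 0"
    if X: "X \<in> lie_algebra K" for X \<eta>
  proof -
    let ?X = "complexify_matrix X"
    have *: "matrix_exp (t *\<^sub>R ?X) = complexify_matrix (matrix_exp (t *\<^sub>R X))" for t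
    proof -
      have "t *\<^sub>R ?X = complexify_matrix (t *\<^sub>R X)"
        by (simp add: vec_eq_iff map_matrix_def scaleR_conv_of_real[where 'a=complex])
      then show ?thesis by (simp add: complexify_matrix_exp)
    qed
    have "((\<lambda>t. p (matrix_exp (t *\<^sub>R ?X) *v \<eta>)) has_vector_derivative
        (\<Sum>i\<in>UNIV. D (matrix_exp (0 *\<^sub>R ?X) *v \<eta>) $ i * (?X *v (matrix_exp (0 *\<^sub>R ?X) *v \<eta>)) $ i)) (at 0)"
      by (rule D, rule has_vector_derivative_matrix_exp_orbit)
    moreover have "p (matrix_exp (t *\<^sub>R ?X) *v \<eta>) = p \<eta>" for t
      using X inv by (simp add: * lie_algebra_def)
    ultimately have "((\<lambda>t::real. p \<eta>) has_vector_derivative (\<Sum>i\<in>UNIV. D \<eta> $ i * (?X *v \<eta>) $ i)) (at 0)"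
      by simp
    then show ?thesis
      by (rule vector_derivative_unique_at[OF _ has_vector_derivative_const])
  qed
  obtain X Y where XY: "Z = (\<chi> i j. Complex (X $ i $ j) (Y $ i $ j))"
    "X \<in> lie_algebra K" "Y \<in> lie_algebra K"
    using Z by (auto simp: complexified_lie_algebra_def)
  have "(Z *v \<eta>) $ i = (complexify_matrix X *v \<eta>) $ i + \<i> * (complexify_matrix Y *v \<eta>) $ i" for \<eta> i
    by (simp add: XY(1) matrix_vector_mult_def map_matrix_def Complex_eq sum.distrib
        sum_distrib_left algebra_simps)
  then have zero: "(\<Sum>i\<in>UNIV. D \<eta> $ i * (Z *v \<eta>) $ i) = 0" for \<eta>
    using real_case[OF XY(2), of \<eta>] real_case[OF XY(3), of \<eta>]
    by (simp add: algebra_simps sum.distrib flip: sum_distrib_left)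
  have "((\<lambda>t. p (matrix_exp (t *\<^sub>R Z) *v \<xi>)) has_vector_derivative 0) (at t)" for t
    using D[of "\<lambda>t. matrix_exp (t *\<^sub>R Z) *v \<xi>", OF has_vector_derivative_matrix_exp_orbit]
    by (simp only: zero)
  then have "p (matrix_exp (1 *\<^sub>R Z) *v \<xi>) = p (matrix_exp (0 *\<^sub>R Z) *v \<xi>)"
    using has_vector_derivative_zero_constant[OF convex_UNIV, of "\<lambda>t. p (matrix_exp (t *\<^sub>R Z) *v \<xi>)"]
    by (metis UNIV_I)
  then show ?thesis by simp
qed

text \<open>Lets \<open>K\<close> itself stand for its complexification in all later arguments about
  the quotient.\<close>

lemma invariant_polynomials_complexification:
  assumes one: "mat 1 \<in> K"
  shows "invariant_polynomials (complexification K) = invariant_polynomials (complexify_matrix ` K)"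
proof (intro equalityI subsetI)
  fix p assume p: "p \<in> invariant_polynomials (complexification K)"
  have "mat 1 \<in> complexified_identity_component K"
    using generate.one[of complex_GL] by (simp add: complexified_identity_component_def complex_GL_def)
  then have "complexify_matrix k \<in> complexification K" if "k \<in> K" for k
    using that by (force simp: complexification_def set_mult_def complex_GL_def)
  then show "p \<in> invariant_polynomials (complexify_matrix ` K)"
    using p by (auto simp: invariant_polynomials_def)
next
  fix p assume "p \<in> invariant_polynomials (complexify_matrix ` K)"
  then have p: "complex_polynomial p" "\<And>k \<xi>. k \<in> K \<Longrightarrow> p (complexify_matrix k *v \<xi>) = p \<xi>"
    by (auto simp: invariant_polynomials_def)
  interpret GL: group complex_GL by (rule group_complex_GL)
  have gen: "\<forall>\<xi>. p (h *v \<xi>) = p \<xi>" if "h \<in> generate complex_GL (matrix_exp ` complexified_lie_algebra K)" for h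
    using that
  proof induction
    case one
    then show ?case by (simp add: complex_GL_def)
  next
    case (incl h)
    then show ?case using invariant_matrix_exp_complexified_lie_algebra[OF p] by auto
  next
    case (inv h)
    then have h: "h \<in> carrier complex_GL" by (auto simp: complex_GL_def invertible_matrix_exp)
    have "h ** inv\<^bsub>complex_GL\<^esub> h = mat 1"
      using GL.r_inv[OF h] by (simp add: complex_GL_def)
    \<comment> \<open>Invariance under \<open>h\<close>, used at the point that the inverse of
      \<open>h\<close> assigns to \<xi>, is invariance under the inverse.\<close>
    then have "h *v (inv\<^bsub>complex_GL\<^esub> h *v \<xi>) = \<xi>" for \<xi>
      by (simp add: matrix_vector_mul_assoc)
    moreover have "p (h *v \<eta>) = p \<eta>" for \<eta>
      using inv invariant_matrix_exp_complexified_lie_algebra[OF p] by auto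
    ultimately show ?case by metis
  next
    case (eng h1 h2)
    then show ?case by (simp add: complex_GL_def flip: matrix_vector_mul_assoc)
  qed
  have "p (h *v \<xi>) = p \<xi>" if "h \<in> complexification K" for h \<xi>
    using that gen p(2)
    by (auto simp: complexification_def complexified_identity_component_def set_mult_def complex_GL_def
        simp flip: matrix_vector_mul_assoc)
  then show "p \<in> invariant_polynomials (complexification K)"
    using p(1) by (auto simp: invariant_polynomials_def)
qed

section \<open>Bochner's theorem, approximately\<close>

lemma integral_translate_lborel:
  fixes f :: "'a::euclidean_space \<Rightarrow> 'b::{banach, second_countable_topology}"
  assumes [measurable]: "f \<in> borel_measurable borel"
  shows "(LINT x|lborel. f (x + c)) = (LINT x|lborel. f x)"
proof -
  have "(LINT x|lborel. f x) = (LINT x|distr lborel borel ((+) c). f x)"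
    by (simp add: lborel_distr_plus)
  also have "\<dots> = (LINT x|lborel. f (x + c))"
    by (subst integral_distr) (auto simp: add.commute)
  finally show ?thesis by simp
qed

lemma integrable_translate_lborel:
  fixes f :: "'a::euclidean_space \<Rightarrow> 'b::{banach, second_countable_topology}"
  assumes f: "integrable lborel f"
  shows "integrable lborel (\<lambda>x. f (x + c))"
proof -
  have [measurable]: "f \<in> borel_measurable borel"
    using borel_measurable_integrable[OF f] by simp
  have "integrable (distr lborel borel ((+) c)) f"
    using f by (simp add: lborel_distr_plus)
  then show ?thesis
    by (subst (asm) integrable_distr_eq) (auto simp: add.commute)
qed

text \<open>A non-integrable \<open>f\<close> does no harm: its integral is \<open>0\<close> by
  convention, which lies in the half-line.\<close>

lemma integral_in_nonneg_Reals:
  fixes f :: "'a \<Rightarrow> complex"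
  assumes "\<And>x. x \<in> space M \<Longrightarrow> f x \<in> \<real>\<^sub>\<ge>\<^sub>0"
  shows "(LINT x|M. f x) \<in> \<real>\<^sub>\<ge>\<^sub>0"
proof -
  have "(LINT x|M. f x) = (LINT x|M. of_real (Re (f x)))"
    by (rule Bochner_Integration.integral_cong) (use assms in \<open>auto simp: complex_nonneg_Reals_iff complex_eq_iff\<close>)
  also have "\<dots> = of_real (LINT x|M. Re (f x))" by simp
  also have "\<dots> \<in> \<real>\<^sub>\<ge>\<^sub>0"
    using assms by (auto simp: complex_nonneg_Reals_iff intro!: integral_nonneg_AE AE_I2)
  finally show ?thesis .
qed

text \<open>Fubini for an integrable product times a bounded kernel. The kernel is a character in
  most uses, and an indicator function in the proof that \<kappa> is invariant under
  inversion.\<close>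

lemma integral_mult_swap:
  fixes u :: "'a \<Rightarrow> complex" and v :: "'b \<Rightarrow> complex" and e :: "'a \<Rightarrow> 'b \<Rightarrow> complex"
  assumes "sigma_finite_measure M" "sigma_finite_measure N"
    and u: "integrable M u" and v: "integrable N v"
    and e [measurable]: "case_prod e \<in> borel_measurable (M \<Otimes>\<^sub>M N)"
    and bound: "\<And>x y. norm (e x y) \<le> B"
  shows "(LINT x|M. u x * (LINT y|N. v y * e x y)) = (LINT y|N. v y * (LINT x|M. u x * e x y))"
proof -
  interpret M: sigma_finite_measure M by fact
  interpret N: sigma_finite_measure N by fact
  interpret pair_sigma_finite M N ..
  note [measurable] = borel_measurable_integrable[OF u] borel_measurable_integrable[OF v]
  have B: "B \<ge> 0" using order_trans[OF norm_ge_zero bound] .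
  have uv: "integrable (M \<Otimes>\<^sub>M N) (\<lambda>(x, y). u x * v y)"
  proof (rule Fubini_integrable)
    show "integrable M (\<lambda>x. LINT y|N. norm (case (x, y) of (x, y) \<Rightarrow> u x * v y))"
      using u by (simp add: norm_mult)
    show "AE x in M. integrable N (\<lambda>y. case (x, y) of (x, y) \<Rightarrow> u x * v y)"
      using v by simp
  qed simp
  have "integrable (M \<Otimes>\<^sub>M N) (\<lambda>(x, y). u x * v y * e x y)"
  proof (rule Bochner_Integration.integrable_bound)
    show "integrable (M \<Otimes>\<^sub>M N) (\<lambda>z. B * norm (case z of (x, y) \<Rightarrow> u x * v y))"
      using uv by (intro integrable_mult_right integrable_norm)
    show "AE z in M \<Otimes>\<^sub>M N. norm (case z of (x, y) \<Rightarrow> u x * v y * e x y) \<le> norm (B * norm (case z of (x, y) \<Rightarrow> u x * v y))"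
    proof (intro AE_I2, clarify)
      fix x y
      show "norm (u x * v y * e x y) \<le> norm (B * norm (u x * v y))"
        using mult_left_mono[OF bound[of x y], of "norm (u x * v y)"] B
        by (simp add: norm_mult abs_mult mult.commute)
    qed
  qed simp
  from Fubini_integral[OF this] have "(LINT y|N. (LINT x|M. u x * v y * e x y)) = (LINT x|M. (LINT y|N. u x * v y * e x y))"
    by simp
  moreover have "(LINT y|N. u x * v y * e x y) = u x * (LINT y|N. v y * e x y)" for x
    by (simp add: mult.assoc)
  moreover have "(LINT x|M. u x * v y * e x y) = v y * (LINT x|M. u x * e x y)" for y
    by (simp add: mult.assoc mult.left_commute[of "u _" "v _"])
  ultimately show ?thesis by simp
qed

text \<open>\<open>lborel_eq\<close> presents Lebesgue measure as the image of a product measure, on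
  which integrals of products factor; this reduces Gaussian integrals to one variable.\<close>

lemma integral_lborel_prod_coordinates:
  fixes f :: "'a::euclidean_space \<Rightarrow> real \<Rightarrow> complex"
  assumes f: "\<And>b. b \<in> Basis \<Longrightarrow> integrable lborel (f b)"
  shows "integrable lborel (\<lambda>x. \<Prod>b\<in>Basis. f b (x \<bullet> b))"
    and "(LINT x|lborel. (\<Prod>b\<in>Basis. f b (x \<bullet> b))) = (\<Prod>b\<in>Basis. (LINT t|lborel. f b t))"
proof -
  interpret product_sigma_finite "\<lambda>_::'a. lborel :: real measure" ..
  note [measurable] = borel_measurable_integrable[OF f, simplified]
  have coord: "(\<Prod>b\<in>Basis. f b ((\<Sum>c\<in>Basis. y c *\<^sub>R c) \<bullet> b)) = (\<Prod>b\<in>Basis. f b (y b))" for y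
    by (intro prod.cong refl) simp
  show "integrable lborel (\<lambda>x. \<Prod>b\<in>Basis. f b (x \<bullet> b))"
    by (subst lborel_eq, subst integrable_distr_eq)
       (auto simp: coord intro: product_integrable_prod f)
  show "(LINT x|lborel. (\<Prod>b\<in>Basis. f b (x \<bullet> b))) = (\<Prod>b\<in>Basis. (LINT t|lborel. f b t))"
    by (subst lborel_eq, subst integral_distr)
       (auto simp: coord intro: product_integral_prod f)
qed

section \<open>Gaussians and their Fourier transforms\<close>

definition gaussian :: "'a::real_inner \<Rightarrow> real" where
  "gaussian x = exp (- (x \<bullet> x) / 2)"

lemma gaussian_pos [simp]: "gaussian x > 0" and gaussian_nonneg [simp]: "gaussian x \<ge> 0"
  and gaussian_0 [simp]: "gaussian 0 = 1" and gaussian_minus [simp]: "gaussian (- x) = gaussian x"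
  and gaussian_le_1 [simp]: "gaussian x \<le> 1"
  by (auto simp: gaussian_def)

lemma continuous_on_gaussian [continuous_intros]:
  "continuous_on A f \<Longrightarrow> continuous_on A (\<lambda>x. gaussian (f x))"
  unfolding gaussian_def by (intro continuous_intros) auto

lemma measurable_gaussian [measurable]:
  "(gaussian :: 'a::euclidean_space \<Rightarrow> real) \<in> borel_measurable borel"
  by (intro borel_measurable_continuous_onI continuous_intros)

lemma continuous_on_cis_fun [continuous_intros]:
  "continuous_on A f \<Longrightarrow> continuous_on A (\<lambda>x. cis (f x))"
  unfolding cis_conv_exp by (intro continuous_intros)

lemma measurable_cis [measurable]: "cis \<in> borel_measurable borel"
  by (intro borel_measurable_continuous_onI continuous_intros)

lemma gaussian_prod:
  fixes x :: "'a::euclidean_space"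
  shows "gaussian x = (\<Prod>b\<in>Basis. exp (- (x \<bullet> b)\<^sup>2 / 2))"
  unfolding gaussian_def euclidean_inner[of x x]
  by (simp add: sum_negf power2_eq_square sum_divide_distrib flip: exp_sum)

lemma cis_inner_prod:
  fixes x y :: "'a::euclidean_space"
  shows "cis (x \<bullet> y) = (\<Prod>b\<in>Basis. cis ((x \<bullet> b) * (y \<bullet> b)))"
  unfolding euclidean_inner[of x y] cis_conv_exp
  by (simp add: sum_distrib_left flip: exp_sum)

text \<open>Read off from the characteristic function of the standard normal law;
  \<open>sqrt (2 * pi)\<close> undoes the normalisation of its density.\<close>

lemma gaussian_fourier_real:
  shows "integrable lborel (\<lambda>t. complex_of_real (exp (- t\<^sup>2 / 2)))"
    and "(LINT t|lborel. complex_of_real (exp (- t\<^sup>2 / 2)) * cis (t * s)) = of_real (sqrt (2 * pi) * exp (- s\<^sup>2 / 2))"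
proof -
  have e: "exp (- t\<^sup>2 / 2) = sqrt (2 * pi) * std_normal_density t" for t :: real
    by (simp add: std_normal_density_def)
  show "integrable lborel (\<lambda>t. complex_of_real (exp (- t\<^sup>2 / 2)))"
    unfolding e by (intro integrable_of_real integrable_mult_right) simp
  have "char std_normal_distribution s = (LINT t|lborel. std_normal_density t *\<^sub>R cis (t * s))"
    unfolding char_def by (subst integral_density) (auto simp: cis_conv_exp mult.commute)
  then have "(LINT t|lborel. std_normal_density t *\<^sub>R cis (t * s)) = of_real (exp (- s\<^sup>2 / 2))"
    by (simp add: char_std_normal_distribution)
  then show "(LINT t|lborel. complex_of_real (exp (- t\<^sup>2 / 2)) * cis (t * s)) = of_real (sqrt (2 * pi) * exp (- s\<^sup>2 / 2))"
    unfolding e by (simp add: scaleR_conv_of_real mult.assoc)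
qed

lemma integrable_gaussian_scaled:
  assumes "c \<noteq> 0"
  shows "integrable lborel (\<lambda>x::'a::euclidean_space. gaussian (c *\<^sub>R x))"
proof -
  have "integrable lborel (\<lambda>x::'a. \<Prod>b\<in>Basis. (\<lambda>t. complex_of_real (exp (- (0 + c * t)\<^sup>2 / 2))) (x \<bullet> b))"
    by (rule integral_lborel_prod_coordinates(1), rule lborel_integrable_real_affine[OF gaussian_fourier_real(1) assms])
  also have "(\<lambda>x::'a. \<Prod>b\<in>Basis. (\<lambda>t. complex_of_real (exp (- (0 + c * t)\<^sup>2 / 2))) (x \<bullet> b)) = (\<lambda>x. of_real (gaussian (c *\<^sub>R x)))"
    by (simp add: gaussian_prod)
  finally show ?thesis
    by (simp only: complex_of_real_integrable_eq)
qed

lemma integrable_gaussian: "integrable lborel (gaussian :: 'a::euclidean_space \<Rightarrow> real)"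
  using integrable_gaussian_scaled[of 1] by simp

lemma gaussian_fourier:
  fixes x :: "'a::euclidean_space"
  shows "(LINT y|lborel. of_real (gaussian y) * cis (y \<bullet> x)) = of_real (sqrt (2 * pi) ^ DIM('a) * gaussian x)"
proof -
  have "(LINT y|lborel. of_real (gaussian y) * cis (y \<bullet> x))
      = (LINT y|lborel. (\<Prod>b\<in>Basis. (\<lambda>b t. complex_of_real (exp (- t\<^sup>2 / 2)) * cis (t * (x \<bullet> b))) b (y \<bullet> b)))"
    by (simp add: gaussian_prod cis_inner_prod prod.distrib)
  also have "\<dots> = (\<Prod>b\<in>Basis. (LINT t|lborel. complex_of_real (exp (- t\<^sup>2 / 2)) * cis (t * (x \<bullet> b))))"
  proof (rule integral_lborel_prod_coordinates(2))
    show "integrable lborel (\<lambda>t. complex_of_real (exp (- t\<^sup>2 / 2)) * cis (t * (x \<bullet> b)))" for b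
      by (rule Bochner_Integration.integrable_bound[OF gaussian_fourier_real(1)]) (auto simp: norm_mult)
  qed
  also have "\<dots> = of_real (sqrt (2 * pi) ^ DIM('a) * gaussian x)"
    by (simp only: gaussian_fourier_real(2) gaussian_prod of_real_prod[symmetric] prod.distrib prod_constant)
  finally show ?thesis .
qed

lemma integral_gaussian: "(LINT y|lborel. gaussian (y :: 'a::euclidean_space)) = sqrt (2 * pi) ^ DIM('a)"
proof -
  have "complex_of_real (LINT y|lborel. gaussian (y :: 'a)) = of_real (sqrt (2 * pi) ^ DIM('a))"
    using gaussian_fourier[of "0 :: 'a"] by simp
  then show ?thesis by (simp only: of_real_eq_iff)
qed

lemma integral_gaussian_scaled_pos:
  assumes "c \<noteq> 0"
  shows "0 < (LINT x|lborel. gaussian (c *\<^sub>R (x :: 'a::euclidean_space)))"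
proof -
  have "(LINT x|lborel. gaussian (c *\<^sub>R (x :: 'a))) \<noteq> 0"
  proof
    assume "(LINT x|lborel. gaussian (c *\<^sub>R (x :: 'a))) = 0"
    then have "AE x in lborel. gaussian (c *\<^sub>R (x :: 'a)) = 0"
      by (subst (asm) integral_nonneg_eq_0_iff_AE) (auto intro: integrable_gaussian_scaled[OF assms])
    then have "AE x in lborel. (x :: 'a) \<in> {}"
      by (auto elim!: eventually_mono simp: less_imp_neq[OF gaussian_pos, symmetric])
    then have "emeasure lborel (UNIV :: 'a set) = 0"
      by (simp add: AE_iff_null null_sets_def)
    then show False by simp
  qed
  moreover have "(LINT x|lborel. gaussian (c *\<^sub>R (x :: 'a))) \<ge> 0" by (intro integral_nonneg_AE) simp
  ultimately show ?thesis by linarith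
qed

section \<open>Positive definite functions on a Euclidean space\<close>

definition posdef_fun :: "('a::ab_group_add \<Rightarrow> complex) \<Rightarrow> bool" where
  "posdef_fun \<phi> \<longleftrightarrow> (\<forall>(m::nat) c x. (\<Sum>i<m. \<Sum>j<m. \<phi> (x i - x j) * cnj (c j) * c i) \<in> \<real>\<^sub>\<ge>\<^sub>0)"

lemma posdef_funD: "posdef_fun \<phi> \<Longrightarrow> (\<Sum>i<m. \<Sum>j<m. \<phi> (x i - x j) * cnj (c j) * c i) \<in> \<real>\<^sub>\<ge>\<^sub>0"
  for m :: nat
  by (auto simp: posdef_fun_def)

lemma posdef_fun_bounds:
  assumes "posdef_fun \<phi>"
  shows "\<phi> (- x) = cnj (\<phi> x)" and "norm (\<phi> x) \<le> Re (\<phi> 0)" and "\<phi> 0 \<in> \<real>\<^sub>\<ge>\<^sub>0"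
proof -
  \<comment> \<open>Positive definiteness at the two points \<open>0\<close> and \<open>x\<close>
    with coefficients \<open>1\<close> and \<open>c\<close>; all three claims come from choices of
    \<open>c\<close>.\<close>
  have two: "\<phi> 0 + \<phi> 0 * (cnj c * c) + \<phi> x * c + \<phi> (- x) * cnj c \<in> \<real>\<^sub>\<ge>\<^sub>0" for c
    using posdef_funD[OF assms, where m = 2 and c = "\<lambda>i. if i = 0 then 1 else c" and x = "\<lambda>i. if i = 0 then 0 else x"]
    by (simp add: numeral_2_eq_2 algebra_simps)
  show zero: "\<phi> 0 \<in> \<real>\<^sub>\<ge>\<^sub>0" using two[of 0] by simp
  show minus: "\<phi> (- x) = cnj (\<phi> x)"
    using two[of 1] two[of \<i>] zero by (auto simp: complex_nonneg_Reals_iff complex_eq_iff)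
  \<comment> \<open>This phase makes \<open>\<phi> x * c\<close> equal to
    \<open>- norm (\<phi> x)\<close>, so that \<open>two\<close> says that
    \<open>2 * (Re (\<phi> 0) - norm (\<phi> x))\<close> is nonnegative.\<close>
  define c where "c = - cnj (sgn (\<phi> x))"
  show "norm (\<phi> x) \<le> Re (\<phi> 0)"
  proof (cases "\<phi> x = 0")
    case True
    then show ?thesis using zero by (simp add: complex_nonneg_Reals_iff)
  next
    case False
    then have "cnj c * c = 1"
      using complex_norm_square[of "sgn (\<phi> x)"] by (simp add: c_def norm_sgn)
    moreover have "\<phi> x * c = - of_real (norm (\<phi> x))"
    proof -
      have "\<phi> x * cnj (\<phi> x) = of_real (norm (\<phi> x)) * of_real (norm (\<phi> x))"
        by (simp add: complex_norm_square[symmetric] power2_eq_square)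
      then show ?thesis using False by (simp add: c_def sgn_eq divide_simps)
    qed
    moreover from this have "\<phi> (- x) * cnj c = - of_real (norm (\<phi> x))"
      by (metis minus complex_cnj_complex_of_real complex_cnj_minus complex_cnj_mult)
    ultimately show ?thesis
      using two[of c] by (simp add: complex_nonneg_Reals_iff)
  qed
qed

text \<open>The character is absorbed into the coefficients. Through this modulation, nonnegativity
  of a single integral becomes nonnegativity of a Fourier transform at every frequency
  \<eta>.\<close>

lemma posdef_fun_cis_mult:
  fixes \<phi> :: "'a::real_inner \<Rightarrow> complex"
  assumes "posdef_fun \<phi>"
  shows "posdef_fun (\<lambda>x. \<phi> (s *\<^sub>R x) * cis (- (\<eta> \<bullet> x)))"
  unfolding posdef_fun_def
proof (intro allI)
  fix m :: nat and c and x :: "nat \<Rightarrow> 'a"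
  have eq: "\<phi> (s *\<^sub>R (x i - x j)) * cis (- (\<eta> \<bullet> (x i - x j))) * cnj (c j) * c i
     = \<phi> (s *\<^sub>R x i - s *\<^sub>R x j) * cnj (c j * cis (- (\<eta> \<bullet> x j))) * (c i * cis (- (\<eta> \<bullet> x i)))" for i j
    by (simp add: scaleR_diff_right inner_diff_right cis_cnj cis_mult mult_ac)
  then show "(\<Sum>i<m. \<Sum>j<m. \<phi> (s *\<^sub>R (x i - x j)) * cis (- (\<eta> \<bullet> (x i - x j))) * cnj (c j) * c i) \<in> \<real>\<^sub>\<ge>\<^sub>0"
    using posdef_funD[OF assms, where m = m and x = "\<lambda>i. s *\<^sub>R x i" and c = "\<lambda>i. c i * cis (- (\<eta> \<bullet> x i))"] by (simp only: eq)
qed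

text \<open>Distinct coordinates are independent with law \<open>D\<close>; this gives the
  expectation of the off-diagonal terms in the random quadratic form below.\<close>

lemma distr_PiM_pair:
  assumes "prob_space D" "finite I" "i \<in> I" "j \<in> I" "i \<noteq> j"
  shows "distr (PiM I (\<lambda>_. D)) (D \<Otimes>\<^sub>M D) (\<lambda>x. (x i, x j)) = D \<Otimes>\<^sub>M D"
proof -
  interpret D: prob_space D by fact
  interpret product_prob_space "\<lambda>_. D" I ..
  have [measurable]: "(\<lambda>x. (x i, x j)) \<in> measurable (PiM I (\<lambda>_. D)) (D \<Otimes>\<^sub>M D)"
    using assms by measurable
  have "D \<Otimes>\<^sub>M D = distr (PiM I (\<lambda>_. D)) (D \<Otimes>\<^sub>M D) (\<lambda>x. (x i, x j))"
  proof (rule pair_measure_eqI)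
    fix A B assume AB: "A \<in> sets D" "B \<in> sets D"
    let ?X = "\<lambda>k. if k = i then A else B"
    have "emeasure (distr (PiM I (\<lambda>_. D)) (D \<Otimes>\<^sub>M D) (\<lambda>x. (x i, x j))) (A \<times> B)
        = emeasure (PiM I (\<lambda>_. D)) {x \<in> space (PiM I (\<lambda>_. D)). \<forall>k\<in>{i, j}. x k \<in> ?X k}"
      using AB \<open>i \<noteq> j\<close> by (subst emeasure_distr) (auto intro!: arg_cong2[where f = emeasure])
    also have "\<dots> = (\<Prod>k\<in>{i, j}. emeasure D (?X k))"
      using AB assms by (intro emeasure_PiM_Collect) auto
    also have "\<dots> = emeasure D A * emeasure D B"
      using \<open>i \<noteq> j\<close> by simp
    finally show "emeasure D A * emeasure D B
      = emeasure (distr (PiM I (\<lambda>_. D)) (D \<Otimes>\<^sub>M D) (\<lambda>x. (x i, x j))) (A \<times> B)" by simp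
  qed (auto intro: D.sigma_finite_measure_axioms)
  then show ?thesis by simp
qed

text \<open>Evaluating positive definiteness at \<open>m\<close> independent random points and averaging gives
  \<open>m \<phi>(0) + m (m - 1) J \<ge> 0\<close>, where \<open>J\<close> is the double integral; now divide by \<open>m\<^sup>2\<close>.\<close>

lemma posdef_fun_double_integral:
  fixes \<phi> :: "'a::euclidean_space \<Rightarrow> complex"
  assumes pd: "posdef_fun \<phi>" and cont: "continuous_on UNIV \<phi>"
    and D: "prob_space D" "sets D = sets borel"
  shows "(LINT z|(D \<Otimes>\<^sub>M D). \<phi> (fst z - snd z)) \<in> \<real>\<^sub>\<ge>\<^sub>0"
proof -
  interpret D: prob_space D by fact
  define J where "J = (LINT z|(D \<Otimes>\<^sub>M D). \<phi> (fst z - snd z))"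
  have [measurable_cong]: "sets D = sets borel" by fact
  have [measurable]: "\<phi> \<in> borel_measurable borel"
    by (rule borel_measurable_continuous_onI[OF cont])
  have bnd: "norm (\<phi> x) \<le> Re (\<phi> 0)" for x by (rule posdef_fun_bounds(2)[OF pd])
  have main: "of_nat m * \<phi> 0 + of_nat m * (of_nat m - 1) * J \<in> \<real>\<^sub>\<ge>\<^sub>0" for m :: nat
  proof -
    interpret product_prob_space "\<lambda>_. D" "{..<m}" ..
    let ?P = "PiM {..<m} (\<lambda>_. D)"
    interpret P: prob_space ?P by (rule prob_space_PiM) (rule D(1))
    have int: "integrable ?P (\<lambda>x. \<phi> (x i - x j))" if "i < m" "j < m" for i j
    proof (rule integrable_const_bound[where B = "Re (\<phi> 0)"])
      have [measurable]: "(\<lambda>x. x k) \<in> borel_measurable ?P" if "k < m" for k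
        using measurable_component_singleton[of k "{..<m}" "\<lambda>_. D"] measurable_cong_sets[OF refl D(2)] that
        by auto
      show "(\<lambda>x. \<phi> (x i - x j)) \<in> borel_measurable ?P"
        using that by measurable
    qed (simp add: bnd)
    have entry: "(LINT x|?P. \<phi> (x i - x j)) = (if i = j then \<phi> 0 else J)" if "i < m" "j < m" for i j
    proof (cases "i = j")
      case True
      then show ?thesis by (simp add: P.prob_space)
    next
      case False
      have "J = (LINT z|distr ?P (D \<Otimes>\<^sub>M D) (\<lambda>x. (x i, x j)). \<phi> (fst z - snd z))"
        using distr_PiM_pair[OF D(1), of "{..<m}" i j] that False by (simp add: J_def)
      also have "\<dots> = (LINT x|?P. \<phi> (x i - x j))"
        using that by (subst integral_distr) auto
      finally show ?thesis using False by simp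
    qed
    have "(LINT x|?P. (\<Sum>i<m. \<Sum>j<m. \<phi> (x i - x j))) \<in> \<real>\<^sub>\<ge>\<^sub>0"
      using posdef_funD[OF pd, where c = "\<lambda>_. 1"] by (intro integral_in_nonneg_Reals) simp
    also have "(LINT x|?P. (\<Sum>i<m. \<Sum>j<m. \<phi> (x i - x j))) = (\<Sum>i<m. \<Sum>j<m. (LINT x|?P. \<phi> (x i - x j)))"
    proof -
      have "(LINT x|?P. (\<Sum>i<m. \<Sum>j<m. \<phi> (x i - x j))) = (\<Sum>i<m. (LINT x|?P. (\<Sum>j<m. \<phi> (x i - x j))))"
        by (intro Bochner_Integration.integral_sum Bochner_Integration.integrable_sum int) auto
      also have "\<dots> = (\<Sum>i<m. \<Sum>j<m. (LINT x|?P. \<phi> (x i - x j)))"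
        by (intro sum.cong refl Bochner_Integration.integral_sum int) auto
      finally show ?thesis .
    qed
    also have "\<dots> = (\<Sum>i<m. \<Sum>j<m. J + (if i = j then \<phi> 0 - J else 0))"
      by (intro sum.cong refl) (auto simp: entry)
    also have "\<dots> = of_nat m * \<phi> 0 + of_nat m * (of_nat m - 1) * J"
      by (simp add: sum.distrib sum.delta algebra_simps)
    finally show ?thesis .
  qed
  have "(\<lambda>m. \<phi> 0 * of_real (1 / of_nat (Suc m)) + J * of_real (1 - 1 / of_nat (Suc m))) \<longlonglongrightarrow> \<phi> 0 * of_real 0 + J * of_real (1 - 0)"
    by (intro tendsto_intros LIMSEQ_Suc[OF lim_1_over_n])
  moreover have "\<phi> 0 * of_real (1 / of_nat (Suc m)) + J * of_real (1 - 1 / of_nat (Suc m)) \<in> \<real>\<^sub>\<ge>\<^sub>0" for m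
  proof -
    have "\<phi> 0 * of_real (1 / of_nat (Suc m)) + J * of_real (1 - 1 / of_nat (Suc m))
      = of_real (1 / (of_nat (Suc m))\<^sup>2) * (of_nat (Suc m) * \<phi> 0 + of_nat (Suc m) * (of_nat (Suc m) - 1) * J)"
      by (simp add: field_simps power2_eq_square del: of_nat_Suc)
    also have "\<dots> \<in> \<real>\<^sub>\<ge>\<^sub>0"
      by (intro nonneg_Reals_mult_I main) (simp only: nonneg_Reals_of_real_iff, simp)
    finally show ?thesis .
  qed
  ultimately have "J \<in> \<real>\<^sub>\<ge>\<^sub>0"
    using Lim_in_closed_set[OF closed_nonneg_Reals_complex] by (force intro: always_eventually)
  then show ?thesis by (simp add: J_def)
qed

text \<open>The double integral is taken for the normal law with density proportional to
  \<open>g\<close>. The difference of two independent vectors with this law is again normal, so the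
  double integral is a positive multiple of the integral in question.\<close>

lemma posdef_fun_gaussian_integral:
  fixes \<phi> :: "'a::euclidean_space \<Rightarrow> complex"
  assumes pd: "posdef_fun \<phi>" and cont: "continuous_on UNIV \<phi>" and "\<epsilon> > 0"
  shows "(LINT z|lborel. \<phi> z * of_real (gaussian (\<epsilon> *\<^sub>R z))) \<in> \<real>\<^sub>\<ge>\<^sub>0"
proof -
  \<comment> \<open>A difference of two independent normal vectors has doubled variance; the factor
    \<open>sqrt 2\<close> compensates for it and leaves scale \<epsilon>.\<close>
  define a where "a = sqrt 2 * \<epsilon>"
  define g :: "'a \<Rightarrow> real" where "g x = gaussian (a *\<^sub>R x)" for x
  have a: "a \<noteq> 0" using \<open>\<epsilon> > 0\<close> by (simp add: a_def)
  have [measurable]: "\<phi> \<in> borel_measurable borel"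
    by (rule borel_measurable_continuous_onI[OF cont])
  have [measurable]: "g \<in> borel_measurable borel" unfolding g_def by measurable
  have bnd: "norm (\<phi> x) \<le> Re (\<phi> 0)" for x by (rule posdef_fun_bounds(2)[OF pd])
  have g_nonneg [simp]: "g x \<ge> 0" for x by (simp add: g_def)
  define C where "C = (LINT x|lborel. g x)"
  have C: "C > 0" unfolding C_def g_def by (rule integral_gaussian_scaled_pos[OF a])
  have g_int: "integrable lborel g" unfolding g_def by (rule integrable_gaussian_scaled[OF a])
  define D where "D = density lborel (\<lambda>x. ennreal (g x / C))"
  have sets_D [measurable_cong]: "sets D = sets borel" by (simp add: D_def)
  have D: "prob_space D"
  proof
    have "emeasure D (space D) = (\<integral>\<^sup>+x. ennreal (g x / C) \<partial>lborel)"
      by (simp add: D_def emeasure_density)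
    also have "\<dots> = ennreal (LINT x|lborel. g x / C)"
      using C g_int by (intro nn_integral_eq_integral) auto
    also have "\<dots> = 1" using C by (simp add: C_def)
    finally show "emeasure D (space D) = 1" .
  qed
  interpret D: prob_space D by fact
  interpret DD: pair_prob_space D D ..
  have D_int: "(LINT x|D. f x) = (LINT x|lborel. of_real (g x) * f x) / of_real C"
    if [measurable]: "f \<in> borel_measurable borel" for f :: "'a \<Rightarrow> complex"
    unfolding D_def using C
    by (subst integral_density) (auto simp: scaleR_conv_of_real)
  have DD: "integrable (D \<Otimes>\<^sub>M D) (\<lambda>(x, y). \<phi> (y - x))"
    by (rule DD.integrable_const_bound[where B = "Re (\<phi> 0)"]) (auto simp: bnd)
  have "(LINT z|(D \<Otimes>\<^sub>M D). \<phi> (fst z - snd z)) = (LINT x|D. (LINT y|D. \<phi> (x - y)))"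
    using DD.integral_fst[of "\<lambda>x y. \<phi> (x - y)"] DD.integrable_product_swap[OF DD]
    by (simp add: case_prod_unfold)
  also have "\<dots> = (LINT y|D. (LINT x|D. \<phi> (x - y)))"
    using DD.Fubini_integral[of "\<lambda>x y. \<phi> (x - y)"] DD.integrable_product_swap[OF DD]
    by (simp add: case_prod_beta)
  also have "\<dots> = (LINT y|lborel. of_real (g y) * (LINT x|lborel. of_real (g x) * \<phi> (x - y))) / (of_real C)\<^sup>2"
    by (simp add: D_int power2_eq_square)
  also have "(\<lambda>y. (LINT x|lborel. of_real (g x) * \<phi> (x - y))) = (\<lambda>y. (LINT z|lborel. \<phi> z * of_real (g (z + y))))"
  proof
    fix y show "(LINT x|lborel. of_real (g x) * \<phi> (x - y)) = (LINT z|lborel. \<phi> z * of_real (g (z + y)))"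
      by (subst integral_translate_lborel[symmetric, where c = y]) (auto simp: mult.commute)
  qed
  also have "(LINT y|lborel. of_real (g y) * (LINT z|lborel. \<phi> z * of_real (g (z + y))))
     = (LINT z|lborel. \<phi> z * of_real (gaussian (\<epsilon> *\<^sub>R z)) * of_real (LINT y|lborel. gaussian ((2 * \<epsilon>) *\<^sub>R (y :: 'a))))"
  proof -
    define h where "h z y = \<phi> z * of_real (gaussian (\<epsilon> *\<^sub>R z)) * of_real (gaussian ((2 * \<epsilon>) *\<^sub>R (y + (1/2) *\<^sub>R z)))" for z y
    \<comment> \<open>Completing the square in \<open>y\<close>: |y|^2 + |z + y|^2 = 2 |y + z/2|^2 +
      |z|^2 / 2.\<close>
    have gg: "g y * g (z + y) = gaussian (\<epsilon> *\<^sub>R z) * gaussian ((2 * \<epsilon>) *\<^sub>R (y + (1/2) *\<^sub>R z))" for y z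
    proof -
      have "a * a = 2 * (\<epsilon> * \<epsilon>)" by (simp add: a_def algebra_simps)
      moreover have "g y * g (z + y) = exp (- ((a * a) * (y \<bullet> y + (z \<bullet> z + 2 * (z \<bullet> y) + y \<bullet> y)) / 2))"
        by (simp add: g_def gaussian_def inner_add_left inner_add_right inner_commute[of y z] field_simps flip: exp_add)
      ultimately show ?thesis
        by (simp add: gaussian_def inner_add_left inner_add_right inner_commute[of y z] field_simps flip: exp_add)
    qed
    have hg: "h z y = of_real (g y) * (\<phi> z * of_real (g (z + y)))" for z y
    proof -
      have "of_real (g y) * (\<phi> z * of_real (g (z + y))) = \<phi> z * of_real (g y * g (z + y))" by simp
      then show ?thesis by (simp only: gg h_def of_real_mult mult.assoc)
    qed
    have inner: "(LINT y|lborel. gaussian ((2 * \<epsilon>) *\<^sub>R (y + (1/2) *\<^sub>R z))) = (LINT y|lborel. gaussian ((2 * \<epsilon>) *\<^sub>R (y :: 'a)))" for z :: 'a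
      by (rule integral_translate_lborel[of "\<lambda>y::'a. gaussian ((2 * \<epsilon>) *\<^sub>R y)"]) measurable
    have inner_int: "integrable lborel (\<lambda>y. gaussian ((2 * \<epsilon>) *\<^sub>R (y + (1/2) *\<^sub>R z)))" for z :: 'a
      using \<open>\<epsilon> > 0\<close> by (intro integrable_translate_lborel[of "\<lambda>y::'a. gaussian ((2 * \<epsilon>) *\<^sub>R y)"] integrable_gaussian_scaled) simp
    have "integrable (lborel \<Otimes>\<^sub>M lborel) (case_prod h)"
    proof (rule lborel_pair.Fubini_integrable)
      show "case_prod h \<in> borel_measurable (lborel \<Otimes>\<^sub>M lborel)"
        unfolding h_def by measurable
      have "integrable lborel (\<lambda>z. norm (\<phi> z) * gaussian (\<epsilon> *\<^sub>R z))"
      proof (rule Bochner_Integration.integrable_bound)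
        show "integrable lborel (\<lambda>z :: 'a. Re (\<phi> 0) * gaussian (\<epsilon> *\<^sub>R z))"
          using \<open>\<epsilon> > 0\<close> by (intro integrable_mult_right integrable_gaussian_scaled) simp
        show "AE z in lborel. norm (norm (\<phi> z) * gaussian (\<epsilon> *\<^sub>R z)) \<le> norm (Re (\<phi> 0) * gaussian (\<epsilon> *\<^sub>R z))"
          by (intro AE_I2) (auto simp: abs_mult intro!: mult_right_mono order_trans[OF bnd])
      qed simp
      then show "integrable lborel (\<lambda>z. LINT y|lborel. norm (case (z, y) of (z, y) \<Rightarrow> h z y))"
        by (simp add: h_def norm_mult inner)
      show "AE z in lborel. integrable lborel (\<lambda>y. case (z, y) of (z, y) \<Rightarrow> h z y)"
        by (auto simp: h_def intro!: integrable_mult_right integrable_of_real inner_int)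
    qed
    from lborel_pair.Fubini_integral[OF this] show ?thesis
      by (simp add: hg) (simp add: h_def inner flip: hg)
  qed
  finally have *: "(LINT z|(D \<Otimes>\<^sub>M D). \<phi> (fst z - snd z)) = (LINT z|lborel. \<phi> z * of_real (gaussian (\<epsilon> *\<^sub>R z)))
      * of_real ((LINT y|lborel. gaussian ((2 * \<epsilon>) *\<^sub>R (y :: 'a))) / C\<^sup>2)"
    by simp
  define r where "r = (LINT y|lborel. gaussian ((2 * \<epsilon>) *\<^sub>R (y :: 'a))) / C\<^sup>2"
  have r: "r > 0"
    using C \<open>\<epsilon> > 0\<close> by (simp add: r_def integral_gaussian_scaled_pos)
  have "(LINT z|lborel. \<phi> z * of_real (gaussian (\<epsilon> *\<^sub>R z))) = (LINT z|(D \<Otimes>\<^sub>M D). \<phi> (fst z - snd z)) * of_real (1 / r)"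
    using r unfolding * by (simp flip: r_def)
  also have "\<dots> \<in> \<real>\<^sub>\<ge>\<^sub>0"
    using r by (intro nonneg_Reals_mult_I posdef_fun_double_integral pd cont D sets_D) auto
  finally show ?thesis .
qed

text \<open>At scale \<open>s m\<close> the function \<phi> is damped by a wide Gaussian and
  averaged against a narrow one; the result is the Fourier transform of an explicit finite
  measure.\<close>

lemma bochner_approximation:
  fixes \<phi> :: "'a::euclidean_space \<Rightarrow> complex"
  assumes pd: "posdef_fun \<phi>" and cont: "continuous_on UNIV \<phi>" and one: "\<phi> 0 = 1"
  obtains N :: "nat \<Rightarrow> 'a measure" where
    "\<And>m. finite_measure (N m)" "\<And>m. sets (N m) = sets borel"
    "\<And>m x. norm (LINT \<eta>|N m. cis (\<eta> \<bullet> x)) \<le> 1"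
    "\<And>x. (\<lambda>m. LINT \<eta>|N m. cis (\<eta> \<bullet> x)) \<longlonglongrightarrow> \<phi> x"
proof -
  have [measurable]: "\<phi> \<in> borel_measurable borel"
    by (rule borel_measurable_continuous_onI[OF cont])
  have bnd: "norm (\<phi> x) \<le> 1" for x using posdef_fun_bounds(2)[OF pd, of x] one by simp
  define C where "C = sqrt (2 * pi) ^ DIM('a)"
  have C: "C > 0" by (simp add: C_def)
  define s :: "nat \<Rightarrow> real" where "s m = 1 / Suc m" for m
  have s: "s m > 0" for m by (simp add: s_def)
  \<comment> \<open>In terms of \<open>x = s m *\<^sub>R u\<close> the damping factor is the
    Gaussian of \<open>s m *\<^sub>R x\<close>, which tends to \<open>1\<close> at each
    \<open>x\<close>. It makes the Fourier integral \<open>q\<close> converge, and \<open>q\<close>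
    is nonnegative by the previous lemmas.\<close>
  define v where "v m u = \<phi> (s m *\<^sub>R u) * of_real (gaussian ((s m)\<^sup>2 *\<^sub>R u))" for m u
  define q where "q m \<eta> = (LINT u|lborel. v m u * cis (- (\<eta> \<bullet> u)))" for m \<eta>
  have [measurable]: "v m \<in> borel_measurable borel" for m unfolding v_def by measurable
  have norm_v: "norm (v m u) \<le> gaussian ((s m)\<^sup>2 *\<^sub>R u)" for m u
    using mult_right_mono[OF bnd[of "s m *\<^sub>R u"], of "gaussian ((s m)\<^sup>2 *\<^sub>R u)"] by (simp add: v_def norm_mult)
  have v_int: "integrable lborel (v m)" for m
    by (rule Bochner_Integration.integrable_bound[OF integrable_gaussian_scaled[of "(s m)\<^sup>2"]])
      (use s[of m] norm_v in auto)
  have q_nonneg: "q m \<eta> \<in> \<real>\<^sub>\<ge>\<^sub>0" for m \<eta>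
  proof -
    have "(LINT u|lborel. (\<phi> (s m *\<^sub>R u) * cis (- (\<eta> \<bullet> u))) * of_real (gaussian ((s m)\<^sup>2 *\<^sub>R u))) \<in> \<real>\<^sub>\<ge>\<^sub>0"
      using s[of m] by (intro posdef_fun_gaussian_integral posdef_fun_cis_mult pd continuous_intros continuous_on_compose2[OF cont]) auto
    then show ?thesis by (simp add: q_def v_def mult_ac)
  qed
  have q_bnd: "norm (q m \<eta>) \<le> (LINT u|lborel. norm (v m u))" for m \<eta>
    unfolding q_def using integral_norm_bound[of lborel "\<lambda>u. v m u * cis (- (\<eta> \<bullet> u))"] by (simp add: norm_mult)
  have [measurable]: "q m \<in> borel_measurable borel" for m
    unfolding q_def by measurable
  \<comment> \<open>The function \<open>q m\<close> is known to be bounded, and the Gaussian weight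
    makes it integrable. One factor \<open>C\<close> will cancel against the Fourier transform of
    this weight, the other normalises the remaining Gaussian average.\<close>
  define w where "w m \<eta> = Re (q m \<eta>) * gaussian \<eta> / C\<^sup>2" for m \<eta>
  have w_nonneg: "w m \<eta> \<ge> 0" for m \<eta>
    using q_nonneg[of m \<eta>] by (simp add: w_def complex_nonneg_Reals_iff)
  have w_q: "of_real (w m \<eta>) = of_real (gaussian \<eta>) * q m \<eta> / (of_real C)\<^sup>2" for m \<eta>
    using q_nonneg[of m \<eta>] by (simp add: w_def complex_nonneg_Reals_iff complex_eq_iff)
  have [measurable]: "w m \<in> borel_measurable borel" for m unfolding w_def by measurable
  have w_int: "integrable lborel (w m)" for m
  proof (rule Bochner_Integration.integrable_bound)
    show "integrable lborel (\<lambda>\<eta>::'a. ((LINT u|lborel. norm (v m u)) / C\<^sup>2) * gaussian \<eta>)"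
      by (intro integrable_mult_right integrable_gaussian)
    show "AE \<eta> in lborel. norm (w m \<eta>) \<le> norm ((LINT u|lborel. norm (v m u)) / C\<^sup>2 * gaussian \<eta>)"
    proof (rule AE_I2)
      fix \<eta>
      have "w m \<eta> \<le> (LINT u|lborel. norm (v m u)) * gaussian \<eta> / C\<^sup>2"
        unfolding w_def using order_trans[OF complex_Re_le_cmod q_bnd]
        by (intro divide_right_mono mult_right_mono) auto
      then show "norm (w m \<eta>) \<le> norm ((LINT u|lborel. norm (v m u)) / C\<^sup>2 * gaussian \<eta>)"
        using w_nonneg[of m \<eta>] by simp
    qed
  qed simp
  \<comment> \<open>Frequencies were taken with respect to \<open>u = x / s m\<close>; the division
    by \<open>s m\<close> returns to the variable dual to \<open>x\<close> and spreads the fixed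
    Gaussian weight out as \<open>s m\<close> tends to \<open>0\<close>.\<close>
  define N where "N m = distr (density lborel (\<lambda>\<eta>. ennreal (w m \<eta>))) borel (\<lambda>\<eta>. \<eta> /\<^sub>R s m)" for m
  \<comment> \<open>Exchanging the integrals replaces the weight in \<eta> by its Fourier transform,
    a Gaussian in \<open>u\<close> centred at \<open>x / s m\<close>; the substitution
    \<open>u = y + x / s m\<close> then averages \<phi> over the points
    \<open>x + s m *\<^sub>R y\<close>.\<close>
  have N_eq: "(LINT \<eta>|N m. cis (\<eta> \<bullet> x))
     = (LINT y|lborel. \<phi> (x + s m *\<^sub>R y) * of_real (gaussian (s m *\<^sub>R x + (s m)\<^sup>2 *\<^sub>R y)) * of_real (gaussian y)) / of_real C" for m x
  proof -
    have "(LINT \<eta>|N m. cis (\<eta> \<bullet> x)) = (LINT \<eta>|lborel. of_real (w m \<eta>) * cis (\<eta> \<bullet> (x /\<^sub>R s m)))"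
      unfolding N_def using w_nonneg
      by (subst integral_distr, simp, simp, subst integral_density) (auto simp: scaleR_conv_of_real)
    also have "\<dots> = (LINT \<eta>|lborel. of_real (gaussian \<eta>) * (LINT u|lborel. v m u * cis (\<eta> \<bullet> (x /\<^sub>R s m - u)))) / (of_real C)\<^sup>2"
    proof -
      have "q m \<eta> * cis (\<eta> \<bullet> (x /\<^sub>R s m)) = (LINT u|lborel. v m u * cis (\<eta> \<bullet> (x /\<^sub>R s m - u)))" for \<eta>
        unfolding q_def integral_mult_left_zero[symmetric]
        by (simp add: cis_mult inner_diff_right mult.assoc)
      then show ?thesis
        unfolding w_q by (simp add: mult.assoc flip: integral_divide_zero)
    qed
    also have "(LINT \<eta>|lborel. of_real (gaussian \<eta>) * (LINT u|lborel. v m u * cis (\<eta> \<bullet> (x /\<^sub>R s m - u))))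
       = (LINT u|lborel. v m u * (LINT \<eta>|lborel. of_real (gaussian \<eta>) * cis (\<eta> \<bullet> (x /\<^sub>R s m - u))))"
      by (rule integral_mult_swap[where B = 1])
        (auto intro: v_int integrable_of_real integrable_gaussian sigma_finite_lborel)
    also have "\<dots> = (LINT u|lborel. v m u * of_real (gaussian (x /\<^sub>R s m - u))) * of_real C"
    proof -
      have "v m u * of_real (C * gaussian z) = v m u * of_real (gaussian z) * of_real C" for u z :: 'a by simp
      then show ?thesis by (simp only: gaussian_fourier C_def[symmetric] integral_mult_left_zero)
    qed
    also have "(LINT u|lborel. v m u * of_real (gaussian (x /\<^sub>R s m - u)))
       = (LINT y|lborel. v m (y + x /\<^sub>R s m) * of_real (gaussian (x /\<^sub>R s m - (y + x /\<^sub>R s m))))"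
      by (rule integral_translate_lborel[symmetric]) measurable
    also have "\<dots> = (LINT y|lborel. \<phi> (x + s m *\<^sub>R y) * of_real (gaussian (s m *\<^sub>R x + (s m)\<^sup>2 *\<^sub>R y)) * of_real (gaussian y))"
    proof -
      have "s m * s m * inverse (s m) = s m" using s[of m] by simp
      note scale = this
      show ?thesis
        using s[of m] by (simp add: scale v_def scaleR_add_right power2_eq_square add.commute)
    qed
    finally show ?thesis
      using C by (simp add: power2_eq_square)
  qed
  have integrand_bound: "norm (\<phi> (x + s m *\<^sub>R y) * of_real (gaussian (s m *\<^sub>R x + (s m)\<^sup>2 *\<^sub>R y)) * complex_of_real (gaussian y)) \<le> gaussian y"
    for m and x y :: 'a
  proof -
    have "norm (\<phi> (x + s m *\<^sub>R y)) * gaussian (s m *\<^sub>R x + (s m)\<^sup>2 *\<^sub>R y) \<le> 1 * 1"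
      by (intro mult_mono bnd) auto
    from mult_right_mono[OF this, of "gaussian y"] show ?thesis
      by (simp add: norm_mult)
  qed
  have integrand_int: "integrable lborel (\<lambda>y. \<phi> (x + s m *\<^sub>R y) * of_real (gaussian (s m *\<^sub>R x + (s m)\<^sup>2 *\<^sub>R y)) * complex_of_real (gaussian y))"
    for m and x :: 'a
    by (rule Bochner_Integration.integrable_bound[OF integrable_gaussian]) (auto simp: integrand_bound)
  show thesis
  proof (rule that)
    fix m show "sets (N m) = sets borel" by (simp add: N_def)
    have "(\<integral>\<^sup>+x. ennreal (w m x) \<partial>lborel) \<noteq> \<infinity>"
      using w_int[of m] w_nonneg by (subst nn_integral_eq_integral) auto
    then have "finite_measure (density lborel (\<lambda>\<eta>. ennreal (w m \<eta>)))"
      by (intro finite_measureI) (simp add: emeasure_density)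
    then show "finite_measure (N m)"
      unfolding N_def by (rule finite_measure.finite_measure_distr) simp
    fix x :: 'a
    let ?I = "LINT y|lborel. \<phi> (x + s m *\<^sub>R y) * of_real (gaussian (s m *\<^sub>R x + (s m)\<^sup>2 *\<^sub>R y)) * complex_of_real (gaussian y)"
    have "norm ?I \<le> (LINT y|lborel. gaussian (y :: 'a))"
    proof (rule Bochner_Integration.integral_norm_bound_integral)
    qed (auto intro: integrable_gaussian integrand_int integrand_bound)
    then show "norm (LINT \<eta>|N m. cis (\<eta> \<bullet> x)) \<le> 1"
      unfolding N_eq using C by (simp add: norm_divide integral_gaussian flip: C_def)
  next
    fix x :: 'a
    have lim_s: "s \<longlonglongrightarrow> 0" unfolding s_def by (rule LIMSEQ_Suc[OF lim_1_over_n])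
    have "(\<lambda>m. LINT y|lborel. \<phi> (x + s m *\<^sub>R y) * of_real (gaussian (s m *\<^sub>R x + (s m)\<^sup>2 *\<^sub>R y)) * complex_of_real (gaussian y))
       \<longlonglongrightarrow> (LINT y|lborel. \<phi> x * complex_of_real (gaussian (y :: 'a)))"
    proof (rule integral_dominated_convergence[where w = gaussian])
      show "AE y in lborel. (\<lambda>m. \<phi> (x + s m *\<^sub>R y) * of_real (gaussian (s m *\<^sub>R x + (s m)\<^sup>2 *\<^sub>R y)) * complex_of_real (gaussian y))
         \<longlonglongrightarrow> \<phi> x * complex_of_real (gaussian (y :: 'a))"
      proof (rule AE_I2)
        fix y :: 'a
        have "(\<lambda>m. \<phi> (x + s m *\<^sub>R y)) \<longlonglongrightarrow> \<phi> (x + 0 *\<^sub>R y)"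
          using cont by (intro continuous_on_tendsto_compose[OF cont] tendsto_intros lim_s) auto
        moreover have "(\<lambda>m. gaussian (s m *\<^sub>R x + (s m)\<^sup>2 *\<^sub>R y)) \<longlonglongrightarrow> gaussian (0 *\<^sub>R x + 0\<^sup>2 *\<^sub>R y)"
          by (intro continuous_on_tendsto_compose[of UNIV gaussian] continuous_intros tendsto_intros lim_s) auto
        ultimately have "(\<lambda>m. \<phi> (x + s m *\<^sub>R y) * of_real (gaussian (s m *\<^sub>R x + (s m)\<^sup>2 *\<^sub>R y)) * complex_of_real (gaussian y))
         \<longlonglongrightarrow> \<phi> (x + 0 *\<^sub>R y) * of_real (gaussian (0 *\<^sub>R x + 0\<^sup>2 *\<^sub>R y)) * complex_of_real (gaussian y)"
          by (intro tendsto_intros)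
        then show "(\<lambda>m. \<phi> (x + s m *\<^sub>R y) * of_real (gaussian (s m *\<^sub>R x + (s m)\<^sup>2 *\<^sub>R y)) * complex_of_real (gaussian y))
         \<longlonglongrightarrow> \<phi> x * complex_of_real (gaussian y)" by simp
      qed
      fix m
      show "AE y in lborel. norm (\<phi> (x + s m *\<^sub>R y) * of_real (gaussian (s m *\<^sub>R x + (s m)\<^sup>2 *\<^sub>R y)) * complex_of_real (gaussian y)) \<le> gaussian (y :: 'a)"
        by (intro AE_I2 integrand_bound)
    qed (auto intro: integrable_gaussian)
    then have "(\<lambda>m. (LINT y|lborel. \<phi> (x + s m *\<^sub>R y) * of_real (gaussian (s m *\<^sub>R x + (s m)\<^sup>2 *\<^sub>R y)) * complex_of_real (gaussian y)) / of_real C)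
       \<longlonglongrightarrow> (LINT y|lborel. \<phi> x * complex_of_real (gaussian (y :: 'a))) / of_real C"
      using C by (intro tendsto_divide tendsto_const) auto
    also have "(LINT y|lborel. \<phi> x * complex_of_real (gaussian (y :: 'a))) / of_real C = \<phi> x"
      using C by (simp add: integral_gaussian C_def)
    finally show "(\<lambda>m. LINT \<eta>|N m. cis (\<eta> \<bullet> x)) \<longlonglongrightarrow> \<phi> x"
      unfolding N_eq .
  qed
qed

section \<open>Positive definite spherical functions\<close>

lemma continuous_on_parameter_integral:
  fixes e :: "'x::metric_space \<Rightarrow> 'y \<Rightarrow> complex"
  assumes v: "integrable M v" and "\<And>x. e x \<in> borel_measurable M"
    and "\<And>y. continuous_on UNIV (\<lambda>x. e x y)" and "\<And>x y. norm (e x y) \<le> 1"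
  shows "continuous_on UNIV (\<lambda>x. LINT y|M. v y * e x y)"
proof (rule continuous_at_imp_continuous_on, intro ballI)
  fix x
  have [measurable]: "v \<in> borel_measurable M" by (rule borel_measurable_integrable[OF v])
  have [measurable]: "e x \<in> borel_measurable M" for x by fact
  show "isCont (\<lambda>x. LINT y|M. v y * e x y) x"
    unfolding continuous_at_sequentially o_def
  proof (intro allI impI)
    fix X assume X: "X \<longlonglongrightarrow> x"
    show "(\<lambda>n. LINT y|M. v y * e (X n) y) \<longlonglongrightarrow> (LINT y|M. v y * e x y)"
    proof (rule integral_dominated_convergence[where w = "\<lambda>y. norm (v y)"])
      show "AE y in M. (\<lambda>n. v y * e (X n) y) \<longlonglongrightarrow> v y * e x y"
        by (intro AE_I2 tendsto_intros continuous_on_tendsto_compose[OF assms(3) X]) auto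
      show "AE y in M. norm (v y * e (X n) y) \<le> norm (v y)" for n
        using assms(4) by (intro AE_I2) (simp add: norm_mult mult_left_le)
    qed (auto intro: v)
  qed
qed

section \<open>The orthogonal group \<open>K\<close> and averages of plane waves over it\<close>

lemma continuous_on_matrix_vector_mult [continuous_intros]:
  fixes f :: "'a::topological_space \<Rightarrow> real^'n^'m"
  assumes "continuous_on A f" "continuous_on A g"
  shows "continuous_on A (\<lambda>x. f x *v g x)"
  unfolding matrix_vector_mult_def by (intro continuous_intros assms)

lemma continuous_on_matrix_matrix_mult [continuous_intros]:
  fixes f :: "'a::topological_space \<Rightarrow> real^'n^'m" and g :: "'a \<Rightarrow> real^'l^'n"
  assumes "continuous_on A f" "continuous_on A g"
  shows "continuous_on A (\<lambda>x. f x ** g x)"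
  unfolding matrix_matrix_mult_def by (intro continuous_intros assms)

lemma continuous_on_transpose [continuous_intros]:
  fixes f :: "'a::topological_space \<Rightarrow> real^'n^'m"
  assumes "continuous_on A f"
  shows "continuous_on A (\<lambda>x. transpose (f x))"
  unfolding transpose_def by (intro continuous_intros assms)

text \<open>The measure \<kappa> lives on all matrices and is tied to \<open>K\<close> by an
  almost-everywhere statement, so that measurability refers to ordinary Borel sets. Closure under
  transposes expresses closure under inverses.\<close>

locale compact_orthogonal =
  fixes K :: "(real^'n^'n) set" and \<kappa> :: "(real^'n^'n) measure"
  assumes orthogonal: "k \<in> K \<Longrightarrow> orthogonal_matrix k"
    and one_closed: "mat 1 \<in> K"
    and mult_closed: "k \<in> K \<Longrightarrow> l \<in> K \<Longrightarrow> k ** l \<in> K"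
    and transpose_closed: "k \<in> K \<Longrightarrow> transpose k \<in> K"
    and prob: "prob_space \<kappa>" and sets_\<kappa> [measurable_cong]: "sets \<kappa> = sets borel"
    and AE_K: "AE k in \<kappa>. k \<in> K"
    and left_invariant: "l \<in> K \<Longrightarrow> distr \<kappa> borel ((**) l) = \<kappa>"
begin

sublocale \<kappa>: prob_space \<kappa> by (rule prob)

definition K_invariant :: "(real^'n \<Rightarrow> 'c) \<Rightarrow> bool" where
  "K_invariant F \<longleftrightarrow> (\<forall>k\<in>K. \<forall>x. F (k *v x) = F x)"

text \<open>The functions of \<open>Cc_biinv\<close>, seen on the vector space.\<close>

definition test_functions :: "(real^'n \<Rightarrow> complex) set" where
  "test_functions = {F. continuous_on UNIV F \<and> K_invariant F \<and> (\<exists>R. \<forall>x. norm x > R \<longrightarrow> F x = 0)}"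

definition sph :: "real^'n \<Rightarrow> real^'n \<Rightarrow> complex" where
  "sph \<xi> x = (LINT k|\<kappa>. cis (x \<bullet> (k *v \<xi>)))"

lemma norm_K [simp]: "k \<in> K \<Longrightarrow> norm (k *v x) = norm x"
  using orthogonal orthogonal_transformation_matrix[of "(*v) k"] orthogonal_transformation_norm
  by (auto simp: matrix_of_matrix_vector_mul)

lemma inner_transpose: "x \<bullet> (k *v y) = (transpose k *v x) \<bullet> (y :: real^'n)"
  by (metis dot_lmul_matrix vector_transpose_matrix transpose_transpose)

lemma space_\<kappa> [simp]: "space \<kappa> = UNIV"
  using sets_eq_imp_space_eq[OF sets_\<kappa>] by simp

lemma integrable_\<kappa>_const_bound:
  fixes f :: "real^'n^'n \<Rightarrow> 'b::{banach, second_countable_topology}"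
  assumes "continuous_on UNIV f" "\<And>k. k \<in> K \<Longrightarrow> norm (f k) \<le> B"
  shows "integrable \<kappa> f"
  using assms AE_K
  by (intro \<kappa>.integrable_const_bound[of _ B])
    (auto intro!: borel_measurable_continuous_onI simp: measurable_cong_sets[OF sets_\<kappa> refl])

lemma integral_left_invariant:
  fixes f :: "real^'n^'n \<Rightarrow> 'b::{banach, second_countable_topology}"
  assumes "l \<in> K" and [measurable]: "f \<in> borel_measurable borel"
  shows "(LINT k|\<kappa>. f (l ** k)) = (LINT k|\<kappa>. f k)"
proof -
  have [measurable]: "((**) l) \<in> borel_measurable borel"
    by (intro borel_measurable_continuous_onI continuous_intros)
  have "(LINT k|\<kappa>. f k) = (LINT k|distr \<kappa> borel ((**) l). f k)"
    using left_invariant[OF assms(1)] by simp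
  also have "\<dots> = (LINT k|\<kappa>. f (l ** k))"
    by (subst integral_distr) auto
  finally show ?thesis by simp
qed

lemma K_invariant_reflect:
  assumes "K_invariant g"
  shows "K_invariant (\<lambda>y. g (- y))"
proof -
  have "- (k *v x) = k *v (- x)" for k :: "real^'n^'n" and x
    using matrix_vector_mult_diff_distrib[of k 0 x] by simp
  then show ?thesis using assms by (simp add: K_invariant_def)
qed

lemma measurable_sph_integrand [measurable]:
  fixes x \<xi> :: "real^'n"
  shows "(\<lambda>k. cis (x \<bullet> (k *v \<xi>))) \<in> borel_measurable borel"
  by (intro borel_measurable_continuous_onI continuous_intros)

lemma sph_0 [simp]: "sph \<xi> 0 = 1"
  by (simp add: sph_def \<kappa>.prob_space[simplified])

lemma continuous_sph: "continuous_on UNIV (sph \<xi>)"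
proof -
  have "continuous_on UNIV (\<lambda>x. LINT k|\<kappa>. (\<lambda>_. 1) k * cis (x \<bullet> (k *v \<xi>)))"
    by (rule continuous_on_parameter_integral) (auto intro!: continuous_intros)
  then show ?thesis by (simp add: sph_def[abs_def])
qed

lemma K_invariant_sph: "K_invariant (sph \<xi>)"
  unfolding K_invariant_def
proof (intro ballI allI)
  fix l x assume l: "l \<in> K"
  have "(l *v x) \<bullet> (k *v \<xi>) = x \<bullet> ((transpose l ** k) *v \<xi>)" for k
    by (metis inner_transpose matrix_vector_mul_assoc transpose_transpose)
  then have "sph \<xi> (l *v x) = (LINT k|\<kappa>. cis (x \<bullet> ((transpose l ** k) *v \<xi>)))"
    by (simp only: sph_def)
  also have "\<dots> = sph \<xi> x"
    unfolding sph_def by (rule integral_left_invariant) (use l in \<open>auto intro: transpose_closed\<close>)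
  finally show "sph \<xi> (l *v x) = sph \<xi> x" .
qed

text \<open>For each \<open>k\<close> the quadratic form is a squared modulus, because a character
  turns a difference into a product with a conjugate.\<close>

lemma posdef_sph: "posdef_fun (sph \<xi>)"
  unfolding posdef_fun_def
proof (intro allI)
  fix m :: nat and c :: "nat \<Rightarrow> complex" and x :: "nat \<Rightarrow> real^'n"
  have int: "integrable \<kappa> (\<lambda>k. cis ((x i - x j) \<bullet> (k *v \<xi>)) * cnj (c j) * c i)" for i j
    by (intro integrable_mult_left \<kappa>.integrable_const_bound[of _ 1]) auto
  have cis_diff: "cis (a - b) = cis a * cis (- b)" for a b by (simp add: cis_mult)
  have sq: "(\<Sum>i<m. \<Sum>j<m. cis ((x i - x j) \<bullet> (k *v \<xi>)) * cnj (c j) * c i)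
    = (\<Sum>i<m. cis (x i \<bullet> (k *v \<xi>)) * c i) * cnj (\<Sum>i<m. cis (x i \<bullet> (k *v \<xi>)) * c i)" for k
    unfolding cnj_sum sum_product
    by (intro sum.cong refl) (simp only: inner_diff_left cis_diff complex_cnj_mult cis_cnj mult_ac)
  have "(\<Sum>i<m. \<Sum>j<m. sph \<xi> (x i - x j) * cnj (c j) * c i)
    = (\<Sum>i<m. (\<Sum>j<m. (LINT k|\<kappa>. cis ((x i - x j) \<bullet> (k *v \<xi>)) * cnj (c j) * c i)))"
    by (simp add: sph_def)
  also have "\<dots> = (\<Sum>i<m. (LINT k|\<kappa>. (\<Sum>j<m. cis ((x i - x j) \<bullet> (k *v \<xi>)) * cnj (c j) * c i)))"
    by (intro sum.cong refl Bochner_Integration.integral_sum[symmetric] int)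
  also have "\<dots> = (LINT k|\<kappa>. (\<Sum>i<m. (\<Sum>j<m. cis ((x i - x j) \<bullet> (k *v \<xi>)) * cnj (c j) * c i)))"
    by (intro Bochner_Integration.integral_sum[symmetric] Bochner_Integration.integrable_sum int)
  also have "\<dots> \<in> \<real>\<^sub>\<ge>\<^sub>0"
    unfolding sq
    by (intro integral_in_nonneg_Reals) (metis complex_norm_square nonneg_Reals_of_real_iff zero_le_power2)
  finally show "(\<Sum>i<m. \<Sum>j<m. sph \<xi> (x i - x j) * cnj (c j) * c i) \<in> \<real>\<^sub>\<ge>\<^sub>0" .
qed

end

text \<open>In use, \<nu> is the image of Haar measure on the motion group under the projection to
  translations; the listed properties are what the arguments draw from it.\<close>

locale motion_invariant = compact_orthogonal K \<kappa> for K :: "(real^'n^'n) set" and \<kappa> +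
  fixes \<nu> :: "(real^'n) measure"
  assumes sets_\<nu> [measurable_cong]: "sets \<nu> = sets borel"
    and translation_invariant: "distr \<nu> borel ((+) c) = \<nu>"
    and rotation_invariant: "k \<in> K \<Longrightarrow> distr \<nu> borel ((*v) k) = \<nu>"
    and finite_on_balls: "emeasure \<nu> (cball 0 r) < \<infinity>"
    and nonzero: "emeasure \<nu> UNIV \<noteq> 0"
begin

lemma space_\<nu> [simp]: "space \<nu> = UNIV"
  using sets_eq_imp_space_eq[OF sets_\<nu>] by simp

lemma sigma_finite_\<nu>: "sigma_finite_measure \<nu>"
proof
  show "\<exists>A. countable A \<and> A \<subseteq> sets \<nu> \<and> \<Union>A = space \<nu> \<and> (\<forall>a\<in>A. emeasure \<nu> a \<noteq> \<infinity>)"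
  proof (intro exI[of _ "range (\<lambda>n::nat. cball 0 (real n))"] conjI)
    show "\<Union>(range (\<lambda>n::nat. cball (0::real^'n) (real n))) = space \<nu>"
      using real_arch_simple by (auto simp: mem_cball_0)
    show "\<forall>a\<in>range (\<lambda>n::nat. cball 0 (real n)). emeasure \<nu> a \<noteq> \<infinity>"
      using finite_on_balls by (auto simp: less_top[symmetric])
  qed (auto simp: sets_\<nu>)
qed

lemma integral_translate:
  fixes f :: "real^'n \<Rightarrow> 'b::{banach, second_countable_topology}"
  assumes [measurable]: "f \<in> borel_measurable borel"
  shows "(LINT y|\<nu>. f (y + c)) = (LINT y|\<nu>. f y)"
proof -
  have "(LINT x|\<nu>. f x) = (LINT x|distr \<nu> borel ((+) c). f x)"
    by (simp add: translation_invariant)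
  also have "\<dots> = (LINT x|\<nu>. f (x + c))"
    by (subst integral_distr) (auto simp: add.commute)
  finally show ?thesis by simp
qed

lemma integral_rotate:
  fixes f :: "real^'n \<Rightarrow> 'b::{banach, second_countable_topology}"
  assumes "k \<in> K" and [measurable]: "f \<in> borel_measurable borel"
  shows "(LINT y|\<nu>. f (k *v y)) = (LINT y|\<nu>. f y)"
proof -
  have [measurable]: "((*v) k) \<in> borel_measurable borel"
    by (intro borel_measurable_continuous_onI continuous_intros)
  have "(LINT x|\<nu>. f x) = (LINT x|distr \<nu> borel ((*v) k). f x)"
    by (simp add: rotation_invariant[OF assms(1)])
  also have "\<dots> = (LINT x|\<nu>. f (k *v x))"
    by (subst integral_distr) auto
  finally show ?thesis by simp
qed

text \<open>All balls of radius \<open>r\<close> have the same measure and countably many of them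
  cover the space, so one null ball would make \<nu> zero.\<close>

lemma emeasure_ball_pos:
  assumes "r > 0"
  shows "emeasure \<nu> (ball c r) \<noteq> 0"
proof
  assume zero: "emeasure \<nu> (ball c r) = 0"
  have "emeasure \<nu> (ball x r) = 0" for x
  proof -
    have "emeasure \<nu> (ball x r) = emeasure (distr \<nu> borel ((+) (x - c))) (ball x r)"
      by (simp add: translation_invariant)
    also have "\<dots> = emeasure \<nu> ((+) (x - c) -` ball x r)"
      by (subst emeasure_distr) auto
    also have "(+) (x - c) -` ball x r = ball c r"
      by (auto simp: dist_norm algebra_simps)
    finally show ?thesis unfolding zero .
  qed
  then have null: "ball x r \<in> null_sets \<nu>" for x by (auto simp: null_sets_def sets_\<nu>)
  obtain D :: "(real^'n) set" where D: "countable D" "\<And>X. open X \<Longrightarrow> X \<noteq> {} \<Longrightarrow> \<exists>d\<in>D. d \<in> X"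
    by (rule countable_dense_setE) blast
  have "x \<in> (\<Union>d\<in>D. ball d r)" for x :: "real^'n"
  proof -
    obtain d where "d \<in> D" "d \<in> ball x r"
      using D(2)[of "ball x r"] assms by auto
    then show ?thesis by (auto simp: dist_commute)
  qed
  then have "UNIV = (\<Union>d\<in>D. ball d r)" by blast
  moreover have "(\<Union>d\<in>D. ball d r) \<in> null_sets \<nu>"
    by (intro null_sets_UN' D(1) null)
  ultimately have "UNIV \<in> null_sets \<nu>" by simp
  then show False using nonzero by (auto simp: null_sets_def)
qed

lemma continuous_eq_0_of_AE:
  fixes f :: "real^'n \<Rightarrow> 'b::real_normed_vector"
  assumes cont: "continuous_on UNIV f" and ae: "AE x in \<nu>. f x = 0"
  shows "f x = 0"
proof (rule ccontr)
  assume "f x \<noteq> 0"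
  have "open {y. f y \<noteq> 0}"
    using cont by (intro open_Collect_neq continuous_on_const)
  with \<open>f x \<noteq> 0\<close> obtain r where r: "r > 0" "ball x r \<subseteq> {y. f y \<noteq> 0}"
    unfolding open_contains_ball by blast
  have "AE y in \<nu>. y \<notin> ball x r"
    using ae by eventually_elim (use r in auto)
  then have "emeasure \<nu> (ball x r) = 0"
    using AE_iff_null_sets[of "ball x r" \<nu>] by (simp add: sets_\<nu> null_sets_def del: mem_ball)
  with emeasure_ball_pos[OF r(1)] show False by simp
qed

section \<open>Test functions and their transforms\<close>

lemma test_function_integrable:
  assumes "F \<in> test_functions"
  shows "integrable \<nu> F"
proof -
  obtain R where R: "\<And>x. norm x > R \<Longrightarrow> F x = 0" and cont: "continuous_on UNIV F"
    using assms by (auto simp: test_functions_def)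
  have "compact (F ` cball 0 R)"
    by (intro compact_continuous_image continuous_on_subset[OF cont]) auto
  then obtain B where B: "\<And>x. x \<in> cball 0 R \<Longrightarrow> norm (F x) \<le> B"
    by (metis compact_imp_bounded bounded_iff imageI)
  show ?thesis
  proof (rule integrableI_bounded_set[where A = "cball 0 R" and B = B])
    show "F \<in> borel_measurable \<nu>"
      using borel_measurable_continuous_onI[OF cont] by (simp add: measurable_cong_sets[OF sets_\<nu> refl])
    show "AE x in \<nu>. x \<in> cball 0 R \<longrightarrow> norm (F x) \<le> B" using B by auto
    show "AE x in \<nu>. x \<notin> cball 0 R \<longrightarrow> F x = 0" using R by (auto simp: mem_cball_0)
  qed (use finite_on_balls in \<open>auto simp: sets_\<nu>\<close>)
qed

lemma test_function_measurable: "F \<in> test_functions \<Longrightarrow> F \<in> borel_measurable borel"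
  by (auto simp: test_functions_def intro: borel_measurable_continuous_onI)

text \<open>Testing against \<open>cnj h\<close> times a cutoff yields the integral of a nonnegative
  continuous function, which therefore vanishes everywhere.\<close>

lemma test_functions_separate:
  assumes cont: "continuous_on UNIV h" and inv: "K_invariant h"
    and zero: "\<And>F. F \<in> test_functions \<Longrightarrow> (LINT y|\<nu>. F y * h y) = 0"
  shows "h x = 0"
proof -
  \<comment> \<open>Radial, hence \<open>K\<close>-invariant; equal to \<open>1\<close> at
    \<open>x\<close>, and zero from norm \<open>1 + norm x\<close> on.\<close>
  define b where "b y = max 0 (1 + norm x - norm y)" for y :: "real^'n"
  define F where "F y = cnj (h y) * of_real (b y)" for y
  have cont_b: "continuous_on UNIV b" unfolding b_def by (intro continuous_intros)
  have test: "F' \<in> test_functions" if "continuous_on UNIV g" "K_invariant g" "F' = (\<lambda>y. g y * of_real (b y))" for g F'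
    using that cont_b inv unfolding test_functions_def K_invariant_def
    by (auto intro!: continuous_intros exI[of _ "1 + norm x"] simp: b_def)
  have F: "F \<in> test_functions"
    using inv by (intro test[of "\<lambda>y. cnj (h y)"] continuous_intros cont) (auto simp: F_def K_invariant_def)
  have Fh: "F y * h y = of_real ((norm (h y))\<^sup>2 * b y)" for y
    unfolding F_def of_real_mult complex_norm_square by (simp add: mult_ac)
  have "(\<lambda>y. F y * h y) \<in> test_functions"
    using inv by (intro test[of "\<lambda>y. cnj (h y) * h y"] continuous_intros cont) (auto simp: F_def K_invariant_def)
  from test_function_integrable[OF this]
  have int: "integrable \<nu> (\<lambda>y. (norm (h y))\<^sup>2 * b y)" unfolding Fh by (simp only: complex_of_real_integrable_eq)
  have "(LINT y|\<nu>. (norm (h y))\<^sup>2 * b y) = 0"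
    using zero[OF F] unfolding Fh by (simp only: integral_complex_of_real of_real_eq_0_iff)
  then have "AE y in \<nu>. (norm (h y))\<^sup>2 * b y = 0"
    by (subst (asm) integral_nonneg_eq_0_iff_AE[OF int]) (auto simp: b_def)
  then have "(norm (h x))\<^sup>2 * b x = 0"
    by (rule continuous_eq_0_of_AE[rotated]) (intro continuous_intros cont cont_b)
  then show ?thesis by (auto simp: b_def)
qed

definition transform :: "(real^'n \<Rightarrow> complex) \<Rightarrow> real^'n \<Rightarrow> complex" where
  "transform F \<eta> = (LINT y|\<nu>. F y * cis (- (y \<bullet> \<eta>)))"

lemma continuous_transform:
  assumes "F \<in> test_functions"
  shows "continuous_on UNIV (transform F)"
  unfolding transform_def[abs_def]
  by (rule continuous_on_parameter_integral[OF test_function_integrable[OF assms]])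
    (auto intro!: continuous_intros)

lemma norm_transform_le: "norm (transform F \<eta>) \<le> (LINT y|\<nu>. norm (F y))"
  unfolding transform_def using integral_norm_bound[of \<nu> "\<lambda>y. F y * cis (- (y \<bullet> \<eta>))"]
  by (simp add: norm_mult)

lemma transform_rotate:
  assumes F: "F \<in> test_functions" and k: "k \<in> K"
  shows "transform F (k *v \<eta>) = transform F \<eta>"
proof -
  note [measurable] = test_function_measurable[OF F]
  have "F (transpose k *v y) = F y" for y
    using F transpose_closed[OF k] by (simp only: test_functions_def K_invariant_def) blast
  then have "F y * cis (- (y \<bullet> (k *v \<eta>))) = F (transpose k *v y) * cis (- ((transpose k *v y) \<bullet> \<eta>))" for y
    by (simp only: inner_transpose[of y k])
  then have "transform F (k *v \<eta>) = (LINT y|\<nu>. F (transpose k *v y) * cis (- ((transpose k *v y) \<bullet> \<eta>)))"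
    by (simp only: transform_def)
  also have "\<dots> = transform F \<eta>"
    unfolding transform_def by (rule integral_rotate[OF transpose_closed[OF k]]) measurable
  finally show ?thesis .
qed

text \<open>The plane wave of frequency \<open>k *v \<xi>\<close> is an eigenfunction of convolution
  with \<open>F\<close>, and its eigenvalue is constant along the orbit by
  \<open>transform_rotate\<close>; so it survives the average over \<open>k\<close>.\<close>

lemma convolution_sph:
  assumes F: "F \<in> test_functions"
  shows "(LINT y|\<nu>. F y * sph \<xi> (x - y)) = transform F \<xi> * sph \<xi> x"
proof -
  have m: "(\<lambda>(y, k). cis ((x - y) \<bullet> (k *v \<xi>))) \<in> borel_measurable (borel \<Otimes>\<^sub>M borel)"
    unfolding borel_prod by (intro borel_measurable_continuous_onI) (auto simp: case_prod_unfold intro!: continuous_intros)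
  have "(LINT y|\<nu>. F y * sph \<xi> (x - y)) = (LINT y|\<nu>. F y * (LINT k|\<kappa>. 1 * cis ((x - y) \<bullet> (k *v \<xi>))))"
    by (simp add: sph_def)
  also have "\<dots> = (LINT k|\<kappa>. 1 * (LINT y|\<nu>. F y * cis ((x - y) \<bullet> (k *v \<xi>))))"
    using m by (intro integral_mult_swap[where B = 1] sigma_finite_\<nu> test_function_integrable F)
      (auto simp: measurable_cong_sets[OF sets_pair_measure_cong[OF sets_\<nu> sets_\<kappa>] refl] intro: \<kappa>.sigma_finite_measure_axioms)
  also have "\<dots> = (LINT k|\<kappa>. cis (x \<bullet> (k *v \<xi>)) * transform F (k *v \<xi>))"
  proof -
    have "F y * cis ((x - y) \<bullet> z) = cis (x \<bullet> z) * (F y * cis (- (y \<bullet> z)))" for y z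
      by (simp add: inner_diff_left cis_mult)
    then show ?thesis by (simp only: transform_def integral_mult_right_zero mult_1)
  qed
  also have "\<dots> = (LINT k|\<kappa>. cis (x \<bullet> (k *v \<xi>)) * transform F \<xi>)"
  proof (rule integral_cong_AE)
    have "(\<lambda>k. transform F (k *v \<xi>)) \<in> borel_measurable borel"
      by (intro borel_measurable_continuous_onI continuous_on_compose2[OF continuous_transform[OF F]] continuous_intros) auto
    then show "(\<lambda>k. cis (x \<bullet> (k *v \<xi>)) * transform F (k *v \<xi>)) \<in> borel_measurable \<kappa>"
      by measurable
    show "AE k in \<kappa>. cis (x \<bullet> (k *v \<xi>)) * transform F (k *v \<xi>) = cis (x \<bullet> (k *v \<xi>)) * transform F \<xi>"
      using AE_K by eventually_elim (simp add: transform_rotate[OF F])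
  qed measurable
  also have "\<dots> = transform F \<xi> * sph \<xi> x"
    by (simp add: sph_def)
  finally show ?thesis .
qed

text \<open>Riemann--Lebesgue: translating by \<open>\<pi>\<eta> / |\<eta>|\<^sup>2\<close> changes the sign of the exponential.\<close>

lemma transform_vanishes_at_infinity:
  assumes F: "F \<in> test_functions" and "e > 0"
  obtains R where "\<And>\<eta>. norm \<eta> > R \<Longrightarrow> norm (transform F \<eta>) < e"
proof -
  obtain R0 where R0: "\<And>x. norm x > R0 \<Longrightarrow> F x = 0" and cont: "continuous_on UNIV F"
    using F by (auto simp: test_functions_def)
  \<comment> \<open>The margin \<open>1\<close> ensures that for \<open>norm y > R\<close> both
    \<open>y\<close> and its translate by a vector shorter than \<open>1\<close> lie outside the
    support.\<close>
  define R where "R = max R0 0 + 1"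
  have R: "R > 0" "\<And>x. norm x > R - 1 \<Longrightarrow> F x = 0" using R0 by (auto simp: R_def)
  note [measurable] = test_function_measurable[OF F]
  define V where "V = measure \<nu> (cball 0 R)"
  \<comment> \<open>\<open>V + 1\<close> rather than \<open>V\<close> keeps the denominator visibly
    positive. The final estimate is \<open>\<epsilon> * V < 2 * e\<close>, since the difference of
    the two integrals is twice the transform.\<close>
  define \<epsilon> where "\<epsilon> = e / (V + 1)"
  have V: "V \<ge> 0" by (simp add: V_def)
  have \<epsilon>: "\<epsilon> > 0" using \<open>e > 0\<close> V by (simp add: \<epsilon>_def)
  have "uniformly_continuous_on (cball 0 (R + 1)) F"
    by (intro compact_uniformly_continuous continuous_on_subset[OF cont]) auto
  then obtain d where d: "d > 0" "\<And>x y. x \<in> cball 0 (R + 1) \<Longrightarrow> y \<in> cball 0 (R + 1) \<Longrightarrow> dist y x < d \<Longrightarrow> dist (F y) (F x) < \<epsilon>"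
    using \<epsilon> unfolding uniformly_continuous_on_def by metis
  define d' where "d' = min d 1"
  have d': "d' > 0" "d' \<le> 1" "d' \<le> d" using d(1) by (auto simp: d'_def)
  show thesis
  proof (rule that[of "pi / d'"])
    fix \<eta> :: "real^'n" assume \<eta>: "norm \<eta> > pi / d'"
    then have n: "norm \<eta> > 0" using d' pi_gt_zero by (smt (verit) divide_pos_pos)
    define c where "c = (pi / (norm \<eta>)\<^sup>2) *\<^sub>R \<eta>"
    have c\<eta>: "c \<bullet> \<eta> = pi" using n by (simp add: c_def dot_square_norm)
    have "norm c = pi / norm \<eta>" using n by (simp add: c_def power2_eq_square)
    moreover have "pi < d' * norm \<eta>" using \<eta> d'(1) by (simp add: pos_divide_less_eq mult.commute)
    ultimately have nc: "norm c < d'" using n by (simp only: pos_divide_less_eq)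
    have diff: "norm (F y - F (y + c)) \<le> \<epsilon> * indicator (cball 0 R) y" for y
    proof (cases "norm y \<le> R")
      case True
      have "norm (y + c) \<le> R + 1" using norm_triangle_ineq[of y c] True nc d' by linarith
      then have "y + c \<in> cball 0 (R + 1)" "y \<in> cball 0 (R + 1)"
        using True by (auto simp: mem_cball_0)
      moreover have "dist y (y + c) < d"
        using nc d' by (simp add: dist_norm)
      ultimately have "dist (F y) (F (y + c)) < \<epsilon>" by (rule d(2))
      then show ?thesis using True by (simp add: dist_norm mem_cball_0)
    next
      case False
      moreover have "norm (y + c) > R - 1"
        using norm_triangle_ineq4[of "y + c" c] False nc d' by (simp add: algebra_simps)
      ultimately show ?thesis using R(2)[of y] R(2)[of "y + c"] by simp
    qed
    have int: "integrable \<nu> (\<lambda>y. F y * cis (- (y \<bullet> \<eta>)))"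
      by (rule Bochner_Integration.integrable_bound[OF test_function_integrable[OF F]]) (auto simp: norm_mult)
    have cis_pi: "cis (- (a + pi)) = - cis (- a)" for a by (simp add: complex_eq_iff)
    have shift: "F (y + c) * cis (- ((y + c) \<bullet> \<eta>)) = - (F (y + c) * cis (- (y \<bullet> \<eta>)))" for y
      by (simp only: inner_add_left c\<eta> cis_pi mult_minus_right)
    have int': "integrable \<nu> (\<lambda>y. F (y + c) * cis (- (y \<bullet> \<eta>)))"
    proof -
      have "integrable (distr \<nu> borel ((+) c)) (\<lambda>y. F y * cis (- (y \<bullet> \<eta>)))"
        using int by (simp add: translation_invariant)
      then have "integrable \<nu> (\<lambda>y. F (y + c) * cis (- ((y + c) \<bullet> \<eta>)))"
        by (subst (asm) integrable_distr_eq) (auto simp: add.commute)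
      then show ?thesis unfolding shift by simp
    qed
    have "transform F \<eta> = (LINT y|\<nu>. F (y + c) * cis (- ((y + c) \<bullet> \<eta>)))"
      unfolding transform_def by (rule integral_translate[symmetric]) measurable
    also have "\<dots> = - (LINT y|\<nu>. F (y + c) * cis (- (y \<bullet> \<eta>)))"
      unfolding shift by simp
    finally have "2 * transform F \<eta> = (LINT y|\<nu>. F y * cis (- (y \<bullet> \<eta>))) - (LINT y|\<nu>. F (y + c) * cis (- (y \<bullet> \<eta>)))"
      by (simp add: transform_def)
    also have "\<dots> = (LINT y|\<nu>. (F y - F (y + c)) * cis (- (y \<bullet> \<eta>)))"
      using int int' by (simp add: left_diff_distrib)
    finally have two: "2 * transform F \<eta> = (LINT y|\<nu>. (F y - F (y + c)) * cis (- (y \<bullet> \<eta>)))" .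
    have "norm (2 * transform F \<eta>) \<le> (LINT y|\<nu>. \<epsilon> * indicator (cball 0 R) y)"
      unfolding two
    proof (rule Bochner_Integration.integral_norm_bound_integral)
      show "integrable \<nu> (\<lambda>y. (F y - F (y + c)) * cis (- (y \<bullet> \<eta>)))"
        using int int' by (simp add: left_diff_distrib)
      show "integrable \<nu> (\<lambda>y. \<epsilon> * indicator (cball 0 R) y)"
        using finite_on_balls[of R] by (intro integrable_mult_right integrable_real_indicator) (auto simp: sets_\<nu>)
    qed (use diff in \<open>auto simp: norm_mult\<close>)
    also have "\<dots> = \<epsilon> * V" by (simp add: V_def)
    also have "\<epsilon> * V < 2 * e" using \<open>e > 0\<close> V by (simp add: \<epsilon>_def field_simps add_nonneg_pos)
    finally show "norm (transform F \<eta>) < e" by (simp add: norm_mult)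
  qed
qed

section \<open>Eigenvalues as values of transforms at a real point\<close>

lemma measurable_cis_inner_pair:
  assumes "sets N = sets borel"
  shows "(\<lambda>(\<eta>, y). cis (\<eta> \<bullet> (z - y))) \<in> borel_measurable (N \<Otimes>\<^sub>M \<nu>)" (is ?A)
    and "(\<lambda>(\<eta>, y). cis (\<eta> \<bullet> (y :: real^'n))) \<in> borel_measurable (N \<Otimes>\<^sub>M \<nu>)" (is ?B)
proof -
  have "(\<lambda>(\<eta>, y). cis (\<eta> \<bullet> (z - y))) \<in> borel_measurable (borel \<Otimes>\<^sub>M borel)"
    unfolding borel_prod by (intro borel_measurable_continuous_onI) (auto simp: case_prod_unfold intro!: continuous_intros)
  then show ?A
    by (simp add: measurable_cong_sets[OF sets_pair_measure_cong[OF assms sets_\<nu>] refl])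
  have "(\<lambda>(\<eta>, y). cis (\<eta> \<bullet> (y :: real^'n))) \<in> borel_measurable (borel \<Otimes>\<^sub>M borel)"
    unfolding borel_prod by (intro borel_measurable_continuous_onI) (auto simp: case_prod_unfold intro!: continuous_intros)
  then show ?B
    by (simp add: measurable_cong_sets[OF sets_pair_measure_cong[OF assms sets_\<nu>] refl])
qed

text \<open>With \<open>ew\<close> the eigenvalue of \<open>F\<close>, the variance \<open>\<integral> |transform F - ew|\<^sup>2\<close> against
  the approximate Bochner measures tends to \<open>(F\<^sup>* * F * \<phi>)(0) - |ew|\<^sup>2 = 0\<close>.\<close>

lemma variance_tendsto_0:
  assumes pd: "posdef_fun \<phi>" and cont: "continuous_on UNIV \<phi>" and one: "\<phi> 0 = 1"
    and F: "F \<in> test_functions" and eigen: "\<And>x. (LINT y|\<nu>. F y * \<phi> (x - y)) = ew * \<phi> x"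
    and N: "\<And>m. finite_measure (N m)" and sets_N: "\<And>m. sets (N m) = sets borel"
    and bound: "\<And>m x. norm (LINT \<eta>|N m. cis (\<eta> \<bullet> x)) \<le> 1"
    and lim: "\<And>x. (\<lambda>m. LINT \<eta>|N m. cis (\<eta> \<bullet> x)) \<longlonglongrightarrow> \<phi> x"
  shows "(\<lambda>m. LINT \<eta>|N m. (norm (transform F \<eta> - ew))\<^sup>2) \<longlonglongrightarrow> 0"
    and "\<And>m. integrable (N m) (\<lambda>\<eta>. (norm (transform F \<eta> - ew))\<^sup>2)"
proof -
  note [measurable] = test_function_measurable[OF F] borel_measurable_continuous_onI[OF cont]
  have [measurable_cong]: "sets (N m) = sets borel" for m by fact
  have sf: "sigma_finite_measure (N m)" for m using N by (simp add: finite_measure.axioms(1))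
  note F_int = test_function_integrable[OF F]
  have F_cnj_int: "integrable \<nu> (\<lambda>y. cnj (F y))" using F_int by simp
  have [measurable]: "(\<lambda>y. cnj (F y)) \<in> borel_measurable \<nu>"
    by (rule borel_measurable_integrable[OF F_cnj_int])
  have [measurable]: "transform F \<in> borel_measurable borel"
    by (intro borel_measurable_continuous_onI continuous_transform F)
  define W where "W m x = (LINT \<eta>|N m. cis (\<eta> \<bullet> x))" for m x
  have W_meas [measurable]: "W m \<in> borel_measurable borel" for m
  proof (intro borel_measurable_continuous_onI)
    have "continuous_on UNIV (\<lambda>x. LINT \<eta>|N m. (\<lambda>_. 1) \<eta> * cis (\<eta> \<bullet> x))"
      using finite_measure.integrable_const[OF N]
      by (intro continuous_on_parameter_integral) (auto intro!: continuous_intros)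
    then show "continuous_on UNIV (W m)" by (simp add: W_def[abs_def])
  qed
  have W_bound: "norm (W m x) \<le> 1" and W_lim: "(\<lambda>m. W m x) \<longlonglongrightarrow> \<phi> x" for m x
    using bound lim by (auto simp: W_def)
  \<comment> \<open>By \<open>V_eq\<close> this is the convolution of \<open>F\<close> with the
    approximant \<open>W m\<close>, so it tends to \<open>ew * \<phi> z\<close>; paired with
    \<open>cnj (F z)\<close> it gives the second moment \<open>A m\<close>.\<close>
  define V where "V m z = (LINT \<eta>|N m. transform F \<eta> * cis (\<eta> \<bullet> z))" for m z
  have bounded_int: "integrable (N m) g" if "g \<in> borel_measurable borel" "\<And>x. norm (g x) \<le> c" for g :: "real^'n \<Rightarrow> complex" and c m
    using that by (intro finite_measure.integrable_const_bound[OF N, of _ c]) auto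
  have V_eq: "V m z = (LINT y|\<nu>. F y * W m (z - y))" for m z
  proof -
    have "V m z = (LINT \<eta>|N m. 1 * (LINT y|\<nu>. F y * cis (\<eta> \<bullet> (z - y))))"
      unfolding V_def transform_def integral_mult_left_zero[symmetric]
      by (simp add: mult.assoc cis_mult inner_diff_right inner_commute)
    also have "\<dots> = (LINT y|\<nu>. F y * (LINT \<eta>|N m. 1 * cis (\<eta> \<bullet> (z - y))))"
      by (rule integral_mult_swap[where B = 1])
        (auto intro: sf sigma_finite_\<nu> F_int measurable_cis_inner_pair sets_N finite_measure.integrable_const[OF N])
    finally show ?thesis by (simp add: W_def)
  qed
  have FW: "norm (F y * W m x) \<le> norm (F y)" for m x y
    using W_bound by (simp add: norm_mult mult_left_le)
  have V_lim: "(\<lambda>m. V m z) \<longlonglongrightarrow> ew * \<phi> z" for z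
    unfolding V_eq eigen[symmetric]
  proof (rule integral_dominated_convergence[where w = "\<lambda>y. norm (F y)"])
    show "AE y in \<nu>. (\<lambda>m. F y * W m (z - y)) \<longlonglongrightarrow> F y * \<phi> (z - y)"
      by (intro AE_I2 tendsto_intros W_lim)
  qed (use F_int FW in auto)
  have V_bound: "norm (V m z) \<le> (LINT y|\<nu>. norm (F y))" for m z
    unfolding V_eq
  proof (rule Bochner_Integration.integral_norm_bound_integral)
    show "integrable \<nu> (\<lambda>y. F y * W m (z - y))"
      by (rule Bochner_Integration.integrable_bound[OF F_int]) (use FW in auto)
  qed (use F_int FW in auto)
  have V_meas [measurable]: "V m \<in> borel_measurable borel" for m
  proof (intro borel_measurable_continuous_onI)
    show "continuous_on UNIV (V m)"
      unfolding V_def[abs_def]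
      by (rule continuous_on_parameter_integral[OF bounded_int[OF _ norm_transform_le]])
        (auto intro!: continuous_intros)
  qed
  have cnj_transform: "cnj (transform F \<eta>) = (LINT y|\<nu>. cnj (F y) * cis (\<eta> \<bullet> y))" for \<eta>
  proof -
    have "(LINT y|\<nu>. cnj (F y) * cis (\<eta> \<bullet> y)) = (LINT y|\<nu>. cnj (F y * cis (- (y \<bullet> \<eta>))))"
      by (rule Bochner_Integration.integral_cong) (simp_all add: cis_cnj inner_commute)
    also have "\<dots> = cnj (transform F \<eta>)"
      unfolding transform_def by (rule Bochner_Integration.integral_cnj)
    finally show ?thesis by simp
  qed
  define A where "A m = (LINT \<eta>|N m. transform F \<eta> * cnj (transform F \<eta>))" for m
  have A_eq: "A m = (LINT z|\<nu>. cnj (F z) * V m z)" for m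
    unfolding A_def V_def cnj_transform
    by (rule integral_mult_swap[where B = 1])
      (auto intro: sf sigma_finite_\<nu> F_int F_cnj_int measurable_cis_inner_pair sets_N bounded_int[OF _ norm_transform_le])
  have "(\<lambda>m. LINT z|\<nu>. cnj (F z) * V m z) \<longlonglongrightarrow> (LINT z|\<nu>. cnj (F z) * (ew * \<phi> z))"
  proof (rule integral_dominated_convergence[where w = "\<lambda>z. norm (F z) * (LINT y|\<nu>. norm (F y))"])
    show "AE z in \<nu>. (\<lambda>m. cnj (F z) * V m z) \<longlonglongrightarrow> cnj (F z) * (ew * \<phi> z)"
      by (intro AE_I2 tendsto_intros V_lim)
    show "AE z in \<nu>. norm (cnj (F z) * V m z) \<le> norm (F z) * (LINT y|\<nu>. norm (F y))" for m
      using V_bound by (auto simp: norm_mult intro!: mult_left_mono)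
  qed (use F_int in auto)
  \<comment> \<open>Hermitian symmetry of \<phi> turns the conjugate of the eigenvalue equation at
    \<open>0\<close> into the integral of \<open>cnj (F z) * \<phi> z\<close>.\<close>
  moreover have "(LINT z|\<nu>. cnj (F z) * (ew * \<phi> z)) = ew * cnj ew"
  proof -
    have "cnj ew = cnj (LINT z|\<nu>. F z * \<phi> (0 - z))" using eigen[of 0] one by simp
    also have "\<dots> = (LINT z|\<nu>. cnj (F z) * \<phi> z)"
      unfolding Bochner_Integration.integral_cnj[symmetric] by (simp add: posdef_fun_bounds(1)[OF pd])
    finally show ?thesis by (simp add: mult.left_commute[of _ ew])
  qed
  ultimately have A_lim: "A \<longlonglongrightarrow> ew * cnj ew"
    unfolding A_eq[abs_def] by simp
  define B where "B m = V m 0" for m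
  have B_lim: "B \<longlonglongrightarrow> ew" using V_lim[of 0] one by (simp add: B_def[abs_def])
  have sq: "complex_of_real ((norm (transform F \<eta> - ew))\<^sup>2)
     = transform F \<eta> * cnj (transform F \<eta>) - cnj ew * transform F \<eta> - ew * cnj (transform F \<eta>) + ew * cnj ew" for \<eta>
    unfolding complex_norm_square by (simp add: algebra_simps)
  have T_int: "integrable (N m) (transform F)" for m
    by (rule bounded_int[OF _ norm_transform_le]) measurable
  have TT_int: "integrable (N m) (\<lambda>\<eta>. transform F \<eta> * cnj (transform F \<eta>))" for m
  proof (rule bounded_int)
    show "norm (transform F \<eta> * cnj (transform F \<eta>)) \<le> (LINT y|\<nu>. norm (F y)) * (LINT y|\<nu>. norm (F y))" for \<eta>
      unfolding norm_mult complex_mod_cnj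
      by (intro mult_mono norm_transform_le order_trans[OF norm_ge_zero norm_transform_le] norm_ge_zero)
  qed (intro borel_measurable_continuous_onI continuous_intros continuous_transform F)
  have const_int: "integrable (N m) (\<lambda>_. c :: complex)" for m c
    by (rule finite_measure.integrable_const[OF N])
  show int: "integrable (N m) (\<lambda>\<eta>. (norm (transform F \<eta> - ew))\<^sup>2)" for m
  proof -
    have "integrable (N m) (\<lambda>\<eta>. complex_of_real ((norm (transform F \<eta> - ew))\<^sup>2))"
      unfolding sq using T_int TT_int const_int by auto
    then show ?thesis by (simp only: complex_of_real_integrable_eq)
  qed
  have "complex_of_real (LINT \<eta>|N m. (norm (transform F \<eta> - ew))\<^sup>2)
    = A m - cnj ew * B m - ew * cnj (B m) + ew * cnj ew * W m 0" for m
    unfolding integral_complex_of_real[symmetric] sq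
    using T_int TT_int const_int by (simp add: A_def B_def V_def W_def)
  \<comment> \<open>The total mass \<open>W m 0\<close> need not be \<open>1\<close>, but tends to
    \<open>\<phi> 0 = 1\<close>; the four terms cancel in the limit.\<close>
  moreover have "(\<lambda>m. A m - cnj ew * B m - ew * cnj (B m) + ew * cnj ew * W m 0)
     \<longlonglongrightarrow> ew * cnj ew - cnj ew * ew - ew * cnj ew + ew * cnj ew * \<phi> 0"
    by (intro tendsto_intros A_lim B_lim W_lim)
  ultimately have "(\<lambda>m. complex_of_real (LINT \<eta>|N m. (norm (transform F \<eta> - ew))\<^sup>2)) \<longlonglongrightarrow> of_real 0"
    using one by simp
  then show "(\<lambda>m. LINT \<eta>|N m. (norm (transform F \<eta> - ew))\<^sup>2) \<longlonglongrightarrow> 0"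
    by (simp only: tendsto_of_real_iff)
qed

text \<open>If every point missed some eigenvalue by more than \<delta>, the variances would add up
  to at least \<delta>^2 times the mass of \<open>N m\<close>; but the masses tend to
  \<open>1\<close> and the variances to \<open>0\<close>.\<close>

lemma eigenvalues_approximated:
  assumes pd: "posdef_fun \<phi>" and cont: "continuous_on UNIV \<phi>" and one: "\<phi> 0 = 1"
    and S: "finite S" "S \<subseteq> test_functions"
    and eigen: "\<And>F x. F \<in> S \<Longrightarrow> (LINT y|\<nu>. F y * \<phi> (x - y)) = ew F * \<phi> x"
    and "\<delta> > 0"
  shows "\<exists>\<eta>. \<forall>F\<in>S. norm (transform F \<eta> - ew F) \<le> \<delta>"
proof (rule ccontr)
  assume "\<not> ?thesis"
  then have no: "\<exists>F\<in>S. norm (transform F \<eta> - ew F) > \<delta>" for \<eta> by (auto simp: not_le)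
  obtain N :: "nat \<Rightarrow> (real^'n) measure" where N: "\<And>m. finite_measure (N m)" "\<And>m. sets (N m) = sets borel"
    "\<And>m x. norm (LINT \<eta>|N m. cis (\<eta> \<bullet> x)) \<le> 1" "\<And>x. (\<lambda>m. LINT \<eta>|N m. cis (\<eta> \<bullet> x)) \<longlonglongrightarrow> \<phi> x"
    using bochner_approximation[OF pd cont one] by blast
  have var: "(\<lambda>m. LINT \<eta>|N m. (norm (transform F \<eta> - ew F))\<^sup>2) \<longlonglongrightarrow> 0"
    "integrable (N m) (\<lambda>\<eta>. (norm (transform F \<eta> - ew F))\<^sup>2)" if "F \<in> S" for F m
    using variance_tendsto_0[OF pd cont one _ eigen N] that S(2) by blast+
  have mass: "(\<lambda>m. measure (N m) UNIV) \<longlonglongrightarrow> 1"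
  proof -
    have "space (N m) = UNIV" for m using sets_eq_imp_space_eq[OF N(2)] by simp
    then have "(\<lambda>m. complex_of_real (measure (N m) UNIV)) \<longlonglongrightarrow> of_real 1"
      using N(4)[of 0] one by (simp add: scaleR_conv_of_real)
    then show ?thesis by (simp only: tendsto_of_real_iff)
  qed
  have "\<delta>\<^sup>2 * measure (N m) UNIV \<le> (\<Sum>F\<in>S. LINT \<eta>|N m. (norm (transform F \<eta> - ew F))\<^sup>2)" for m
  proof -
    interpret finite_measure "N m" by (rule N(1))
    have sp: "space (N m) = UNIV" using sets_eq_imp_space_eq[OF N(2)] by simp
    have "(LINT \<eta>|N m. \<delta>\<^sup>2) \<le> (LINT \<eta>|N m. (\<Sum>F\<in>S. (norm (transform F \<eta> - ew F))\<^sup>2))"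
    proof (rule integral_mono)
      fix \<eta>
      obtain F where F: "F \<in> S" "norm (transform F \<eta> - ew F) > \<delta>" using no by blast
      have "\<delta>\<^sup>2 \<le> (norm (transform F \<eta> - ew F))\<^sup>2" using F \<open>\<delta> > 0\<close> by (intro power_mono) auto
      also have "\<dots> \<le> (\<Sum>F\<in>S. (norm (transform F \<eta> - ew F))\<^sup>2)"
        using F S(1) by (intro member_le_sum) auto
      finally show "\<delta>\<^sup>2 \<le> (\<Sum>F\<in>S. (norm (transform F \<eta> - ew F))\<^sup>2)" .
    qed (auto intro!: Bochner_Integration.integrable_sum var)
    then show ?thesis using var by (simp add: Bochner_Integration.integral_sum sp mult.commute)
  qed
  moreover have "(\<lambda>m. \<Sum>F\<in>S. LINT \<eta>|N m. (norm (transform F \<eta> - ew F))\<^sup>2) \<longlonglongrightarrow> (\<Sum>F\<in>S. 0)"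
    by (intro tendsto_sum var)
  moreover have "(\<lambda>m. \<delta>\<^sup>2 * measure (N m) UNIV) \<longlonglongrightarrow> \<delta>\<^sup>2 * 1"
    by (intro tendsto_intros mass)
  ultimately have "\<delta>\<^sup>2 * 1 \<le> (\<Sum>F\<in>S. 0)"
    by (intro LIMSEQ_le) auto
  then show False using \<open>\<delta> > 0\<close> by simp
qed

lemma posdef_eigenfunction_is_sph:
  assumes pd: "posdef_fun \<phi>" and cont: "continuous_on UNIV \<phi>" and one: "\<phi> 0 = 1"
    and inv: "K_invariant \<phi>"
    and eigen: "\<And>F. F \<in> test_functions \<Longrightarrow> \<exists>c. \<forall>x. (LINT y|\<nu>. F y * \<phi> (x - y)) = c * \<phi> x"
  shows "\<exists>\<xi>. \<phi> = sph \<xi>"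
proof -
  define ew where "ew F = (LINT y|\<nu>. F y * \<phi> (- y))" for F
  have ew: "(LINT y|\<nu>. F y * \<phi> (x - y)) = ew F * \<phi> x" if F: "F \<in> test_functions" for F x
  proof -
    obtain c where c: "\<And>x. (LINT y|\<nu>. F y * \<phi> (x - y)) = c * \<phi> x" using eigen[OF F] by blast
    then show ?thesis using c[of 0] one by (simp add: ew_def)
  qed
  have cont': "continuous_on UNIV (\<lambda>y. \<phi> (- y))"
    by (intro continuous_on_compose2[OF cont] continuous_intros) auto
  \<comment> \<open>Some eigenvalue is nonzero, since otherwise separation would give
    \<open>\<phi> 0 = 0\<close>. The transform of \<open>F0\<close> confines the approximate
    solutions to one ball.\<close>
  obtain F0 where F0: "F0 \<in> test_functions" "ew F0 \<noteq> 0"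
    using test_functions_separate[OF cont' K_invariant_reflect[OF inv], of 0] one unfolding ew_def by auto
  obtain R where R: "\<And>\<eta>. norm \<eta> > R \<Longrightarrow> norm (transform F0 \<eta>) < norm (ew F0) / 2"
    using transform_vanishes_at_infinity[OF F0(1), of "norm (ew F0) / 2"] F0(2) by auto
  \<comment> \<open>With the tolerance in the index, finite subfamilies are solvable by
    \<open>eigenvalues_approximated\<close>; exact equality is recovered from all tolerances
    together.\<close>
  define T where "T = (\<lambda>(F, \<delta>). {\<eta>. norm (transform F \<eta> - ew F) \<le> \<delta>})"
  define I :: "((real^'n \<Rightarrow> complex) \<times> real) set" where "I = test_functions \<times> {0<..}"
  have "cball 0 R \<inter> \<Inter>(T ` I) \<noteq> {}"
  proof (rule compact_imp_fip)
    show "compact (cball 0 R :: (real^'n) set)" by simp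
    fix t assume "t \<in> T ` I"
    then obtain F \<delta> where F: "F \<in> test_functions" "t = {\<eta>. norm (transform F \<eta> - ew F) \<le> \<delta>}"
      by (auto simp: T_def I_def)
    show "closed t"
      unfolding F(2) by (intro closed_Collect_le continuous_intros continuous_transform F(1))
  next
    fix \<F> assume "finite \<F>" "\<F> \<subseteq> T ` I"
    then obtain J where J: "finite J" "J \<subseteq> I" "\<F> = T ` J" by (meson finite_subset_image)
    \<comment> \<open>The entry \<open>norm (ew F0) / 2\<close> keeps \<open>transform F0\<close> at
      least half as large as \<open>ew F0\<close>, which is impossible outside radius
      \<open>R\<close>.\<close>
    define \<delta> where "\<delta> = Min (insert (norm (ew F0) / 2) (snd ` J))"
    have \<delta>: "\<delta> > 0" using J F0(2) by (auto simp: \<delta>_def I_def Min_gr_iff)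
    have min: "\<delta> \<le> d" if "d \<in> insert (norm (ew F0) / 2) (snd ` J)" for d
      using J(1) that unfolding \<delta>_def by (intro Min_le) auto
    have \<delta>_le: "\<delta> \<le> norm (ew F0) / 2" "(F, d) \<in> J \<Longrightarrow> \<delta> \<le> d" for F d
      using min[of "norm (ew F0) / 2"] min[of d] by force+
    have "\<exists>\<eta>. \<forall>F\<in>insert F0 (fst ` J). norm (transform F \<eta> - ew F) \<le> \<delta>"
      using J F0(1) by (intro eigenvalues_approximated[OF pd cont one] \<delta> ew) (auto simp: I_def)
    then obtain \<eta> where \<eta>: "norm (transform F0 \<eta> - ew F0) \<le> \<delta>" "\<And>F d. (F, d) \<in> J \<Longrightarrow> norm (transform F \<eta> - ew F) \<le> \<delta>"
      by force
    have "norm \<eta> \<le> R"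
    proof (rule ccontr)
      assume "\<not> norm \<eta> \<le> R"
      then have "norm (transform F0 \<eta>) < norm (ew F0) / 2" by (intro R) simp
      then show False using \<eta>(1) \<delta>_le(1) norm_triangle_ineq2[of "ew F0" "transform F0 \<eta>"]
        by (simp add: norm_minus_commute)
    qed
    moreover have "\<eta> \<in> T z" if "z \<in> J" for z
      using that \<eta>(2) \<delta>_le(2) by (cases z) (force simp: T_def)
    ultimately have "\<eta> \<in> cball 0 R \<inter> \<Inter>\<F>" using J(3) by (auto simp: mem_cball_0)
    then show "cball 0 R \<inter> \<Inter>\<F> \<noteq> {}" by blast
  qed
  then obtain \<xi> where \<xi>: "\<And>F \<delta>. F \<in> test_functions \<Longrightarrow> \<delta> > 0 \<Longrightarrow> norm (transform F \<xi> - ew F) \<le> \<delta>"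
    by (force simp: T_def I_def)
  have tr: "transform F \<xi> = ew F" if "F \<in> test_functions" for F
  proof -
    have "norm (transform F \<xi> - ew F) \<le> 0"
      by (rule field_le_epsilon) (use \<xi>[OF that] in simp)
    then show ?thesis by simp
  qed
  have cont_s: "continuous_on UNIV (\<lambda>y. sph \<xi> (- y))"
    by (intro continuous_on_compose2[OF continuous_sph] continuous_intros) auto
  have int_mult: "integrable \<nu> (\<lambda>y. F y * g y)" if F: "F \<in> test_functions" and g: "continuous_on UNIV g" "\<And>x. norm (g x) \<le> 1" for F g
    by (rule Bochner_Integration.integrable_bound[OF test_function_integrable[OF F]])
      (use borel_measurable_continuous_onI[OF g(1)] test_function_measurable[OF F] g(2)
        in \<open>auto simp: norm_mult mult_left_le measurable_cong_sets[OF sets_\<nu> refl]\<close>)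
  \<comment> \<open>The functions are reflected because \<open>ew F\<close> and
    \<open>transform F \<xi>\<close> are the integrals of \<open>F y\<close> against
    \<open>\<phi> (- y)\<close> and \<open>sph \<xi> (- y)\<close>.\<close>
  have "\<phi> (- x) - sph \<xi> (- x) = 0" for x
  proof (rule test_functions_separate[where h = "\<lambda>y. \<phi> (- y) - sph \<xi> (- y)"])
    show "continuous_on UNIV (\<lambda>y. \<phi> (- y) - sph \<xi> (- y))"
      by (intro continuous_intros cont' cont_s)
    show "K_invariant (\<lambda>y. \<phi> (- y) - sph \<xi> (- y))"
      using K_invariant_reflect[OF inv] K_invariant_reflect[OF K_invariant_sph] by (simp add: K_invariant_def)
    fix F assume F: "F \<in> test_functions"
    have "norm (\<phi> y) \<le> 1" "norm (sph \<xi> y) \<le> 1" for y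
      using posdef_fun_bounds(2)[OF pd, of y] one posdef_fun_bounds(2)[OF posdef_sph, of \<xi> y] by simp_all
    then have "(LINT y|\<nu>. F y * (\<phi> (- y) - sph \<xi> (- y))) = ew F - (LINT y|\<nu>. F y * sph \<xi> (- y))"
      unfolding ew_def right_diff_distrib
      by (intro Bochner_Integration.integral_diff int_mult F cont' cont_s)
    also have "(LINT y|\<nu>. F y * sph \<xi> (- y)) = transform F \<xi>"
      using convolution_sph[OF F, of \<xi> 0] by simp
    finally show "(LINT y|\<nu>. F y * (\<phi> (- y) - sph \<xi> (- y))) = 0"
      using tr[OF F] by simp
  qed
  from this[of "- _"] have "\<phi> x = sph \<xi> x" for x by simp
  then show ?thesis by auto
qed

end

section \<open>Spherical functions and invariant polynomials\<close>

lemma continuous_on_complex_matrix_vector_mult [continuous_intros]: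
  fixes f :: "'a::topological_space \<Rightarrow> complex^'n^'m"
  assumes "continuous_on A f" "continuous_on A g"
  shows "continuous_on A (\<lambda>x. f x *v g x)"
  unfolding matrix_vector_mult_def by (intro continuous_intros assms)

lemma continuous_on_complexify_matrix [continuous_intros]:
  "continuous_on A f \<Longrightarrow> continuous_on A (\<lambda>x. complexify_matrix (f x))"
  unfolding map_matrix_def by (intro continuous_intros)

lemma continuous_on_complexify [continuous_intros]:
  "continuous_on A f \<Longrightarrow> continuous_on A (\<lambda>x. complexify (f x))"
  unfolding complexify_def by (intro continuous_intros)

section \<open>Polynomials averaged over \<open>K\<close>\<close>

lemma continuous_on_complex_polynomial:
  assumes "complex_polynomial p" "continuous_on A f"
  shows "continuous_on A (\<lambda>x. p (f x))"
  using assms by (induction) (auto intro!: continuous_intros)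

lemma complex_polynomial_sum:
  "(\<And>i. i \<in> I \<Longrightarrow> complex_polynomial (p i)) \<Longrightarrow> complex_polynomial (\<lambda>\<xi>. \<Sum>i\<in>I. p i \<xi>)"
  by (induction I rule: infinite_finite_induct) (auto intro: complex_polynomial.intros)

lemma complex_polynomial_power:
  "complex_polynomial p \<Longrightarrow> complex_polynomial (\<lambda>\<xi>. p \<xi> ^ m)"
  by (induction m) (auto intro: complex_polynomial.intros)

text \<open>Finite sums with separated variables: integrating over \<open>k\<close> only changes
  coefficients and leaves a polynomial in \<zeta>.\<close>

inductive mixed_polynomial :: "(real^'n^'n \<Rightarrow> complex^'n \<Rightarrow> complex) \<Rightarrow> bool" where
  product: "continuous_on UNIV a \<Longrightarrow> complex_polynomial m \<Longrightarrow> mixed_polynomial (\<lambda>k \<zeta>. a k * m \<zeta>)"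
| add: "mixed_polynomial g \<Longrightarrow> mixed_polynomial h \<Longrightarrow> mixed_polynomial (\<lambda>k \<zeta>. g k \<zeta> + h k \<zeta>)"

lemma mixed_polynomial_mult_product:
  assumes "mixed_polynomial g" and a: "continuous_on UNIV a" and m: "complex_polynomial m"
  shows "mixed_polynomial (\<lambda>k \<zeta>. (a k * m \<zeta>) * g k \<zeta>)"
  using assms(1)
proof induction
  case (product a' m')
  have "mixed_polynomial (\<lambda>k \<zeta>. (a k * a' k) * (m \<zeta> * m' \<zeta>))"
    by (intro mixed_polynomial.product continuous_intros complex_polynomial.mult product a m)
  then show ?case by (simp add: mult_ac)
next
  case (add g h)
  then show ?case by (simp add: distrib_left mixed_polynomial.add)
qed

lemma mixed_polynomial_mult:
  assumes "mixed_polynomial g" and h: "mixed_polynomial h"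
  shows "mixed_polynomial (\<lambda>k \<zeta>. g k \<zeta> * h k \<zeta>)"
  using assms(1)
proof induction
  case (product a m)
  then show ?case by (intro mixed_polynomial_mult_product h)
next
  case (add g1 g2)
  then show ?case by (simp add: distrib_right mixed_polynomial.add)
qed

lemma mixed_polynomial_sum:
  assumes "\<And>i. i \<in> I \<Longrightarrow> mixed_polynomial (g i)"
  shows "mixed_polynomial (\<lambda>k \<zeta>. \<Sum>i\<in>I. g i k \<zeta>)"
proof -
  have "mixed_polynomial (\<lambda>k \<zeta>. 0)"
    using mixed_polynomial.product[OF continuous_on_const complex_polynomial.const, of 0 0] by simp
  then show ?thesis using assms
    by (induction I rule: infinite_finite_induct) (auto intro: mixed_polynomial.add)
qed

lemma mixed_polynomial_complexify_matrix:
  assumes "complex_polynomial p"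
  shows "mixed_polynomial (\<lambda>k \<zeta>. p (complexify_matrix k *v \<zeta>))"
  using assms
proof induction
  case (coord i)
  have "mixed_polynomial (\<lambda>k \<zeta>. \<Sum>j\<in>UNIV. complex_of_real (k $ i $ j) * \<zeta> $ j)"
    by (intro mixed_polynomial_sum mixed_polynomial.product complex_polynomial.coord continuous_intros)
  then show ?case by (simp add: matrix_vector_mult_def map_matrix_def)
next
  case (const c)
  show ?case
    using mixed_polynomial.product[OF continuous_on_const complex_polynomial.const, of 1 c] by simp
qed (auto intro: mixed_polynomial.add mixed_polynomial_mult)

lemma norm_cis_minus_1_le: "norm (cis t - 1) \<le> \<bar>t\<bar>"
  using iexp_approx1[of t 0] by (simp add: cis_conv_exp)

lemma norm_cis_minus_linear_le: "norm (cis t - (1 + \<i> * of_real t)) \<le> t\<^sup>2 / 2"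
  using iexp_approx1[of t 1] by (simp add: cis_conv_exp power2_eq_square)

text \<open>A derivative taken along a sequence, to suit dominated convergence; the quadratic
  remainder of the exponential gives the error bound.\<close>

lemma cis_difference_quotient_tendsto:
  "(\<lambda>m. of_nat (Suc m) * (cis (t / of_nat (Suc m)) - 1)) \<longlonglongrightarrow> \<i> * of_real t"
proof -
  have "norm (of_nat (Suc m) * (cis (t / of_nat (Suc m)) - 1) - \<i> * of_real t) \<le> t\<^sup>2 * (1 / of_nat (Suc m))" for m
  proof -
    let ?s = "t / of_nat (Suc m)"
    have "norm (cis ?s - (1 + \<i> * of_real ?s)) \<le> ?s\<^sup>2 / 2"
      by (rule norm_cis_minus_linear_le)
    then have "of_nat (Suc m) * norm (cis ?s - (1 + \<i> * of_real ?s)) \<le> of_nat (Suc m) * (?s\<^sup>2 / 2)"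
      by (intro mult_left_mono) auto
    also have "of_nat (Suc m) * (?s\<^sup>2 / 2) \<le> t\<^sup>2 * (1 / of_nat (Suc m))"
      by (simp add: field_simps power2_eq_square del: of_nat_Suc)
    also have "of_nat (Suc m) * norm (cis ?s - (1 + \<i> * of_real ?s))
       = norm (of_nat (Suc m) * (cis ?s - (1 + \<i> * of_real ?s)))"
      by (simp only: norm_mult norm_of_nat)
    also have "of_nat (Suc m) * (cis ?s - (1 + \<i> * of_real ?s)) = of_nat (Suc m) * (cis ?s - 1) - \<i> * of_real t"
      by (simp add: field_simps del: of_nat_Suc)
    finally show ?thesis .
  qed
  moreover have "(\<lambda>m. t\<^sup>2 * (1 / of_nat (Suc m))) \<longlonglongrightarrow> 0"
    using tendsto_mult[OF tendsto_const LIMSEQ_Suc[OF lim_1_over_n]] by fastforce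
  ultimately show ?thesis
    by (subst LIM_zero_iff[symmetric]) (rule Lim_null_comparison[OF always_eventually], auto)
qed

lemma cbilinear_complexify:
  "cbilinear (complexify x) (complexify y) = of_real (x \<bullet> y)"
  by (simp add: cbilinear_def complexify_def inner_vec_def)

context compact_orthogonal
begin

lemma bounded_K: "bounded K"
proof -
  have "norm k \<le> real (CARD('n) * CARD('n))" if k: "k \<in> K" for k
  proof -
    have entry: "\<bar>k $ i $ j\<bar> \<le> 1" for i j
    proof -
      have "\<bar>k $ i $ j\<bar> = \<bar>(k *v axis j 1) $ i\<bar>" by (simp add: matrix_vector_mult_basis column_def)
      also have "\<dots> \<le> norm (k *v axis j 1)" by (rule component_le_norm_cart)
      also have "\<dots> = 1" using k by (simp add: norm_axis_1)
      finally show ?thesis .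
    qed
    have "norm k \<le> (\<Sum>i\<in>UNIV. norm (k $ i))" by (simp add: norm_vec_def L2_set_le_sum)
    also have "\<dots> \<le> (\<Sum>i\<in>(UNIV :: 'n set). real CARD('n))"
    proof (rule sum_mono)
      fix i
      have "norm (k $ i) \<le> (\<Sum>j\<in>UNIV. \<bar>k $ i $ j\<bar>)" by (rule norm_le_l1_cart)
      also have "\<dots> \<le> (\<Sum>j\<in>(UNIV :: 'n set). 1)" by (intro sum_mono entry)
      finally show "norm (k $ i) \<le> real CARD('n)" by simp
    qed
    finally show ?thesis by simp
  qed
  then show ?thesis unfolding bounded_iff by blast
qed

lemma integrable_\<kappa>_continuous:
  fixes f :: "real^'n^'n \<Rightarrow> 'b::{banach, second_countable_topology}"
  assumes f: "continuous_on UNIV f"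
  shows "integrable \<kappa> f"
proof -
  have "compact (f ` closure K)"
    using bounded_K by (intro compact_continuous_image continuous_on_subset[OF f]) (auto simp: compact_closure)
  then obtain B where "\<forall>x\<in>f ` closure K. norm x \<le> B"
    by (meson compact_imp_bounded bounded_iff)
  then have "norm (f k) \<le> B" if "k \<in> K" for k
    using that closure_subset by blast
  then show ?thesis by (rule integrable_\<kappa>_const_bound[OF f])
qed

text \<open>Inversion invariance of the Haar measure of a compact group. Left invariance evaluates
  the double integral of \<open>f (transpose l ** k)\<close> in both orders: with \<open>k\<close>
  inside it is the integral of \<open>f\<close>, with \<open>l\<close> inside that of
  \<open>f (transpose l)\<close>.\<close>

lemma transpose_invariant: "distr \<kappa> borel transpose = \<kappa>"
proof (rule measure_eqI)
  have [measurable]: "transpose \<in> borel_measurable (borel :: (real^'n^'n) measure)"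
    by (intro borel_measurable_continuous_onI continuous_intros)
  fix A assume "A \<in> sets (distr \<kappa> borel (transpose :: real^'n^'n \<Rightarrow> _))"
  then have A [measurable]: "A \<in> sets borel" by simp
  define f :: "real^'n^'n \<Rightarrow> complex" where "f = indicator A"
  have [measurable]: "f \<in> borel_measurable borel" unfolding f_def by simp
  have meas: "(\<lambda>(l, k). f (transpose l ** k)) \<in> borel_measurable (\<kappa> \<Otimes>\<^sub>M \<kappa>)"
  proof -
    have "(\<lambda>z. transpose (fst z) ** snd z) \<in> borel_measurable (borel :: ((real^'n^'n) \<times> (real^'n^'n)) measure)"
      by (intro borel_measurable_continuous_onI continuous_intros)
    then have "(\<lambda>z :: (real^'n^'n) \<times> (real^'n^'n). f (transpose (fst z) ** snd z)) \<in> borel_measurable (borel \<Otimes>\<^sub>M borel)"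
      unfolding borel_prod by (rule measurable_compose) measurable
    then show ?thesis
      by (simp add: case_prod_unfold measurable_cong_sets[OF sets_pair_measure_cong[OF sets_\<kappa> sets_\<kappa>] refl])
  qed
  have swap: "(LINT l|\<kappa>. (LINT k|\<kappa>. f (transpose l ** k))) = (LINT k|\<kappa>. (LINT l|\<kappa>. f (transpose l ** k)))"
    using integral_mult_swap[OF \<kappa>.sigma_finite_measure_axioms \<kappa>.sigma_finite_measure_axioms _ _ meas,
        of "\<lambda>_. 1" "\<lambda>_. 1" 1]
    by (simp add: f_def indicator_def)
  have "(LINT l|\<kappa>. (LINT k|\<kappa>. f (transpose l ** k))) = (LINT l|\<kappa>. (LINT k|\<kappa>. f k))"
  proof (rule integral_cong_AE)
    show "(\<lambda>l. LINT k|\<kappa>. f (transpose l ** k)) \<in> borel_measurable \<kappa>"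
      using \<kappa>.borel_measurable_lebesgue_integral[OF meas] by simp
    show "AE l in \<kappa>. (LINT k|\<kappa>. f (transpose l ** k)) = (LINT k|\<kappa>. f k)"
      using AE_K by eventually_elim (simp add: integral_left_invariant transpose_closed)
  qed simp
  moreover have "(LINT k|\<kappa>. (LINT l|\<kappa>. f (transpose l ** k))) = (LINT k|\<kappa>. (LINT l|\<kappa>. f (transpose l)))"
  proof (rule integral_cong_AE)
    have "(\<lambda>(k, l). f (transpose l ** k)) \<in> borel_measurable (\<kappa> \<Otimes>\<^sub>M \<kappa>)"
      using measurable_pair_swap[OF meas] by simp
    from \<kappa>.borel_measurable_lebesgue_integral[OF this]
    show "(\<lambda>k. LINT l|\<kappa>. f (transpose l ** k)) \<in> borel_measurable \<kappa>" by simp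
    show "AE k in \<kappa>. (LINT l|\<kappa>. f (transpose l ** k)) = (LINT l|\<kappa>. f (transpose l))"
      using AE_K
    proof eventually_elim
      fix k assume "k \<in> K"
      then have "(LINT l|\<kappa>. f (transpose (transpose k ** l))) = (LINT l|\<kappa>. f (transpose l))"
        by (intro integral_left_invariant transpose_closed) measurable
      then show "(LINT l|\<kappa>. f (transpose l ** k)) = (LINT l|\<kappa>. f (transpose l))"
        by (simp add: matrix_transpose_mul)
    qed
  qed simp
  ultimately have "(LINT l|\<kappa>. f (transpose l)) = (LINT k|\<kappa>. f k)"
    using swap \<kappa>.prob_space by simp
  moreover have "f (transpose l) = indicator (transpose -` A) l" for l
    by (simp add: f_def indicator_def)
  moreover have "(LINT l|\<kappa>. indicator B l :: complex) = of_real (measure \<kappa> B)" for B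
    by (subst of_real_indicator[symmetric], subst integral_complex_of_real) simp
  ultimately have "complex_of_real (measure \<kappa> (transpose -` A)) = of_real (measure \<kappa> A)"
    by (simp only: f_def)
  then have "measure \<kappa> (transpose -` A) = measure \<kappa> A" by (simp only: of_real_eq_iff)
  then show "emeasure (distr \<kappa> borel transpose) A = emeasure \<kappa> A"
    by (simp add: emeasure_distr \<kappa>.emeasure_eq_measure)
qed (simp add: sets_\<kappa>)

text \<open>Transposition exchanges left and right multiplication. The right-hand version is what
  makes averages invariant: moving the argument by \<open>l\<close> multiplies \<open>k\<close> by
  \<open>l\<close> on the right.\<close>

lemma integral_right_invariant:
  fixes f :: "real^'n^'n \<Rightarrow> 'b::{banach, second_countable_topology}"
  assumes l: "l \<in> K" and [measurable]: "f \<in> borel_measurable borel"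
  shows "(LINT k|\<kappa>. f (k ** l)) = (LINT k|\<kappa>. f k)"
proof -
  have [measurable]: "transpose \<in> borel_measurable (borel :: (real^'n^'n) measure)"
    "(\<lambda>k. k ** l) \<in> borel_measurable borel"
    by (intro borel_measurable_continuous_onI continuous_intros)+
  have tr: "(LINT k|\<kappa>. g (transpose k)) = (LINT k|\<kappa>. g k)" if [measurable]: "g \<in> borel_measurable borel"
    for g :: "real^'n^'n \<Rightarrow> 'b"
    by (subst (2) transpose_invariant[symmetric], subst integral_distr) auto
  have "(LINT k|\<kappa>. f (k ** l)) = (LINT k|\<kappa>. f (transpose k ** l))"
    by (rule tr[symmetric]) measurable
  also have "\<dots> = (LINT k|\<kappa>. f (transpose (transpose l ** k)))"
    by (simp add: matrix_transpose_mul)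
  also have "\<dots> = (LINT k|\<kappa>. f (transpose k))"
    by (rule integral_left_invariant[of "transpose l"]) (use l in \<open>auto intro: transpose_closed\<close>)
  also have "\<dots> = (LINT k|\<kappa>. f k)" by (rule tr) measurable
  finally show ?thesis .
qed

text \<open>The Reynolds operator of \<open>K\<close>.\<close>

definition average :: "(complex^'n \<Rightarrow> complex) \<Rightarrow> complex^'n \<Rightarrow> complex" where
  "average p \<zeta> = (LINT k|\<kappa>. p (complexify_matrix k *v \<zeta>))"

lemma continuous_polynomial_orbit:
  "complex_polynomial p \<Longrightarrow> continuous_on UNIV (\<lambda>k. p (complexify_matrix k *v \<zeta>))"
  by (erule continuous_on_complex_polynomial) (intro continuous_intros)

text \<open>Continuity in \<open>k\<close> is carried through the induction because splitting the
  integral of a sum needs integrable summands.\<close>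

lemma average_mixed_polynomial:
  assumes "mixed_polynomial h"
  shows "(\<forall>\<zeta>. continuous_on UNIV (\<lambda>k. h k \<zeta>)) \<and> complex_polynomial (\<lambda>\<zeta>. LINT k|\<kappa>. h k \<zeta>)"
  using assms
proof induction
  case (product a m)
  have "complex_polynomial (\<lambda>\<zeta>. (LINT k|\<kappa>. a k) * m \<zeta>)"
    by (intro complex_polynomial.intros product)
  then show ?case using product by (auto intro!: continuous_intros)
next
  case (add g h)
  then have "(LINT k|\<kappa>. g k \<zeta> + h k \<zeta>) = (LINT k|\<kappa>. g k \<zeta>) + (LINT k|\<kappa>. h k \<zeta>)" for \<zeta>
    by (intro Bochner_Integration.integral_add integrable_\<kappa>_continuous) auto
  then show ?case using add by (auto intro!: continuous_intros complex_polynomial.add)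
qed

lemma average_invariant:
  assumes p: "complex_polynomial p"
  shows "average p \<in> invariant_polynomials (complexify_matrix ` K)"
proof -
  have "complex_polynomial (average p)"
    unfolding average_def[abs_def] using average_mixed_polynomial[OF mixed_polynomial_complexify_matrix[OF p]] by blast
  moreover have "average p (complexify_matrix l *v \<zeta>) = average p \<zeta>" if "l \<in> K" for l \<zeta>
  proof -
    have "average p (complexify_matrix l *v \<zeta>) = (LINT k|\<kappa>. p (complexify_matrix (k ** l) *v \<zeta>))"
      by (simp add: average_def map_matrix_of_real_mult matrix_vector_mul_assoc)
    also have "\<dots> = average p \<zeta>"
      unfolding average_def
      by (rule integral_right_invariant[OF that]) (intro borel_measurable_continuous_onI continuous_polynomial_orbit p)
    finally show ?thesis .
  qed
  ultimately show ?thesis by (auto simp: invariant_polynomials_def)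
qed

section \<open>Spherical functions and invariants determine each other\<close>

lemma sph_eq_if_invariants_eq:
  assumes eq: "\<And>p. p \<in> invariant_polynomials (complexify_matrix ` K) \<Longrightarrow> p (complexify \<xi>) = p (complexify \<eta>)"
  shows "sph \<xi> = sph \<eta>"
proof
  fix x :: "real^'n"
  \<comment> \<open>The Taylor terms of the plane wave; being polynomials in \<zeta>, they have
    invariant polynomials as averages.\<close>
  define q where "q m \<zeta> = (\<i> * cbilinear (complexify x) \<zeta>) ^ m * (1 / fact m)" for m \<zeta>
  have q: "complex_polynomial (q m)" for m
    unfolding q_def[abs_def] cbilinear_def
    by (intro complex_polynomial.mult complex_polynomial_power complex_polynomial_sum complex_polynomial.coord complex_polynomial.const)
  have q_orbit: "q m (complexify_matrix k *v complexify z) = (\<i> * of_real (x \<bullet> (k *v z))) ^ m / fact m" for m k z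
    by (simp add: q_def complexify_matrix_mult_complexify cbilinear_complexify)
  have lim: "(\<lambda>N. \<Sum>m<N. average (q m) (complexify z)) \<longlonglongrightarrow> sph z x" for z
  proof -
    have "(\<lambda>N. LINT k|\<kappa>. (\<Sum>m<N. q m (complexify_matrix k *v complexify z))) \<longlonglongrightarrow> (LINT k|\<kappa>. cis (x \<bullet> (k *v z)))"
    \<comment> \<open>By Cauchy-Schwarz and since \<open>K\<close> preserves norms, the partial sums
      are bounded by an exponential series that is the same for all \<open>k\<close> in
      \<open>K\<close>.\<close>
    proof (rule integral_dominated_convergence[where w = "\<lambda>_. exp (norm x * norm z)"])
      show "AE k in \<kappa>. (\<lambda>N. \<Sum>m<N. q m (complexify_matrix k *v complexify z)) \<longlonglongrightarrow> cis (x \<bullet> (k *v z))"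
      proof (rule AE_I2)
        fix k
        show "(\<lambda>N. \<Sum>m<N. q m (complexify_matrix k *v complexify z)) \<longlonglongrightarrow> cis (x \<bullet> (k *v z))"
          using exp_converges[of "\<i> * of_real (x \<bullet> (k *v z))"]
          by (simp add: q_orbit sums_def cis_conv_exp scaleR_conv_of_real field_simps)
      qed
      fix N
      show "AE k in \<kappa>. norm (\<Sum>m<N. q m (complexify_matrix k *v complexify z)) \<le> exp (norm x * norm z)"
        using AE_K
      proof eventually_elim
        fix k assume k: "k \<in> K"
        have "norm (\<Sum>m<N. q m (complexify_matrix k *v complexify z)) \<le> (\<Sum>m<N. norm (q m (complexify_matrix k *v complexify z)))"
          by (rule norm_sum)
        also have "\<dots> \<le> (\<Sum>m<N. (norm x * norm z) ^ m /\<^sub>R fact m)"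
        proof (rule sum_mono)
          fix m
          have "\<bar>x \<bullet> (k *v z)\<bar> ^ m \<le> (norm x * norm z) ^ m"
            using Cauchy_Schwarz_ineq2[of x "k *v z"] k by (intro power_mono) auto
          then show "norm (q m (complexify_matrix k *v complexify z)) \<le> (norm x * norm z) ^ m /\<^sub>R fact m"
            by (simp add: q_orbit norm_divide norm_power norm_mult divide_simps)
        qed
        also have "\<dots> \<le> exp (norm x * norm z)"
          unfolding exp_def by (intro sum_le_suminf summable_exp_generic) auto
        finally show "norm (\<Sum>m<N. q m (complexify_matrix k *v complexify z)) \<le> exp (norm x * norm z)" .
      qed
      show "(\<lambda>k. \<Sum>m<N. q m (complexify_matrix k *v complexify z)) \<in> borel_measurable \<kappa>"
        using q by (intro borel_measurable_sum borel_measurable_integrable integrable_\<kappa>_continuous continuous_polynomial_orbit)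
    qed auto
    moreover have "(LINT k|\<kappa>. (\<Sum>m<N. q m (complexify_matrix k *v complexify z))) = (\<Sum>m<N. average (q m) (complexify z))" for N
      unfolding average_def
      by (intro Bochner_Integration.integral_sum integrable_\<kappa>_continuous continuous_polynomial_orbit q)
    ultimately show ?thesis by (simp add: sph_def)
  qed
  have "(\<lambda>N. \<Sum>m<N. average (q m) (complexify \<xi>)) = (\<lambda>N. \<Sum>m<N. average (q m) (complexify \<eta>))"
    using eq[OF average_invariant[OF q]] by simp
  with lim[of \<xi>] lim[of \<eta>] show "sph \<xi> x = sph \<eta> x"
    by (metis LIMSEQ_unique)
qed

text \<open>Allowing all characters \<open>x\<close> makes the class stable under multiplication by polynomials:
  differentiate in \<open>x\<close>.\<close>

definition equal_means :: "real^'n \<Rightarrow> real^'n \<Rightarrow> (real^'n \<Rightarrow> complex) set" where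
  "equal_means \<xi> \<eta> = {g. continuous_on UNIV g \<and>
     (\<forall>x. (LINT k|\<kappa>. g (k *v \<xi>) * cis (x \<bullet> (k *v \<xi>))) = (LINT k|\<kappa>. g (k *v \<eta>) * cis (x \<bullet> (k *v \<eta>))))}"

lemma equal_means_coordinate:
  assumes g: "g \<in> equal_means \<xi> \<eta>"
  shows "(\<lambda>y. of_real (y $ i) * g y) \<in> equal_means \<xi> \<eta>"
proof -
  have cont: "continuous_on UNIV g" using g by (simp add: equal_means_def)
  have gk: "continuous_on UNIV (\<lambda>k. g (k *v z))" for z :: "real^'n"
    by (intro continuous_on_compose2[OF cont] continuous_intros) auto
  have "(LINT k|\<kappa>. of_real ((k *v \<xi>) $ i) * g (k *v \<xi>) * cis (x \<bullet> (k *v \<xi>)))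
      = (LINT k|\<kappa>. of_real ((k *v \<eta>) $ i) * g (k *v \<eta>) * cis (x \<bullet> (k *v \<eta>)))" for x
  proof -
    \<comment> \<open>Moving \<open>x\<close> in coordinate direction \<open>i\<close> multiplies
      the character by \<open>cis\<close> of the \<open>i\<close>-th coordinate over
      \<open>Suc m\<close>. The difference quotient \<open>Q\<close> involves only means that are
      equal by assumption.\<close>
    define X where "X m = x + (1 / of_nat (Suc m)) *\<^sub>R axis i 1" for m
    define Q where "Q z m = of_nat (Suc m) * ((LINT k|\<kappa>. g (k *v z) * cis (X m \<bullet> (k *v z))) - (LINT k|\<kappa>. g (k *v z) * cis (x \<bullet> (k *v z))))" for z m
    have X: "cis (X m \<bullet> z) = cis (x \<bullet> z) * cis (z $ i / of_nat (Suc m))" for m z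
      by (simp add: X_def inner_add_left cis_mult inner_axis inner_commute[of "axis i 1"] del: of_nat_Suc)
    have Q: "Q z m = (LINT k|\<kappa>. g (k *v z) * cis (x \<bullet> (k *v z)) * (of_nat (Suc m) * (cis ((k *v z) $ i / of_nat (Suc m)) - 1)))" for z m
    proof -
      have "(LINT k|\<kappa>. g (k *v z) * cis (X m \<bullet> (k *v z))) - (LINT k|\<kappa>. g (k *v z) * cis (x \<bullet> (k *v z)))
        = (LINT k|\<kappa>. g (k *v z) * cis (X m \<bullet> (k *v z)) - g (k *v z) * cis (x \<bullet> (k *v z)))"
        by (intro Bochner_Integration.integral_diff[symmetric] integrable_\<kappa>_continuous continuous_intros gk)
      then have "Q z m = (LINT k|\<kappa>. of_nat (Suc m) * (g (k *v z) * cis (X m \<bullet> (k *v z)) - g (k *v z) * cis (x \<bullet> (k *v z))))"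
        by (simp add: Q_def del: of_nat_Suc)
      then show ?thesis by (simp add: X algebra_simps del: of_nat_Suc)
    qed
    have "(\<lambda>m. Q z m) \<longlonglongrightarrow> (LINT k|\<kappa>. g (k *v z) * cis (x \<bullet> (k *v z)) * (\<i> * of_real ((k *v z) $ i)))" for z
      unfolding Q
    proof (rule integral_dominated_convergence[where w = "\<lambda>k. norm (g (k *v z)) * \<bar>(k *v z) $ i\<bar>"])
      show "AE k in \<kappa>. (\<lambda>m. g (k *v z) * cis (x \<bullet> (k *v z)) * (of_nat (Suc m) * (cis ((k *v z) $ i / of_nat (Suc m)) - 1)))
         \<longlonglongrightarrow> g (k *v z) * cis (x \<bullet> (k *v z)) * (\<i> * of_real ((k *v z) $ i))"
        by (intro AE_I2 tendsto_mult tendsto_const cis_difference_quotient_tendsto)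
      fix m
      have "norm (of_nat (Suc m) * (cis (t / of_nat (Suc m)) - 1)) \<le> \<bar>t\<bar>" for t :: real
        using mult_left_mono[OF norm_cis_minus_1_le[of "t / of_nat (Suc m)"], of "of_nat (Suc m)"]
        by (simp only: norm_mult norm_of_nat abs_divide of_nat_0_le_iff) (simp del: of_nat_Suc)
      then show "AE k in \<kappa>. norm (g (k *v z) * cis (x \<bullet> (k *v z)) * (of_nat (Suc m) * (cis ((k *v z) $ i / of_nat (Suc m)) - 1)))
         \<le> norm (g (k *v z)) * \<bar>(k *v z) $ i\<bar>"
        by (intro AE_I2) (simp only: norm_mult[of "g _ * _"] norm_mult[of "g _"] norm_cis mult_1_right mult_left_mono norm_ge_zero)
      show "(\<lambda>k. g (k *v z) * cis (x \<bullet> (k *v z)) * (of_nat (Suc m) * (cis ((k *v z) $ i / of_nat (Suc m)) - 1))) \<in> borel_measurable \<kappa>"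
        by (intro borel_measurable_integrable integrable_\<kappa>_continuous continuous_intros gk) auto
    qed (intro borel_measurable_integrable integrable_\<kappa>_continuous continuous_intros gk)+
    moreover have "Q \<xi> m = Q \<eta> m" for m
      using g unfolding Q_def equal_means_def by simp
    ultimately have "(LINT k|\<kappa>. g (k *v \<xi>) * cis (x \<bullet> (k *v \<xi>)) * (\<i> * of_real ((k *v \<xi>) $ i)))
       = (LINT k|\<kappa>. g (k *v \<eta>) * cis (x \<bullet> (k *v \<eta>)) * (\<i> * of_real ((k *v \<eta>) $ i)))"
      by (metis (no_types, lifting) LIMSEQ_unique ext)
    moreover have "g y * c * (\<i> * r) = \<i> * (r * g y * c)" for y c r by simp
    ultimately show ?thesis by simp
  qed
  then show ?thesis
    using cont by (auto simp: equal_means_def intro!: continuous_intros)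
qed

text \<open>The induction is over all \<open>g\<close>, so that a product of \<open>p\<close> and
  \<open>q\<close> is handled by multiplying first with \<open>q\<close> and then with
  \<open>p\<close>.\<close>

lemma equal_means_polynomial:
  assumes p: "complex_polynomial p" and "g \<in> equal_means \<xi> \<eta>"
  shows "(\<lambda>y. p (complexify y) * g y) \<in> equal_means \<xi> \<eta>"
  using assms
proof (induction arbitrary: g)
  case (coord i)
  then show ?case using equal_means_coordinate[of g \<xi> \<eta> i] by (simp add: complexify_def)
next
  case (const c)
  then show ?case by (auto simp: equal_means_def mult.assoc intro!: continuous_intros)
next
  case (mult p q)
  then show ?case using mult.IH(1)[OF mult.IH(2)[OF mult.prems]] by (simp add: mult.assoc)
next
  case (add p q)
  let ?p = "\<lambda>y. p (complexify y) * g y" and ?q = "\<lambda>y. q (complexify y) * g y"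
  have pq: "?p \<in> equal_means \<xi> \<eta>" "?q \<in> equal_means \<xi> \<eta>" using add by auto
  then have cont: "continuous_on UNIV ?p" "continuous_on UNIV ?q" by (auto simp: equal_means_def)
  have ck: "continuous_on UNIV (\<lambda>k. ?p (k *v z) * cis (x \<bullet> (k *v z)))" "continuous_on UNIV (\<lambda>k. ?q (k *v z) * cis (x \<bullet> (k *v z)))" for x z :: "real^'n"
    by (intro continuous_on_mult continuous_on_compose2[OF cont(1)] continuous_on_compose2[OF cont(2)] continuous_intros; simp)+
  have "(LINT k|\<kappa>. (?p (k *v z) + ?q (k *v z)) * cis (x \<bullet> (k *v z)))
     = (LINT k|\<kappa>. ?p (k *v z) * cis (x \<bullet> (k *v z))) + (LINT k|\<kappa>. ?q (k *v z) * cis (x \<bullet> (k *v z)))" for x z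
    unfolding distrib_right[of "?p _" "?q _"]
    by (intro Bochner_Integration.integral_add integrable_\<kappa>_continuous ck)
  then have "(\<lambda>y. ?p y + ?q y) \<in> equal_means \<xi> \<eta>"
    using pq by (simp add: equal_means_def continuous_on_add)
  then show ?case by (simp add: distrib_right)
qed

text \<open>Equality of the spherical functions says that the constant \<open>1\<close> belongs to
  \<open>equal_means\<close>. After multiplication by \<open>p\<close>, the frequency
  \<open>0\<close> gives the orbit mean of \<open>p\<close>, which for an invariant polynomial is
  its value at the point.\<close>

lemma invariants_eq_if_sph_eq:
  assumes eq: "sph \<xi> = sph \<eta>" and p: "p \<in> invariant_polynomials (complexify_matrix ` K)"
  shows "p (complexify \<xi>) = p (complexify \<eta>)"
proof -
  have poly: "complex_polynomial p" and inv: "\<And>k \<zeta>. k \<in> K \<Longrightarrow> p (complexify_matrix k *v \<zeta>) = p \<zeta>"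
    using p by (auto simp: invariant_polynomials_def)
  have "(\<lambda>_. 1) \<in> equal_means \<xi> \<eta>"
    using fun_cong[OF eq] by (simp add: equal_means_def sph_def)
  from equal_means_polynomial[OF poly this]
  have "(LINT k|\<kappa>. p (complexify (k *v \<xi>))) = (LINT k|\<kappa>. p (complexify (k *v \<eta>)))"
    unfolding equal_means_def by (auto dest: spec[of _ 0])
  moreover have "(LINT k|\<kappa>. p (complexify (k *v z))) = p (complexify z)" for z
  proof -
    have "(LINT k|\<kappa>. p (complexify (k *v z))) = (LINT k|\<kappa>. p (complexify z))"
    proof (rule integral_cong_AE)
      show "(\<lambda>k. p (complexify (k *v z))) \<in> borel_measurable \<kappa>"
        by (intro borel_measurable_integrable integrable_\<kappa>_continuous continuous_on_complex_polynomial[OF poly] continuous_intros)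
      show "AE k in \<kappa>. p (complexify (k *v z)) = p (complexify z)"
        using AE_K by eventually_elim (simp add: inv flip: complexify_matrix_mult_complexify)
    qed simp
    then show ?thesis using \<kappa>.prob_space by simp
  qed
  ultimately show ?thesis by simp
qed

end

section \<open>The homeomorphism\<close>

text \<open>The points of a compact neighbourhood of \<open>\<xi>\<^sub>0\<close> at which \<open>b\<close> leaves \<open>U\<close> are separated
  from \<open>\<xi>\<^sub>0\<close> by the functions \<open>a i\<close>, and by compactness by finitely many of them.\<close>

lemma separating_family_controls:
  fixes a :: "'i \<Rightarrow> 'x::heine_borel \<Rightarrow> complex" and b :: "'x \<Rightarrow> complex"
  assumes cont_a: "\<And>i. i \<in> I \<Longrightarrow> continuous_on UNIV (a i)" and cont_b: "continuous_on UNIV b"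
    and sep: "\<And>\<xi>. (\<forall>i\<in>I. a i \<xi> = a i \<xi>0) \<Longrightarrow> b \<xi> = b \<xi>0"
    and tight: "i0 \<in> I" "r0 > 0" "bounded {\<xi>. dist (a i0 \<xi>) (a i0 \<xi>0) < r0}"
    and U: "open U" "b \<xi>0 \<in> U"
  obtains J e where "finite J" "J \<subseteq> I" "e > 0" "\<And>\<xi>. (\<forall>i\<in>J. dist (a i \<xi>) (a i \<xi>0) < e) \<Longrightarrow> b \<xi> \<in> U"
proof -
  define D where "D = closure {\<xi>. dist (a i0 \<xi>) (a i0 \<xi>0) < r0} \<inter> {\<xi>. b \<xi> \<notin> U}"
  have "closed (b -` (- U))" using U(1) cont_b by (intro closed_vimage) auto
  moreover have "b -` (- U) = {\<xi>. b \<xi> \<notin> U}" by auto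
  ultimately have "compact D"
    unfolding D_def using tight(3) by (intro compact_Int_closed) (auto simp: compact_closure)
  \<comment> \<open>The strict threshold makes these sets open; as it is part of the index, a finite
    subcover comes with finitely many positive thresholds.\<close>
  define W where "W = (\<lambda>(i, e). {\<xi>. e < dist (a i \<xi>) (a i \<xi>0)})"
  have "\<exists>I'\<subseteq>I \<times> {0<..}. finite I' \<and> D \<subseteq> (\<Union>z\<in>I'. W z)"
  proof (rule compactE_image[OF \<open>compact D\<close>])
    fix z assume "z \<in> I \<times> {0 :: real<..}"
    then show "open (W z)"
      by (auto simp: W_def intro!: open_Collect_less continuous_intros cont_a)
  next
    show "D \<subseteq> (\<Union>z\<in>I \<times> {0<..}. W z)"
    proof
      fix \<xi> assume "\<xi> \<in> D"
      then have "b \<xi> \<noteq> b \<xi>0" using U by (auto simp: D_def)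
      then obtain i where i: "i \<in> I" "a i \<xi> \<noteq> a i \<xi>0" using sep by blast
      then have "\<xi> \<in> W (i, dist (a i \<xi>) (a i \<xi>0) / 2)" by (simp add: W_def)
      moreover have "(i, dist (a i \<xi>) (a i \<xi>0) / 2) \<in> I \<times> {0<..}" using i by simp
      ultimately show "\<xi> \<in> (\<Union>z\<in>I \<times> {0<..}. W z)" by blast
    qed
  qed blast
  then obtain I' where I': "I' \<subseteq> I \<times> {0<..}" "finite I'" "D \<subseteq> (\<Union>z\<in>I'. W z)" by blast
  \<comment> \<open>Including \<open>r0\<close> ensures that closeness in \<open>a i0\<close> places
    the point in the bounded region on which the cover is available.\<close>
  define e where "e = Min (insert r0 (snd ` I'))"
  have e: "e > 0" using I'(1,2) tight(2) by (auto simp: e_def)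
  have e_le: "e \<le> d" if "d \<in> insert r0 (snd ` I')" for d
    using I'(2) that unfolding e_def by (intro Min_le) auto
  show thesis
  proof (rule that[of "insert i0 (fst ` I')" e])
    fix \<xi> assume close: "\<forall>i\<in>insert i0 (fst ` I'). dist (a i \<xi>) (a i \<xi>0) < e"
    show "b \<xi> \<in> U"
    proof (rule ccontr)
      assume "b \<xi> \<notin> U"
      moreover have "dist (a i0 \<xi>) (a i0 \<xi>0) < r0" using close e_le[of r0] by auto
      ultimately have "\<xi> \<in> D" by (simp add: D_def closure_subset[THEN subsetD])
      then obtain i d where z: "(i, d) \<in> I'" "d < dist (a i \<xi>) (a i \<xi>0)"
        using I'(3) by (auto simp: W_def)
      then have "dist (a i \<xi>) (a i \<xi>0) < e" using close by force
      moreover have "e \<le> d" using e_le[of d] z(1) by force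
      ultimately show False using z(2) by simp
    qed
  qed (use I' e tight(1) in auto)
qed

text \<open>Stated for two arbitrary parametrizations so that it serves both the map and its
  inverse; neither parametrization need be injective. Openness is tested at each point
  \<open>\<Phi> \<eta>\<close> with a finite intersection of subbasic sets.\<close>

lemma continuous_map_between_initial_topologies:
  fixes a :: "'i \<Rightarrow> 'p \<Rightarrow> complex" and b :: "'j \<Rightarrow> 'q \<Rightarrow> complex"
    and \<Phi> :: "'x::heine_borel \<Rightarrow> 'p" and \<Psi> :: "'x \<Rightarrow> 'q"
  assumes S1: "range \<Phi> \<subseteq> S1" and S2: "range \<Psi> \<subseteq> S2" and "J \<noteq> {}"
    and cont_a: "\<And>i. i \<in> I \<Longrightarrow> continuous_on UNIV (\<lambda>\<xi>. a i (\<Phi> \<xi>))"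
    and cont_b: "\<And>j. j \<in> J \<Longrightarrow> continuous_on UNIV (\<lambda>\<xi>. b j (\<Psi> \<xi>))"
    and sep: "\<And>\<xi> \<eta>. (\<forall>i\<in>I. a i (\<Phi> \<xi>) = a i (\<Phi> \<eta>)) \<Longrightarrow> \<Psi> \<xi> = \<Psi> \<eta>"
    and tight: "\<And>\<eta>. \<exists>i\<in>I. \<exists>r>0. bounded {\<xi>. dist (a i (\<Phi> \<xi>)) (a i (\<Phi> \<eta>)) < r}"
    and F: "\<And>\<xi>. F (\<Phi> \<xi>) = \<Psi> \<xi>"
  shows "continuous_map
     (subtopology (topology_generated_by {{\<phi> \<in> S1. a i \<phi> \<in> U} | i U. i \<in> I \<and> open U}) (range \<Phi>))
     (subtopology (topology_generated_by {{c \<in> S2. b j c \<in> U} | j U. j \<in> J \<and> open U}) (range \<Psi>)) F"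
    (is "continuous_map (subtopology ?X _) (subtopology (topology_generated_by ?SY) _) F")
proof -
  have open_X: "openin ?X {\<phi> \<in> S1. a i \<phi> \<in> U}" if "i \<in> I" "open U" for i U
    using that by (intro topology_generated_by_Basis) auto
  have "continuous_map (subtopology ?X (range \<Phi>)) (topology_generated_by ?SY) F"
  proof (rule continuous_on_generated_topo)
    fix W assume "W \<in> ?SY"
    then obtain j U where W: "W = {c \<in> S2. b j c \<in> U}" "j \<in> J" "open U" by blast
    have "topspace (subtopology ?X (range \<Phi>)) = range \<Phi>"
    proof -
      obtain i0 where "i0 \<in> I" using tight by blast
      from openin_subset[OF open_X[OF this open_UNIV]] have "S1 \<subseteq> topspace ?X" by simp
      then show ?thesis using S1 by auto
    qed
    then have eq: "F -` W \<inter> topspace (subtopology ?X (range \<Phi>)) = {\<Phi> \<xi> | \<xi>. b j (\<Psi> \<xi>) \<in> U}"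
      using S2 F by (auto simp: W(1))
    show "openin (subtopology ?X (range \<Phi>)) (F -` W \<inter> topspace (subtopology ?X (range \<Phi>)))"
      unfolding eq
    proof (subst openin_subopen, intro ballI)
      fix \<phi> assume "\<phi> \<in> {\<Phi> \<xi> | \<xi>. b j (\<Psi> \<xi>) \<in> U}"
      then obtain \<eta> where \<eta>: "\<phi> = \<Phi> \<eta>" "b j (\<Psi> \<eta>) \<in> U" by blast
      obtain i0 r0 where "i0 \<in> I" "r0 > 0" "bounded {\<xi>. dist (a i0 (\<Phi> \<xi>)) (a i0 (\<Phi> \<eta>)) < r0}"
        using tight by blast
      then obtain I' e where I': "finite I'" "I' \<subseteq> I" "e > 0"
        "\<And>\<xi>. (\<forall>i\<in>I'. dist (a i (\<Phi> \<xi>)) (a i (\<Phi> \<eta>)) < e) \<Longrightarrow> b j (\<Psi> \<xi>) \<in> U"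
        using separating_family_controls[of I "\<lambda>i \<xi>. a i (\<Phi> \<xi>)" "\<lambda>\<xi>. b j (\<Psi> \<xi>)" \<eta> i0 r0 U]
          cont_a cont_b[OF W(2)] sep W(3) \<eta>(2) by metis
      \<comment> \<open>\<open>I'\<close> may be empty; inserting \<open>i0\<close>, with the
        trivial condition unless it already lies in \<open>I'\<close>, keeps the intersection over a
        nonempty index set.\<close>
      define V where "V = (\<Inter>i\<in>insert i0 I'. {\<phi> \<in> S1. a i \<phi> \<in> (if i \<in> I' then ball (a i (\<Phi> \<eta>)) e else UNIV)})"
      have "openin ?X V"
        unfolding V_def using I' \<open>i0 \<in> I\<close> by (intro openin_INT2 open_X) auto
      then have "openin (subtopology ?X (range \<Phi>)) (V \<inter> range \<Phi>)"
        by (rule openin_subtopology_Int)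
      moreover have "\<phi> \<in> V \<inter> range \<Phi>"
        using S1 I'(3) by (auto simp: V_def \<eta>(1))
      moreover have "V \<inter> range \<Phi> \<subseteq> {\<Phi> \<xi> | \<xi>. b j (\<Psi> \<xi>) \<in> U}"
      proof
        fix \<psi> assume \<psi>: "\<psi> \<in> V \<inter> range \<Phi>"
        then obtain \<xi> where \<xi>: "\<psi> = \<Phi> \<xi>" by blast
        have "dist (a i (\<Phi> \<xi>)) (a i (\<Phi> \<eta>)) < e" if "i \<in> I'" for i
          using \<psi> that by (auto simp: V_def \<xi> dist_commute)
        then show "\<psi> \<in> {\<Phi> \<xi> | \<xi>. b j (\<Psi> \<xi>) \<in> U}" using I'(4) \<xi> by blast
      qed
      ultimately show "\<exists>T. openin (subtopology ?X (range \<Phi>)) T \<and> \<phi> \<in> T \<and> T \<subseteq> {\<Phi> \<xi> | \<xi>. b j (\<Psi> \<xi>) \<in> U}"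
        by blast
    qed
  next
    obtain j0 where j0: "j0 \<in> J" using \<open>J \<noteq> {}\<close> by blast
    then have "S2 \<in> ?SY" by (intro CollectI exI[of _ j0] exI[of _ UNIV]) auto
    then have "S2 \<subseteq> \<Union>?SY" by (rule Union_upper)
    moreover have "topspace (subtopology ?X (range \<Phi>)) \<subseteq> range \<Phi>"
      unfolding topspace_subtopology by (rule Int_lower2)
    then have "F ` topspace (subtopology ?X (range \<Phi>)) \<subseteq> range \<Psi>" using F by fastforce
    ultimately show "F ` topspace (subtopology ?X (range \<Phi>)) \<subseteq> \<Union>?SY"
      using S2 by (meson subset_trans)
  qed
  then show ?thesis
    by (rule continuous_map_into_subtopology) (use F in auto)
qed

section \<open>Descent from the motion group to the vector space\<close>

locale motion_group_haar =
  fixes K :: "(real^'n^'n) set"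
    and \<mu>\<^sub>K :: "(real^'n^'n) measure"
    and \<mu>\<^sub>G :: "((real^'n) \<times> (real^'n^'n)) measure"
  assumes subgroup: "subgroup K orthogonal_group" and closed: "closed K"
    and haar_K: "haar_measure (orthogonal_group\<lparr>carrier := K\<rparr>) \<mu>\<^sub>K" and mass_K: "emeasure \<mu>\<^sub>K K = 1"
    and haar_G: "haar_measure (motion_group K) \<mu>\<^sub>G"
begin

lemma K_orthogonal: "k \<in> K \<Longrightarrow> orthogonal_matrix k"
  using subgroup.subset[OF subgroup] by (auto simp: orthogonal_group_def)

lemma K_one: "mat 1 \<in> K"
  using subgroup.one_closed[OF subgroup] by (simp add: orthogonal_group_def)

lemma K_mult: "k \<in> K \<Longrightarrow> l \<in> K \<Longrightarrow> k ** l \<in> K"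
  using subgroup.m_closed[OF subgroup] by (simp add: orthogonal_group_def)

lemma K_transpose: "k \<in> K \<Longrightarrow> transpose k \<in> K"
proof -
  assume k: "k \<in> K"
  interpret O: group "orthogonal_group :: (real^'n^'n) monoid" by (rule group_orthogonal_group)
  have "inv\<^bsub>orthogonal_group\<^esub> k = transpose k"
    using K_orthogonal[OF k]
    by (intro O.inv_equality) (auto simp: orthogonal_group_def orthogonal_matrix_def)
  then show "transpose k \<in> K" using subgroup.m_inv_closed[OF subgroup k] by simp
qed

lemma K_transpose_mult: "k \<in> K \<Longrightarrow> transpose k ** k = mat 1" "k \<in> K \<Longrightarrow> k ** transpose k = mat 1"
  using K_orthogonal by (auto simp: orthogonal_matrix_def)

lemma sets_\<mu>\<^sub>K: "sets \<mu>\<^sub>K = sets (restrict_space borel K)"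
  using haar_K by (simp add: haar_measure_def)

lemma space_\<mu>\<^sub>K: "space \<mu>\<^sub>K = K"
  using sets_eq_imp_space_eq[OF sets_\<mu>\<^sub>K] by (simp add: space_restrict_space)

lemma sets_\<mu>\<^sub>G: "sets \<mu>\<^sub>G = sets (restrict_space borel (UNIV \<times> K))"
  using haar_G by (simp add: haar_measure_def motion_group_def)

lemma space_\<mu>\<^sub>G: "space \<mu>\<^sub>G = UNIV \<times> K"
  using sets_eq_imp_space_eq[OF sets_\<mu>\<^sub>G] by (simp add: space_restrict_space)

text \<open>Haar measures live on the trace sigma-algebra of a subset. Both are pushed to a full
  Borel sigma-algebra: \<kappa> along the inclusion of \<open>K\<close>, \<nu> along the projection
  to translations.\<close>

definition \<kappa> where "\<kappa> = distr \<mu>\<^sub>K borel (\<lambda>k. k)"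
definition \<nu> where "\<nu> = distr \<mu>\<^sub>G borel fst"

lemma measurable_id_\<mu>\<^sub>K: "(\<lambda>k. k) \<in> borel_measurable \<mu>\<^sub>K"
  unfolding measurable_cong_sets[OF sets_\<mu>\<^sub>K refl] by (rule measurable_restrict_space1) simp

lemma measurable_fst_\<mu>\<^sub>G: "fst \<in> borel_measurable \<mu>\<^sub>G"
  unfolding measurable_cong_sets[OF sets_\<mu>\<^sub>G refl]
  by (intro measurable_restrict_space1 borel_measurable_continuous_onI continuous_intros)

lemma distr_left_mult_\<kappa>:
  assumes l: "l \<in> K"
  shows "distr \<kappa> borel ((**) l) = \<kappa>"
proof (rule measure_eqI)
  have m: "((**) l) \<in> borel_measurable borel"
    by (intro borel_measurable_continuous_onI continuous_intros)
  fix A assume "A \<in> sets (distr \<kappa> borel ((**) l))"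
  then have A: "A \<in> sets borel" by simp
  \<comment> \<open>\<open>haar_measure\<close> speaks of images and \<open>distr\<close> of
    preimages; left translation by \<open>l\<close> maps this set onto
    \<open>A \<inter> K\<close>.\<close>
  define B where "B = (**) l -` A \<inter> K"
  have "B \<in> sets (restrict_space borel K)"
    using measurable_sets[OF m A] by (auto simp: B_def sets_restrict_space)
  then have B: "B \<in> sets \<mu>\<^sub>K" by (simp add: sets_\<mu>\<^sub>K)
  have "(**) l ` B = A \<inter> K"
  proof (intro equalityI subsetI)
    fix k assume k: "k \<in> A \<inter> K"
    then have "k = l ** (transpose l ** k)" using K_transpose_mult[OF l] by (simp add: matrix_mul_assoc)
    moreover from this have "transpose l ** k \<in> B"
      using k K_mult[OF K_transpose[OF l]] by (auto simp: B_def)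
    ultimately show "k \<in> (**) l ` B" by blast
  qed (use K_mult[OF l] in \<open>auto simp: B_def\<close>)
  moreover have "emeasure \<mu>\<^sub>K ((\<lambda>x. l \<otimes>\<^bsub>orthogonal_group\<lparr>carrier := K\<rparr>\<^esub> x) ` B) = emeasure \<mu>\<^sub>K B"
    using haar_K l B unfolding haar_measure_def by simp
  ultimately have "emeasure \<mu>\<^sub>K (A \<inter> K) = emeasure \<mu>\<^sub>K B" by (simp add: orthogonal_group_def)
  moreover have emeasure_\<kappa>: "emeasure \<kappa> X = emeasure \<mu>\<^sub>K (X \<inter> K)" if "X \<in> sets borel" for X
    using that measurable_id_\<mu>\<^sub>K by (simp add: \<kappa>_def emeasure_distr space_\<mu>\<^sub>K)
  moreover have "emeasure (distr \<kappa> borel ((**) l)) A = emeasure \<mu>\<^sub>K B"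
  proof -
    have "(**) l \<in> measurable \<kappa> borel" using m by (simp add: \<kappa>_def)
    then have "emeasure (distr \<kappa> borel ((**) l)) A = emeasure \<kappa> ((**) l -` A)"
      using A by (subst emeasure_distr) (auto simp: \<kappa>_def)
    then show ?thesis using emeasure_\<kappa>[of "(**) l -` A"] measurable_sets[OF m A] by (simp add: B_def)
  qed
  ultimately show "emeasure (distr \<kappa> borel ((**) l)) A = emeasure \<kappa> A" using A by simp
qed (simp add: \<kappa>_def)

sublocale compact_orthogonal K \<kappa>
proof (rule compact_orthogonal.intro)
  show "prob_space \<kappa>"
    using measurable_id_\<mu>\<^sub>K mass_K by (intro prob_spaceI) (simp add: \<kappa>_def emeasure_distr space_\<mu>\<^sub>K)
  show "AE k in \<kappa>. k \<in> K"
    unfolding \<kappa>_def using closed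
    by (subst AE_distr_iff[OF measurable_id_\<mu>\<^sub>K]) (auto simp: space_\<mu>\<^sub>K intro: borel_closed)
  show "sets \<kappa> = sets borel" by (simp add: \<kappa>_def)
qed (fact K_orthogonal K_one K_mult K_transpose distr_left_mult_\<kappa>)+

text \<open>Left translation by \<open>(c, l)\<close> maps the cylinder over the preimage onto the
  cylinder over \<open>A\<close>; one computation thus yields invariance under translations and
  rotations.\<close>

lemma emeasure_\<nu>_affine:
  assumes l: "l \<in> K" and A: "A \<in> sets borel"
  shows "emeasure \<nu> ((\<lambda>y. c + l *v y) -` A) = emeasure \<nu> A"
proof -
  have m: "(\<lambda>y. c + l *v y) \<in> borel_measurable borel"
    by (intro borel_measurable_continuous_onI continuous_intros)
  define B where "B = ((\<lambda>y. c + l *v y) -` A) \<times> K"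
  have "B = fst -` ((\<lambda>y. c + l *v y) -` A) \<inter> space \<mu>\<^sub>G" by (auto simp: B_def space_\<mu>\<^sub>G)
  moreover have pre: "(\<lambda>y. c + l *v y) -` A \<in> sets borel" using measurable_sets[OF m A] by simp
  ultimately have B: "B \<in> sets \<mu>\<^sub>G" "emeasure \<nu> ((\<lambda>y. c + l *v y) -` A) = emeasure \<mu>\<^sub>G B"
    using measurable_sets[OF measurable_fst_\<mu>\<^sub>G pre] by (simp_all add: \<nu>_def emeasure_distr measurable_fst_\<mu>\<^sub>G)
  have "(\<lambda>x. (c, l) \<otimes>\<^bsub>motion_group K\<^esub> x) ` B = A \<times> K"
  proof (intro equalityI subsetI)
    fix z assume "z \<in> A \<times> K"
    then obtain y k where z: "z = (y, k)" "y \<in> A" "k \<in> K" by blast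
    have "l *v (transpose l *v w) = w" for w
      using K_transpose_mult(2)[OF l] by (simp only: matrix_vector_mul_assoc matrix_vector_mul_lid)
    moreover have "l ** (transpose l ** k) = k" using K_transpose_mult(2)[OF l] by (simp add: matrix_mul_assoc)
    ultimately have "z = (c, l) \<otimes>\<^bsub>motion_group K\<^esub> (transpose l *v (y - c), transpose l ** k)"
      "(transpose l *v (y - c), transpose l ** k) \<in> B"
      using z K_mult[OF K_transpose[OF l]] by (simp_all add: motion_group_def B_def del: transpose_matrix_vector)
    then show "z \<in> (\<lambda>x. (c, l) \<otimes>\<^bsub>motion_group K\<^esub> x) ` B" by blast
  qed (use K_mult[OF l] in \<open>auto simp: motion_group_def B_def\<close>)
  moreover have "emeasure \<mu>\<^sub>G ((\<lambda>x. (c, l) \<otimes>\<^bsub>motion_group K\<^esub> x) ` B) = emeasure \<mu>\<^sub>G B"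
  proof -
    have "(c, l) \<in> carrier (motion_group K)" using l by (simp add: motion_group_def)
    then show ?thesis using haar_G B(1) unfolding haar_measure_def by blast
  qed
  moreover have "emeasure \<nu> A = emeasure \<mu>\<^sub>G (A \<times> K)"
  proof -
    have "fst -` A \<inter> space \<mu>\<^sub>G = A \<times> K" by (auto simp: space_\<mu>\<^sub>G)
    then show ?thesis using A by (simp add: \<nu>_def emeasure_distr measurable_fst_\<mu>\<^sub>G)
  qed
  ultimately show ?thesis using B(2) by simp
qed

lemma compact_K: "compact K"
  using bounded_K closed by (simp add: compact_eq_bounded_closed)

sublocale motion_invariant K \<kappa> \<nu>
proof
  show "sets \<nu> = sets borel" by (simp add: \<nu>_def)
  show "distr \<nu> borel ((+) c) = \<nu>" for c
  proof (rule measure_eqI)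
    fix A assume "A \<in> sets (distr \<nu> borel ((+) c))"
    then show "emeasure (distr \<nu> borel ((+) c)) A = emeasure \<nu> A"
      using emeasure_\<nu>_affine[OF K_one, of A c] by (simp add: emeasure_distr \<nu>_def)
  qed (simp add: \<nu>_def)
  show "distr \<nu> borel ((*v) k) = \<nu>" if "k \<in> K" for k
  proof (rule measure_eqI)
    have [measurable]: "((*v) k) \<in> borel_measurable borel"
      by (intro borel_measurable_continuous_onI continuous_intros)
    fix A assume "A \<in> sets (distr \<nu> borel ((*v) k))"
    then show "emeasure (distr \<nu> borel ((*v) k)) A = emeasure \<nu> A"
      using emeasure_\<nu>_affine[OF that, of A 0] by (simp add: emeasure_distr \<nu>_def)
  qed (simp add: \<nu>_def)
  show "emeasure \<nu> (cball 0 r) < \<infinity>" for r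
  proof -
    have "emeasure \<nu> (cball 0 r) = emeasure \<mu>\<^sub>G (cball 0 r \<times> K)"
    proof -
      have "fst -` cball 0 r \<inter> space \<mu>\<^sub>G = cball 0 r \<times> K" by (auto simp: space_\<mu>\<^sub>G)
      then show ?thesis by (simp add: \<nu>_def emeasure_distr measurable_fst_\<mu>\<^sub>G)
    qed
    moreover have "compact (cball (0 :: real^'n) r \<times> K)" by (intro compact_Times compact_cball compact_K)
    moreover have "\<forall>C. compact C \<and> C \<subseteq> UNIV \<times> K \<longrightarrow> emeasure \<mu>\<^sub>G C < \<infinity>"
      using haar_G by (simp add: haar_measure_def motion_group_def)
    ultimately show ?thesis by auto
  qed
  show "emeasure \<nu> UNIV \<noteq> 0"
    using haar_G by (simp add: \<nu>_def emeasure_distr measurable_fst_\<mu>\<^sub>G haar_measure_def)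
qed

lemma spherical_phi_eq_sph: "spherical_phi \<mu>\<^sub>K (complexify \<xi>) = sph \<xi>"
proof
  fix x
  have "sph \<xi> x = (LINT k|\<kappa>. cis (x \<bullet> (k *v \<xi>)))" by (rule sph_def)
  also have "\<dots> = (LINT k|\<mu>\<^sub>K. cis (x \<bullet> (k *v \<xi>)))"
    unfolding \<kappa>_def by (rule integral_distr[OF measurable_id_\<mu>\<^sub>K]) measurable
  finally show "spherical_phi \<mu>\<^sub>K (complexify \<xi>) x = sph \<xi> x"
    by (simp add: spherical_phi_def complexify_matrix_mult_complexify cbilinear_complexify cis_conv_exp)
qed

abbreviation "G \<equiv> motion_group K"

lemma carrier_G: "carrier G = UNIV \<times> K"
  and mult_G: "(x, k) \<otimes>\<^bsub>G\<^esub> (y, l) = (x + k *v y, k ** l)"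
  and one_G: "\<one>\<^bsub>G\<^esub> = (0, mat 1)"
  by (simp_all add: motion_group_def)

lemma inv_G:
  assumes k: "k \<in> K"
  shows "inv\<^bsub>G\<^esub> (x, k) = (- (transpose k *v x), transpose k)"
proof -
  interpret G: group G by (rule group_motion_group[OF subgroup])
  show ?thesis
    using k by (intro G.inv_equality)
      (simp_all add: mult_G one_G carrier_G K_transpose K_transpose_mult del: transpose_matrix_vector)
qed

lemma lift_apply: "k \<in> K \<Longrightarrow> lift_to_motion_group K f (x, k) = f x"
  by (simp add: lift_to_motion_group_def carrier_G)

lemma lift_inj: "lift_to_motion_group K f = lift_to_motion_group K g \<longleftrightarrow> f = g"
  using lift_apply[OF K_one] by (metis ext)

text \<open>From \<open>(x, k) = (x, 1) (0, k)\<close> and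
  \<open>(0, k) (x, 1) (0, transpose k) = (k x, 1)\<close>: bi-invariant functions are
  \<open>K\<close>-invariant functions of the translation part.\<close>

lemma bi_invariant_eq:
  assumes f: "bi_invariant G ({0} \<times> K) f" and k: "k \<in> K"
  shows "f (x, k) = f (x, mat 1)" and "f (k *v x, mat 1) = f (x, mat 1)"
proof -
  have inv: "f (a \<otimes>\<^bsub>G\<^esub> (x, l) \<otimes>\<^bsub>G\<^esub> b) = f (x, l)" if "a \<in> {0} \<times> K" "b \<in> {0} \<times> K" "l \<in> K" for a b x l
    using f that unfolding bi_invariant_def carrier_G by blast
  show "f (x, k) = f (x, mat 1)"
    using inv[of "(0, mat 1)" "(0, k)" "mat 1" x] k K_one by (simp add: mult_G)
  show "f (k *v x, mat 1) = f (x, mat 1)"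
    using inv[of "(0, k)" "(0, transpose k)" "mat 1" x] k K_one K_transpose by (simp add: mult_G K_transpose_mult)
qed

lemma bi_invariant_lift:
  "K_invariant F \<Longrightarrow> bi_invariant G ({0} \<times> K) (\<lambda>(x, k). F x)"
  by (auto simp: bi_invariant_def carrier_G mult_G K_invariant_def)

lemma Cc_biinv_test_function:
  assumes f: "f \<in> Cc_biinv G ({0} \<times> K)"
  shows "(\<lambda>x. f (x, mat 1)) \<in> test_functions" and "k \<in> K \<Longrightarrow> f (x, k) = f (x, mat 1)"
proof -
  have bi: "bi_invariant G ({0} \<times> K) f" and cont: "continuous_on (UNIV \<times> K) f"
    using f by (auto simp: Cc_biinv_def carrier_G)
  obtain C where C: "compact C" "\<forall>g\<in>UNIV \<times> K - C. f g = 0"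
    using f by (auto simp: Cc_biinv_def carrier_G)
  show "k \<in> K \<Longrightarrow> f (x, k) = f (x, mat 1)" by (rule bi_invariant_eq(1)[OF bi])
  have "bounded (fst ` C)"
    using C(1) by (intro compact_imp_bounded compact_continuous_image continuous_intros)
  then obtain R where R: "\<forall>x\<in>fst ` C. norm x \<le> R" by (auto simp: bounded_iff)
  have "f (x, mat 1) = 0" if "norm x > R" for x
  proof -
    have "(x, mat 1) \<notin> C" using R that by force
    then show ?thesis using C(2) K_one by blast
  qed
  moreover have "continuous_on UNIV (\<lambda>x. f (x, mat 1))"
    by (rule continuous_on_compose2[OF cont]) (auto intro!: continuous_intros K_one)
  ultimately show "(\<lambda>x. f (x, mat 1)) \<in> test_functions"
    using bi_invariant_eq(2)[OF bi] by (auto simp: test_functions_def K_invariant_def)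
qed

lemma test_function_Cc_biinv:
  assumes F: "F \<in> test_functions"
  shows "(\<lambda>(x, k). F x) \<in> Cc_biinv G ({0} \<times> K)"
proof -
  obtain R where R: "\<And>x. norm x > R \<Longrightarrow> F x = 0" and cont: "continuous_on UNIV F" and inv: "K_invariant F"
    using F by (auto simp: test_functions_def)
  have "continuous_on (UNIV \<times> K) (\<lambda>(x, k). F x)"
    unfolding case_prod_unfold by (intro continuous_on_compose2[OF cont] continuous_intros) auto
  moreover have "compact (cball (0 :: real^'n) R \<times> K)" by (intro compact_Times compact_cball compact_K)
  moreover have "\<forall>g\<in>UNIV \<times> K - cball (0 :: real^'n) R \<times> K. (case g of (x, k) \<Rightarrow> F x) = 0"
  proof
    fix g assume "g \<in> UNIV \<times> K - cball (0 :: real^'n) R \<times> K"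
    then have "norm (fst g) > R" by (cases g) (auto simp: mem_cball_0)
    then show "(case g of (x, k) \<Rightarrow> F x) = 0" by (simp add: R case_prod_unfold)
  qed
  ultimately show ?thesis
    using bi_invariant_lift[OF inv] unfolding Cc_biinv_def carrier_G by blast
qed

lemma integral_\<mu>\<^sub>G:
  assumes "\<And>x k. k \<in> K \<Longrightarrow> h (x, k) = g x" and g: "(g :: real^'n \<Rightarrow> complex) \<in> borel_measurable borel"
  shows "(LINT z|\<mu>\<^sub>G. h z) = (LINT y|\<nu>. g y)"
proof -
  have "(LINT z|\<mu>\<^sub>G. h z) = (LINT z|\<mu>\<^sub>G. g (fst z))"
    by (rule Bochner_Integration.integral_cong) (use assms(1) in \<open>auto simp: space_\<mu>\<^sub>G\<close>)
  also have "\<dots> = (LINT y|\<nu>. g y)"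
    unfolding \<nu>_def by (rule integral_distr[symmetric, OF measurable_fst_\<mu>\<^sub>G g])
  finally show ?thesis .
qed

lemma K_invariantD: "K_invariant F \<Longrightarrow> k \<in> K \<Longrightarrow> F (k *v x) = F x"
  by (simp add: K_invariant_def)

text \<open>The product of the inverse of \<open>(y, l)\<close> with \<open>(x, k)\<close> has
  translation part \<open>transpose l *v (x - y)\<close>. By \<open>K\<close>-invariance
  \<open>\<Phi>\<close> sees only \<open>x - y\<close>, and the integrand no longer depends on
  \<open>l\<close>.\<close>

lemma group_convolution_eq:
  assumes f: "f \<in> Cc_biinv G ({0} \<times> K)" and \<Phi>: "continuous_on UNIV \<Phi>" "K_invariant \<Phi>" and k: "k \<in> K"
  shows "group_convolution G \<mu>\<^sub>G f (lift_to_motion_group K \<Phi>) (x, k) = (LINT y|\<nu>. f (y, mat 1) * \<Phi> (x - y))"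
  unfolding group_convolution_def
proof (rule integral_\<mu>\<^sub>G)
  show "(\<lambda>y. f (y, mat 1) * \<Phi> (x - y)) \<in> borel_measurable borel"
    using Cc_biinv_test_function(1)[OF f]
    by (intro borel_measurable_continuous_onI continuous_intros continuous_on_compose2[OF \<Phi>(1)])
      (auto simp: test_functions_def)
  fix y l assume l: "l \<in> K"
  have "inv\<^bsub>G\<^esub> (y, l) \<otimes>\<^bsub>G\<^esub> (x, k) = (transpose l *v (x - y), transpose l ** k)"
    by (simp add: inv_G l mult_G matrix_vector_mult_diff_distrib del: transpose_matrix_vector)
  then have "lift_to_motion_group K \<Phi> (inv\<^bsub>G\<^esub> (y, l) \<otimes>\<^bsub>G\<^esub> (x, k)) = \<Phi> (x - y)"
    using l k by (simp add: lift_apply K_mult K_transpose K_invariantD[OF \<Phi>(2)] del: transpose_matrix_vector)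
  then show "f (y, l) * lift_to_motion_group K \<Phi> (inv\<^bsub>G\<^esub> (y, l) \<otimes>\<^bsub>G\<^esub> (x, k)) = f (y, mat 1) * \<Phi> (x - y)"
    using Cc_biinv_test_function(2)[OF f l] by simp
qed

text \<open>The transform is the convolution evaluated at the identity.\<close>

lemma spherical_transform_eq:
  assumes f: "f \<in> Cc_biinv G ({0} \<times> K)" and \<Phi>: "continuous_on UNIV \<Phi>" "K_invariant \<Phi>"
  shows "spherical_transform G \<mu>\<^sub>G f (lift_to_motion_group K \<Phi>) = (LINT y|\<nu>. f (y, mat 1) * \<Phi> (- y))"
proof -
  interpret G: group G by (rule group_motion_group[OF subgroup])
  have "spherical_transform G \<mu>\<^sub>G f (lift_to_motion_group K \<Phi>)
      = group_convolution G \<mu>\<^sub>G f (lift_to_motion_group K \<Phi>) (0, mat 1)"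
    unfolding spherical_transform_def group_convolution_def
  proof (rule Bochner_Integration.integral_cong)
    fix z assume "z \<in> space \<mu>\<^sub>G"
    then have "z \<in> carrier G" by (simp add: space_\<mu>\<^sub>G carrier_G)
    then have "inv\<^bsub>G\<^esub> z \<otimes>\<^bsub>G\<^esub> \<one>\<^bsub>G\<^esub> = inv\<^bsub>G\<^esub> z" by simp
    then show "f z * lift_to_motion_group K \<Phi> (inv\<^bsub>G\<^esub> z)
       = f z * lift_to_motion_group K \<Phi> (inv\<^bsub>G\<^esub> z \<otimes>\<^bsub>G\<^esub> (0, mat 1))"
      by (simp only: one_G)
  qed simp
  then show ?thesis using group_convolution_eq[OF f \<Phi> K_one, of 0] by simp
qed

lemma spherical_transform_sph:
  "f \<in> Cc_biinv G ({0} \<times> K) \<Longrightarrow>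
    spherical_transform G \<mu>\<^sub>G f (lift_to_motion_group K (sph \<xi>)) = transform (\<lambda>x. f (x, mat 1)) \<xi>"
  using convolution_sph[OF Cc_biinv_test_function(1), of f \<xi> 0]
  by (simp add: spherical_transform_eq continuous_sph K_invariant_sph)

lemma positive_definite_lift:
  assumes inv: "K_invariant \<Phi>"
  shows "positive_definite_on G (lift_to_motion_group K \<Phi>) \<longleftrightarrow> posdef_fun \<Phi>"
proof -
  have eq: "lift_to_motion_group K \<Phi> (inv\<^bsub>G\<^esub> (y, l) \<otimes>\<^bsub>G\<^esub> (x, k)) = \<Phi> (x - y)" if "k \<in> K" "l \<in> K" for x y k l
  proof -
    have "inv\<^bsub>G\<^esub> (y, l) \<otimes>\<^bsub>G\<^esub> (x, k) = (transpose l *v (x - y), transpose l ** k)"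
      by (simp add: inv_G that mult_G matrix_vector_mult_diff_distrib del: transpose_matrix_vector)
    then show ?thesis
      using that by (simp add: lift_apply K_mult K_transpose K_invariantD[OF inv] del: transpose_matrix_vector)
  qed
  show ?thesis
  proof
    assume pd: "positive_definite_on G (lift_to_motion_group K \<Phi>)"
    show "posdef_fun \<Phi>"
      unfolding posdef_fun_def
    proof (intro allI)
      fix m :: nat and c and x :: "nat \<Rightarrow> real^'n"
      show "(\<Sum>i<m. \<Sum>j<m. \<Phi> (x i - x j) * cnj (c j) * c i) \<in> \<real>\<^sub>\<ge>\<^sub>0"
      \<comment> \<open>\<open>positive_definite_on\<close> speaks of \<open>m > 0\<close>, whereas
        \<open>posdef_fun\<close> includes the empty sum.\<close>
      proof (cases "m = 0")
        case False
        then show ?thesis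
          using pd[unfolded positive_definite_on_def, rule_format, of m "\<lambda>i. (x i, mat 1)" c] K_one
          by (simp add: eq carrier_G)
      qed simp
    qed
  next
    assume pd: "posdef_fun \<Phi>"
    show "positive_definite_on G (lift_to_motion_group K \<Phi>)"
      unfolding positive_definite_on_def
    proof (intro allI impI)
      fix m :: nat and c :: "nat \<Rightarrow> complex" and g :: "nat \<Rightarrow> (real^'n) \<times> (real^'n^'n)"
      assume "\<forall>i<m. g i \<in> carrier G"
      then have "snd (g i) \<in> K" if "i < m" for i using that by (force simp: carrier_G)
      then have "lift_to_motion_group K \<Phi> (inv\<^bsub>G\<^esub> (g j) \<otimes>\<^bsub>G\<^esub> g i) = \<Phi> (fst (g i) - fst (g j))" if "i < m" "j < m" for i j
        using that eq[of "snd (g i)" "snd (g j)" "fst (g j)" "fst (g i)"] by simp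
      then show "(\<Sum>i<m. \<Sum>j<m. lift_to_motion_group K \<Phi> (inv\<^bsub>G\<^esub> (g j) \<otimes>\<^bsub>G\<^esub> g i) * cnj (c j) * c i) \<in> \<real>\<^sub>\<ge>\<^sub>0"
        using posdef_funD[OF pd, where m = m and c = c and x = "\<lambda>i. fst (g i)"] by simp
    qed
  qed
qed

lemma posdef_spherical_functions_eq:
  "posdef_spherical_functions G ({0} \<times> K) \<mu>\<^sub>G = range (\<lambda>\<xi>. lift_to_motion_group K (sph \<xi>))"
proof (intro equalityI subsetI)
  fix \<phi> assume "\<phi> \<in> posdef_spherical_functions G ({0} \<times> K) \<mu>\<^sub>G"
  then have ext: "\<phi> \<in> extensional (UNIV \<times> K)" and cont: "continuous_on (UNIV \<times> K) \<phi>"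
    and bi: "bi_invariant G ({0} \<times> K) \<phi>" and one: "\<phi> (0, mat 1) = 1"
    and eigen: "\<And>f. f \<in> Cc_biinv G ({0} \<times> K) \<Longrightarrow> \<exists>c. \<forall>g\<in>UNIV \<times> K. group_convolution G \<mu>\<^sub>G f \<phi> g = c * \<phi> g"
    and pd: "positive_definite_on G \<phi>"
    by (auto simp: posdef_spherical_functions_def spherical_functions_def carrier_G one_G)
  define \<Phi> where "\<Phi> x = \<phi> (x, mat 1)" for x
  \<comment> \<open>Membership in \<open>extensional\<close> upgrades agreement on the carrier to
    equality of functions.\<close>
  have \<phi>: "\<phi> = lift_to_motion_group K \<Phi>"
  proof (rule extensionalityI[OF ext])
    show "lift_to_motion_group K \<Phi> \<in> extensional (UNIV \<times> K)"
      by (simp add: lift_to_motion_group_def carrier_G)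
    show "\<phi> z = lift_to_motion_group K \<Phi> z" if "z \<in> UNIV \<times> K" for z
      using that bi_invariant_eq(1)[OF bi] by (auto simp: lift_apply \<Phi>_def)
  qed
  have inv: "K_invariant \<Phi>" using bi_invariant_eq(2)[OF bi] by (simp add: K_invariant_def \<Phi>_def)
  have cont': "continuous_on UNIV \<Phi>"
    unfolding \<Phi>_def[abs_def]
    by (rule continuous_on_compose2[OF cont]) (auto intro!: continuous_intros K_one)
  have "\<exists>\<xi>. \<Phi> = sph \<xi>"
  proof (rule posdef_eigenfunction_is_sph)
    show "posdef_fun \<Phi>" using pd positive_definite_lift[OF inv] by (simp add: \<phi>)
    fix F assume F: "F \<in> test_functions"
    note f = test_function_Cc_biinv[OF F]
    obtain c where "\<forall>g\<in>UNIV \<times> K. group_convolution G \<mu>\<^sub>G (\<lambda>(x, k). F x) \<phi> g = c * \<phi> g"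
      using eigen[OF f] by blast
    then have "group_convolution G \<mu>\<^sub>G (\<lambda>(x, k). F x) \<phi> (x, mat 1) = c * \<phi> (x, mat 1)" for x
      using K_one by blast
    then show "\<exists>c. \<forall>x. (LINT y|\<nu>. F y * \<Phi> (x - y)) = c * \<Phi> x"
      using group_convolution_eq[OF f cont' inv K_one] by (auto simp: \<phi> lift_apply K_one)
  qed (use one inv cont' in \<open>auto simp: \<Phi>_def\<close>)
  then show "\<phi> \<in> range (\<lambda>\<xi>. lift_to_motion_group K (sph \<xi>))" using \<phi> by auto
next
  fix \<phi> assume "\<phi> \<in> range (\<lambda>\<xi>. lift_to_motion_group K (sph \<xi>))"
  then obtain \<xi> where \<phi>: "\<phi> = lift_to_motion_group K (sph \<xi>)" by blast
  have eq: "\<phi> z = (case z of (x, k) \<Rightarrow> sph \<xi> x)" if "z \<in> UNIV \<times> K" for z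
    using that by (auto simp: \<phi> lift_apply)
  have "continuous_on (UNIV \<times> K) (\<lambda>z. sph \<xi> (fst z))"
    by (intro continuous_on_compose2[OF continuous_sph] continuous_intros) auto
  then have "continuous_on (UNIV \<times> K) \<phi>"
    by (rule continuous_on_eq) (use eq in auto)
  moreover have "bi_invariant G ({0} \<times> K) \<phi>"
    unfolding bi_invariant_def
    by (auto simp: carrier_G mult_G \<phi> lift_apply K_mult K_invariantD[OF K_invariant_sph])
  moreover have "\<exists>c. \<forall>g\<in>UNIV \<times> K. group_convolution G \<mu>\<^sub>G f \<phi> g = c * \<phi> g"
    if f: "f \<in> Cc_biinv G ({0} \<times> K)" for f
    using group_convolution_eq[OF f continuous_sph K_invariant_sph] convolution_sph[OF Cc_biinv_test_function(1)[OF f]]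
    by (intro exI[of _ "transform (\<lambda>x. f (x, mat 1)) \<xi>"]) (auto simp: \<phi> lift_apply)
  moreover have "\<phi> \<in> extensional (UNIV \<times> K)" by (simp add: \<phi> lift_to_motion_group_def carrier_G)
  moreover have "\<phi> (0, mat 1) = 1" by (simp add: \<phi> lift_apply K_one)
  moreover have "positive_definite_on G \<phi>"
    using positive_definite_lift[OF K_invariant_sph] posdef_sph by (simp add: \<phi>)
  ultimately show "\<phi> \<in> posdef_spherical_functions G ({0} \<times> K) \<mu>\<^sub>G"
    by (auto simp: posdef_spherical_functions_def spherical_functions_def carrier_G one_G)
qed

section \<open>Invariants as functions on the quotient\<close>

abbreviation "invariants \<equiv> invariant_polynomials (complexify_matrix ` K)"
abbreviation "proj \<equiv> quotient_projection (complexification K)"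

lemma proj_eq_iff: "proj \<xi> = proj \<eta> \<longleftrightarrow> (\<forall>p\<in>invariants. p \<xi> = p \<eta>)"
  unfolding quotient_projection_def quotient_rel_def invariant_polynomials_complexification[OF K_one]
  by (simp add: set_eq_iff) metis

lemma sph_eq_iff: "sph \<xi> = sph \<eta> \<longleftrightarrow> proj (complexify \<xi>) = proj (complexify \<eta>)"
  unfolding proj_eq_iff using sph_eq_if_invariants_eq invariants_eq_if_sph_eq by blast

text \<open>An invariant descends by evaluation at any representative. On sets that are not classes
  \<open>r\<close> takes an arbitrary value, which \<open>regular_functions\<close> does not
  see.\<close>

lemma regular_function_of_invariant:
  assumes p: "p \<in> invariants"
  obtains r where "r \<in> regular_functions (complexification K)" "\<And>\<zeta>. r (proj \<zeta>) = p \<zeta>"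
proof -
  define r where "r c = p (SOME \<zeta>. proj \<zeta> = c)" for c
  have "r (proj \<zeta>) = p \<zeta>" for \<zeta>
  proof -
    have "proj (SOME \<eta>. proj \<eta> = proj \<zeta>) = proj \<zeta>" by (rule someI) (rule refl)
    then show ?thesis using p unfolding r_def proj_eq_iff by blast
  qed
  then show thesis using p
    by (intro that[of r])
      (auto simp: regular_functions_def o_def invariant_polynomials_complexification[OF K_one])
qed

lemma regular_function_invariant:
  "r \<in> regular_functions (complexification K) \<Longrightarrow> (\<lambda>\<zeta>. r (proj \<zeta>)) \<in> invariants"
  by (simp add: regular_functions_def o_def invariant_polynomials_complexification[OF K_one])

text \<open>Orthonormality of the columns of \<open>k\<close> is an identity between its real
  entries, so it also applies to complex vectors. At real points this invariant is the squared norm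
  and bounds the parameter on the quotient side.\<close>

lemma norm_squared_invariant: "(\<lambda>\<zeta>. cbilinear \<zeta> \<zeta>) \<in> invariants"
proof -
  have "complex_polynomial (\<lambda>\<zeta>::complex^'n. cbilinear \<zeta> \<zeta>)"
    unfolding cbilinear_def by (intro complex_polynomial_sum complex_polynomial.intros)
  moreover have "cbilinear (complexify_matrix k *v \<zeta>) (complexify_matrix k *v \<zeta>) = cbilinear \<zeta> \<zeta>"
    if k: "k \<in> K" for k and \<zeta> :: "complex^'n"
  proof -
    let ?k = "complexify_matrix k"
    have "(\<Sum>i\<in>UNIV. k $ i $ j * k $ i $ l) = (if j = l then 1 else 0)" for j l
      using K_transpose_mult(1)[OF k] by (simp add: vec_eq_iff matrix_matrix_mult_def transpose_def mat_def)
    then have "complex_of_real (\<Sum>i\<in>UNIV. k $ i $ j * k $ i $ l) = of_real (if j = l then 1 else 0)" for j l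
      by (simp only:)
    then have entry: "(\<Sum>i\<in>UNIV. ?k $ i $ j * ?k $ i $ l) = (if j = l then 1 else 0)" for j l
      by (simp add: map_matrix_def)
    have "cbilinear (?k *v \<zeta>) (?k *v \<zeta>) = (\<Sum>i\<in>UNIV. \<Sum>j\<in>UNIV. \<Sum>l\<in>UNIV. ?k $ i $ j * \<zeta> $ j * (?k $ i $ l * \<zeta> $ l))"
      by (simp add: cbilinear_def matrix_vector_mult_def sum_product)
    also have "\<dots> = (\<Sum>j\<in>UNIV. \<Sum>l\<in>UNIV. \<Sum>i\<in>UNIV. ?k $ i $ j * \<zeta> $ j * (?k $ i $ l * \<zeta> $ l))"
      by (subst sum.swap, subst (2) sum.swap) (rule refl)
    also have "\<dots> = (\<Sum>j\<in>UNIV. \<Sum>l\<in>UNIV. \<zeta> $ j * \<zeta> $ l * (\<Sum>i\<in>UNIV. ?k $ i $ j * ?k $ i $ l))"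
      by (simp add: sum_distrib_left mult_ac)
    also have "\<dots> = cbilinear \<zeta> \<zeta>"
      unfolding entry by (simp add: cbilinear_def if_distrib[of "\<lambda>x. _ * x"] cong: if_cong)
    finally show ?thesis .
  qed
  ultimately show ?thesis by (auto simp: invariant_polynomials_def)
qed

text \<open>If every transform vanished at \<eta>, separation would give
  \<open>sph \<eta> 0 = 0\<close>. Near a nonzero value, within half its modulus, vanishing at
  infinity excludes large \<xi>.\<close>

lemma transform_tight:
  "\<exists>F\<in>test_functions. \<exists>r>0. bounded {\<xi>. dist (transform F \<xi>) (transform F \<eta>) < r}"
proof -
  have "\<exists>F\<in>test_functions. transform F \<eta> \<noteq> 0"
  proof (rule ccontr)
    assume no: "\<not> ?thesis"
    note K_invariant_reflect[OF K_invariant_sph, of \<eta>]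
    moreover have "continuous_on UNIV (\<lambda>y. sph \<eta> (- y))"
      by (intro continuous_on_compose2[OF continuous_sph] continuous_intros) auto
    moreover have "(LINT y|\<nu>. F y * sph \<eta> (- y)) = 0" if "F \<in> test_functions" for F
      using convolution_sph[OF that, of \<eta> 0] no that by simp
    ultimately have "sph \<eta> (- 0) = 0"
      by (intro test_functions_separate[where h = "\<lambda>y. sph \<eta> (- y)" and x = 0])
    then show False by simp
  qed
  then obtain F where F: "F \<in> test_functions" "transform F \<eta> \<noteq> 0" by blast
  define r where "r = norm (transform F \<eta>) / 2"
  have r: "r > 0" using F by (simp add: r_def)
  obtain R where R: "\<And>\<xi>. norm \<xi> > R \<Longrightarrow> norm (transform F \<xi>) < r"
    using transform_vanishes_at_infinity[OF F(1) r] by blast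
  have "norm \<xi> \<le> R" if "dist (transform F \<xi>) (transform F \<eta>) < r" for \<xi>
  proof (rule ccontr)
    assume "\<not> norm \<xi> \<le> R"
    then have "norm (transform F \<xi>) < r" by (intro R) simp
    then show False
      using that norm_triangle_ineq2[of "transform F \<eta>" "transform F \<xi>"]
      by (simp add: r_def dist_norm norm_minus_commute)
  qed
  then have "bounded {\<xi>. dist (transform F \<xi>) (transform F \<eta>) < r}" by (auto simp: bounded_iff)
  then show ?thesis using F(1) r by blast
qed

lemma norm_squared_tight: "bounded {\<xi>. dist (cbilinear (complexify \<xi>) (complexify \<xi>)) (cbilinear (complexify \<eta>) (complexify \<eta>)) < 1}"
proof -
  \<comment> \<open>One summand \<open>1\<close> comes from the assumed distance, the other from
    \<open>norm \<xi> \<le> (norm \<xi>)\<^sup>2 + 1\<close>.\<close>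
  have "norm \<xi> \<le> (norm \<eta>)\<^sup>2 + 1 + 1"
    if "dist (cbilinear (complexify \<xi>) (complexify \<xi>)) (cbilinear (complexify \<eta>) (complexify \<eta>)) < 1" for \<xi>
  proof -
    have "\<bar>(norm \<xi>)\<^sup>2 - (norm \<eta>)\<^sup>2\<bar> < 1"
      using that by (simp add: cbilinear_complexify dist_norm norm_of_real power2_norm_eq_inner flip: of_real_diff)
    moreover have "norm \<xi> \<le> (norm \<xi>)\<^sup>2 + 1"
    proof -
      have "2 * norm \<xi> \<le> (norm \<xi>)\<^sup>2 + 1"
        using zero_le_power2[of "norm \<xi> - 1"] by (simp add: power2_diff)
      then show ?thesis using norm_ge_zero[of \<xi>] by linarith
    qed
    ultimately show ?thesis by linarith
  qed
  then show ?thesis by (auto simp: bounded_iff)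
qed

text \<open>\<open>transform F \<xi>\<close> is the integral of \<open>F\<close> against the
  reflected \<open>sph \<xi>\<close>, and test functions separate continuous
  \<open>K\<close>-invariant functions.\<close>

lemma transforms_separate:
  assumes "\<forall>F\<in>test_functions. transform F \<xi> = transform F \<eta>"
  shows "sph \<xi> = sph \<eta>"
proof -
  have "K_invariant (\<lambda>y. sph \<xi> (- y) - sph \<eta> (- y))"
    using K_invariant_reflect[OF K_invariant_sph, of \<xi>] K_invariant_reflect[OF K_invariant_sph, of \<eta>]
    by (simp add: K_invariant_def)
  moreover have cont: "continuous_on UNIV (\<lambda>y. sph z (- y))" for z
    by (intro continuous_on_compose2[OF continuous_sph] continuous_intros) auto
  have "(LINT y|\<nu>. F y * (sph \<xi> (- y) - sph \<eta> (- y))) = 0" if F: "F \<in> test_functions" for F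
  proof -
    have int: "integrable \<nu> (\<lambda>y. F y * sph z (- y))" for z
    proof (rule Bochner_Integration.integrable_bound[OF test_function_integrable[OF F]])
      show "(\<lambda>y. F y * sph z (- y)) \<in> borel_measurable \<nu>"
        using borel_measurable_continuous_onI[OF cont] test_function_measurable[OF F]
        by (simp add: measurable_cong_sets[OF sets_\<nu> refl])
      have "norm (sph z y) \<le> 1" for y using posdef_fun_bounds(2)[OF posdef_sph, of z y] by simp
      then show "AE y in \<nu>. norm (F y * sph z (- y)) \<le> norm (F y)"
        by (simp add: norm_mult mult_left_le)
    qed
    have "(LINT y|\<nu>. F y * (sph \<xi> (- y) - sph \<eta> (- y))) = (LINT y|\<nu>. F y * sph \<xi> (- y)) - (LINT y|\<nu>. F y * sph \<eta> (- y))"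
      unfolding right_diff_distrib by (rule Bochner_Integration.integral_diff[OF int int])
    then show ?thesis
      using convolution_sph[OF F, of \<xi> 0] convolution_sph[OF F, of \<eta> 0] assms F by simp
  qed
  ultimately have "sph \<xi> (- x) - sph \<eta> (- x) = 0" for x
    by (intro test_functions_separate[where h = "\<lambda>y. sph \<xi> (- y) - sph \<eta> (- y)"] continuous_on_diff cont)
  from this[of "- _"] show ?thesis by auto
qed

theorem homeomorphism:
  assumes F: "\<And>\<xi>. F (lift_to_motion_group K (sph \<xi>)) = proj (complexify \<xi>)"
  shows "homeomorphic_map
    (subtopology (spherical_topology G ({0} \<times> K) \<mu>\<^sub>G) (posdef_spherical_functions G ({0} \<times> K) \<mu>\<^sub>G))
    (subtopology (categorical_quotient_topology (complexification K)) (real_form K)) F"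
proof -
  define \<Phi> where "\<Phi> \<xi> = lift_to_motion_group K (sph \<xi>)" for \<xi>
  define \<Psi> where "\<Psi> \<xi> = proj (complexify \<xi>)" for \<xi> :: "real^'n"
  have P: "posdef_spherical_functions G ({0} \<times> K) \<mu>\<^sub>G = range \<Phi>"
    unfolding \<Phi>_def by (rule posdef_spherical_functions_eq)
  have R: "real_form K = range \<Psi>" by (simp add: real_form_def \<Psi>_def)
  have S1: "range \<Phi> \<subseteq> spherical_functions G ({0} \<times> K) \<mu>\<^sub>G"
    unfolding P[symmetric] by (auto simp: posdef_spherical_functions_def)
  have S2: "range \<Psi> \<subseteq> categorical_quotient (complexification K)"
    by (auto simp: \<Psi>_def categorical_quotient_def quotient_projection_def quotientI)
  \<comment> \<open>The two parametrizations have the same fibres, which makes the map injective and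
    lets each continuity argument use the separation proved on its own side.\<close>
  have \<Phi>_\<Psi>: "\<Phi> \<xi> = \<Phi> \<eta> \<longleftrightarrow> \<Psi> \<xi> = \<Psi> \<eta>" for \<xi> \<eta>
    by (simp add: \<Phi>_def \<Psi>_def lift_inj sph_eq_iff)
  have transform: "spherical_transform G \<mu>\<^sub>G f (\<Phi> \<xi>) = transform (\<lambda>x. f (x, mat 1)) \<xi>"
    if "f \<in> Cc_biinv G ({0} \<times> K)" for f \<xi>
    unfolding \<Phi>_def by (rule spherical_transform_sph[OF that])
  have cont_a: "continuous_on UNIV (\<lambda>\<xi>. spherical_transform G \<mu>\<^sub>G f (\<Phi> \<xi>))" if "f \<in> Cc_biinv G ({0} \<times> K)" for f
    unfolding transform[OF that] by (rule continuous_transform[OF Cc_biinv_test_function(1)[OF that]])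
  have cont_b: "continuous_on UNIV (\<lambda>\<xi>. r (\<Psi> \<xi>))" if "r \<in> regular_functions (complexification K)" for r
    using regular_function_invariant[OF that] continuous_on_complex_polynomial[of "\<lambda>\<zeta>. r (proj \<zeta>)" UNIV complexify]
    by (simp add: \<Psi>_def invariant_polynomials_def continuous_intros)
  have sep_a: "\<Phi> \<xi> = \<Phi> \<eta>"
    if eq: "\<forall>f\<in>Cc_biinv G ({0} \<times> K). spherical_transform G \<mu>\<^sub>G f (\<Phi> \<xi>) = spherical_transform G \<mu>\<^sub>G f (\<Phi> \<eta>)" for \<xi> \<eta>
  proof -
    have "transform F \<xi> = transform F \<eta>" if "F \<in> test_functions" for F
      using bspec[OF eq test_function_Cc_biinv[OF that]] transform[OF test_function_Cc_biinv[OF that]] by simp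
    then have "sph \<xi> = sph \<eta>" by (intro transforms_separate) blast
    then show ?thesis by (simp add: \<Phi>_def)
  qed
  have sep_b: "\<Psi> \<xi> = \<Psi> \<eta>" if eq: "\<forall>r\<in>regular_functions (complexification K). r (\<Psi> \<xi>) = r (\<Psi> \<eta>)" for \<xi> \<eta>
    unfolding \<Psi>_def proj_eq_iff
  proof
    fix p assume "p \<in> invariants"
    then obtain r where "r \<in> regular_functions (complexification K)" "\<And>\<zeta>. r (proj \<zeta>) = p \<zeta>"
      by (rule regular_function_of_invariant) blast
    then show "p (complexify \<xi>) = p (complexify \<eta>)" using eq by (simp add: \<Psi>_def) metis
  qed
  have tight_a: "\<exists>f\<in>Cc_biinv G ({0} \<times> K). \<exists>r>0. bounded {\<xi>. dist (spherical_transform G \<mu>\<^sub>G f (\<Phi> \<xi>)) (spherical_transform G \<mu>\<^sub>G f (\<Phi> \<eta>)) < r}" for \<eta>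
  proof -
    obtain F r where F: "F \<in> test_functions" "r > 0" "bounded {\<xi>. dist (transform F \<xi>) (transform F \<eta>) < r}"
      using transform_tight by blast
    then show ?thesis
      using test_function_Cc_biinv[OF F(1)] transform[OF test_function_Cc_biinv[OF F(1)]]
      by (intro bexI[of _ "\<lambda>(x, k). F x"] exI[of _ r]) simp_all
  qed
  have tight_b: "\<exists>s\<in>regular_functions (complexification K). \<exists>r>0. bounded {\<xi>. dist (s (\<Psi> \<xi>)) (s (\<Psi> \<eta>)) < r}" for \<eta>
  proof -
    obtain s where "s \<in> regular_functions (complexification K)" "\<And>\<zeta>. s (proj \<zeta>) = cbilinear \<zeta> \<zeta>"
      using regular_function_of_invariant[OF norm_squared_invariant] by blast
    then show ?thesis
      using norm_squared_tight[of \<eta>] by (intro bexI[of _ s] exI[of _ 1]) (simp_all add: \<Psi>_def)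
  qed
  have ne: "Cc_biinv G ({0} \<times> K) \<noteq> {}" "regular_functions (complexification K) \<noteq> {}"
    using tight_a tight_b by blast+
  have F: "F (\<Phi> \<xi>) = \<Psi> \<xi>" for \<xi> using F by (simp add: \<Phi>_def \<Psi>_def)
  \<comment> \<open>The inverse map; any parameter over \<open>c\<close> serves, since \<Phi> is
    constant on the fibres of \<Psi>.\<close>
  define H where "H c = \<Phi> (SOME \<xi>. \<Psi> \<xi> = c)" for c
  have H: "H (\<Psi> \<xi>) = \<Phi> \<xi>" for \<xi>
    unfolding H_def \<Phi>_\<Psi> by (rule someI) (rule refl)
  have "homeomorphic_maps
    (subtopology (spherical_topology G ({0} \<times> K) \<mu>\<^sub>G) (range \<Phi>))
    (subtopology (categorical_quotient_topology (complexification K)) (range \<Psi>)) F H"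
    unfolding homeomorphic_maps_def spherical_topology_def categorical_quotient_topology_def
  proof (intro conjI)
    show "continuous_map
      (subtopology (topology_generated_by {{\<phi> \<in> spherical_functions G ({0} \<times> K) \<mu>\<^sub>G. spherical_transform G \<mu>\<^sub>G f \<phi> \<in> U} | f U.
          f \<in> Cc_biinv G ({0} \<times> K) \<and> open U}) (range \<Phi>))
      (subtopology (topology_generated_by {{c \<in> categorical_quotient (complexification K). r c \<in> U} | r U.
          r \<in> regular_functions (complexification K) \<and> open U}) (range \<Psi>)) F"
      using sep_a \<Phi>_\<Psi> by (intro continuous_map_between_initial_topologies S1 S2 ne cont_a cont_b tight_a F) blast+
    show "continuous_map
      (subtopology (topology_generated_by {{c \<in> categorical_quotient (complexification K). r c \<in> U} | r U.
          r \<in> regular_functions (complexification K) \<and> open U}) (range \<Psi>))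
      (subtopology (topology_generated_by {{\<phi> \<in> spherical_functions G ({0} \<times> K) \<mu>\<^sub>G. spherical_transform G \<mu>\<^sub>G f \<phi> \<in> U} | f U.
          f \<in> Cc_biinv G ({0} \<times> K) \<and> open U}) (range \<Phi>)) H"
      using sep_b \<Phi>_\<Psi> by (intro continuous_map_between_initial_topologies[where a = "\<lambda>r c. r c"] S1 S2 ne cont_a cont_b tight_b H) blast+
  qed (auto simp: F H)
  then show ?thesis
    unfolding P R by (rule homeomorphic_maps_map[THEN iffD1, THEN conjunct1])
qed

end

theorem theorem5p5:
  fixes K :: "(real^'n^'n) set"
    and \<mu>\<^sub>K :: "(real^'n^'n) measure"
    and \<mu>\<^sub>G :: "((real^'n) \<times> (real^'n^'n)) measure"
  assumes "subgroup K orthogonal_group" and "closed K"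
    and "haar_measure (orthogonal_group\<lparr>carrier := K\<rparr>) \<mu>\<^sub>K" and "emeasure \<mu>\<^sub>K K = 1"
    and "haar_measure (motion_group K) \<mu>\<^sub>G"
  shows "posdef_spherical_functions (motion_group K) ({0} \<times> K) \<mu>\<^sub>G =
           range (\<lambda>\<xi>. lift_to_motion_group K (spherical_phi \<mu>\<^sub>K (complexify \<xi>))) \<and>
         (\<exists>F. (\<forall>\<xi>. F (lift_to_motion_group K (spherical_phi \<mu>\<^sub>K (complexify \<xi>))) =
                   quotient_projection (complexification K) (complexify \<xi>)) \<and>
              homeomorphic_map
                (subtopology (spherical_topology (motion_group K) ({0} \<times> K) \<mu>\<^sub>G)
                   (posdef_spherical_functions (motion_group K) ({0} \<times> K) \<mu>\<^sub>G))
                (subtopology (categorical_quotient_topology (complexification K)) (real_form K))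
                F)"
proof -
  interpret motion_group_haar K \<mu>\<^sub>K \<mu>\<^sub>G
    by (intro motion_group_haar.intro assms)
  \<comment> \<open>A parameter is chosen for each function; by \<open>sph_eq_iff\<close> its
    projection does not depend on the choice.\<close>
  define F where "F \<phi> = proj (complexify (SOME \<xi>. lift_to_motion_group K (sph \<xi>) = \<phi>))" for \<phi>
  have F: "F (lift_to_motion_group K (sph \<xi>)) = proj (complexify \<xi>)" for \<xi>
  proof -
    have "lift_to_motion_group K (sph (SOME \<eta>. lift_to_motion_group K (sph \<eta>) = lift_to_motion_group K (sph \<xi>)))
        = lift_to_motion_group K (sph \<xi>)"
      by (rule someI) (rule refl)
    then show ?thesis unfolding F_def lift_inj sph_eq_iff .
  qed
  then show ?thesis
    unfolding spherical_phi_eq_sph using posdef_spherical_functions_eq homeomorphism[OF F] by blast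
qed

end
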